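(* Let $\mathcal X$ be a semi-abelian category and let $$0\to A\xrightarrow{a}X\xrightarrow{p}G\to0$$ be a short exact sequence in $\mathcal X$ whose kernel $A$ is an abelian object. Then the following are equivalent: (i) $p$ is an abelian extension; (ii) the Smith/Pedicchio commutator $[X\times_GX,X\times_GX]$ (of the kernel pair of $p$ with itself) vanishes; (iii) $[A,A,X]=0$; (iv) $c_{2,1}^{A,X}=0$; (v) the conjugation action $c^{A,X}$ of $X$ on $A$ factors through a (necessarily unique) action $\psi_p$ of $G$ on $A$, that is, $c^{A,X}=\psi_p\circ(1_A\diamond p)$ for an action core $\psi_p\colon A\diamond G\to A$; (vi) there exists a morphism $\psi_p\colon A\diamond G\to A$ (not assumed to be an action core) such that $c^{A,X}=\psi_p\circ(1_A\diamond p)$.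
   Context: A semi-abelian category is a pointed, Barr-exact, Bourn-protomodular category with finite coproducts. **Cosmash products and commutators.** The cosmash product $X\diamond Y$ is the kernel $\iota_{X,Y}$ of the canonical morphism $X+Y\to X\times Y$; the ternary cosmash product $X\diamond Y\diamond Z$ is the kernel $\iota_{X,Y,Z}$ of the canonical morphism $X+Y+Z\to(X+Y)\times(X+Z)\times(Y+Z)$ whose components kill $Z$, $Y$, $X$ respectively. For subobjects $K,L,M$ of $X$, $[K,L,M]\leq X$ is the image of $K\diamond L\diamond M\to K+L+M\to X$. The morphism $S_{2,1}^{X,Y}\colon X\diamond X\diamond Y\to X\diamond Y$ is the restriction of $\nabla_X+1_Y\colon X+X+Y\to X+Y$, where $\nabla_X$ is the codiagonal. **Abelian notions.** An object is abelian if it admits an internal abelian group structure. A regular epimorphism $p\colon X\to G$ is an abelian extension if it is an abelian object of the slice category $(\mathcal X\downarrow G)$, i.e. it admits an internal Mal'tsev operation there. **Actions.** For objects $A,X$, let $\mathrm{T}_X(A)$ be the kernel of the morphism $A+X\to X$ which is $0$ on $A$ and $1_X$ on $X$; $\mathrm T_X$ is a monad on $\mathcal X$, and an internal action of $X$ on $A$ is a $\mathrm T_X$-algebra structure $\xi\colon \mathrm T_X(A)\to A$. The cosmash product $A\diamond X$ is canonically included in $\mathrm T_X(A)$; the restriction $\psi\colon A\diamond X\to A$ of an action $\xi$ is called the core of $\xi$, and a morphism $\psi\colon A\diamond X\to A$ which arises in this way is an action core. An action core determines the action uniquely, so actions are identified with their cores. **Conjugation.** For a normal subobject $A$ of $X$,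 the conjugation action of $X$ on $A$ is (the action with core) the unique restriction $c^{A,X}\colon A\diamond X\to A$ of $c^{X,X}=\nabla_X\circ\iota_{X,X}\colon X\diamond X\to X$. Put $c_{2,1}^{A,X}=c^{A,X}\circ S_{2,1}^{A,X}\colon A\diamond A\diamond X\to A$. *)

theory Defs
  imports Main
begin

section \<open>Categories\<close>

record ('o, 'm) cat =
  Ob :: "'o set"
  Ar :: "'m set"
  Dom :: "'m \<Rightarrow> 'o"
  Cod :: "'m \<Rightarrow> 'o"
  Ide :: "'o \<Rightarrow> 'm"
  Comp :: "'m \<Rightarrow> 'm \<Rightarrow> 'm"

abbreviation comp_in :: "'m \<Rightarrow> ('o, 'm) cat \<Rightarrow> 'm \<Rightarrow> 'm"  ("(_ \<cdot>\<^bsub>_\<^esub> _)" [71, 0, 70] 70)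
  where "g \<cdot>\<^bsub>C\<^esub> f \<equiv> Comp C g f"

definition Hom :: "('o, 'm) cat \<Rightarrow> 'o \<Rightarrow> 'o \<Rightarrow> 'm set"
  where "Hom C X Y = {f \<in> Ar C. Dom C f = X \<and> Cod C f = Y}"

locale category =
  fixes C :: "('o, 'm) cat"
  assumes dom_in_Ob: "f \<in> Ar C \<Longrightarrow> Dom C f \<in> Ob C"
    and cod_in_Ob: "f \<in> Ar C \<Longrightarrow> Cod C f \<in> Ob C"
    and id_in_Hom: "X \<in> Ob C \<Longrightarrow> Ide C X \<in> Hom C X X"
    and comp_in_Hom: "f \<in> Hom C X Y \<Longrightarrow> g \<in> Hom C Y Z \<Longrightarrow> g \<cdot>\<^bsub>C\<^esub> f \<in> Hom C X Z"
    and id_left: "f \<in> Hom C X Y \<Longrightarrow> Ide C Y \<cdot>\<^bsub>C\<^esub> f = f"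
    and id_right: "f \<in> Hom C X Y \<Longrightarrow> f \<cdot>\<^bsub>C\<^esub> Ide C X = f"
    and comp_assoc: "f \<in> Hom C W X \<Longrightarrow> g \<in> Hom C X Y \<Longrightarrow> h \<in> Hom C Y Z \<Longrightarrow>
      (h \<cdot>\<^bsub>C\<^esub> g) \<cdot>\<^bsub>C\<^esub> f = h \<cdot>\<^bsub>C\<^esub> (g \<cdot>\<^bsub>C\<^esub> f)"

text \<open>An arrow of the slice over \<open>G\<close> is a triple \<open>(p, q, f)\<close> with \<open>f\<close> a morphism from \<open>p\<close> to \<open>q\<close>;
  the endpoints are recorded because \<open>f\<close> alone does not determine them.\<close>

definition slice :: "('o, 'm) cat \<Rightarrow> 'o \<Rightarrow> ('m, 'm \<times> 'm \<times> 'm) cat"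
  where "slice C G = \<lparr>
    Ob = {p \<in> Ar C. Cod C p = G},
    Ar = {(p, q, f). p \<in> Ar C \<and> q \<in> Ar C \<and> Cod C p = G \<and> Cod C q = G \<and>
            f \<in> Hom C (Dom C p) (Dom C q) \<and> q \<cdot>\<^bsub>C\<^esub> f = p},
    Dom = (\<lambda>(p, q, f). p),
    Cod = (\<lambda>(p, q, f). q),
    Ide = (\<lambda>p. (p, p, Ide C (Dom C p))),
    Comp = (\<lambda>(q', r, g) (p, q, f). (p, r, g \<cdot>\<^bsub>C\<^esub> f)) \<rparr>"

lemma category_slice:
  assumes "category C"
  shows "category (slice C G)"
proof -
  interpret category C by fact
  have Hom_slice: "F \<in> Hom (slice C G) p q \<longleftrightarrow> (\<exists>f. F = (p, q, f) \<and> p \<in> Ar C \<and> q \<in> Ar C \<and>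
      Cod C p = G \<and> Cod C q = G \<and> f \<in> Hom C (Dom C p) (Dom C q) \<and> q \<cdot>\<^bsub>C\<^esub> f = p)" for F p q
    by (cases F) (auto simp: Hom_def slice_def)
  have Comp_slice: "Comp (slice C K) (q', r, g) (p, q, f) = (p, r, g \<cdot>\<^bsub>C\<^esub> f)" for K q' r g p q f
    by (simp add: slice_def)
  have Ide_slice: "Ide (slice C K) p = (p, p, Ide C (Dom C p))" for K p
    by (simp add: slice_def)
  have Hom_self: "p \<in> Hom C (Dom C p) (Cod C p)" if "p \<in> Ar C" for p
    using that by (simp add: Hom_def)
  show ?thesis
  proof
    fix f assume "f \<in> Ar (slice C G)"
    then show "Dom (slice C G) f \<in> Ob (slice C G)" and "Cod (slice C G) f \<in> Ob (slice C G)"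
      by (auto simp: slice_def)
  next
    fix p assume "p \<in> Ob (slice C G)"
    then have "p \<in> Ar C" "Cod C p = G" by (auto simp: slice_def)
    then show "Ide (slice C G) p \<in> Hom (slice C G) p p"
      by (simp add: Hom_slice Ide_slice id_in_Hom dom_in_Ob id_right[OF Hom_self])
  next
    fix F H p q r assume "F \<in> Hom (slice C G) p q" "H \<in> Hom (slice C G) q r"
    then obtain f h where *: "F = (p, q, f)" "H = (q, r, h)" "p \<in> Ar C" "q \<in> Ar C" "r \<in> Ar C"
      "Cod C p = G" "Cod C r = G" "f \<in> Hom C (Dom C p) (Dom C q)" "q \<cdot>\<^bsub>C\<^esub> f = p"
      "h \<in> Hom C (Dom C q) (Dom C r)" "r \<cdot>\<^bsub>C\<^esub> h = q"
      by (auto simp: Hom_slice)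
    have "r \<cdot>\<^bsub>C\<^esub> (h \<cdot>\<^bsub>C\<^esub> f) = p"
      using comp_assoc[OF *(8,10) Hom_self[OF *(5)]] *(9,11) by simp
    with * comp_in_Hom[OF *(8,10)] show "H \<cdot>\<^bsub>slice C G\<^esub> F \<in> Hom (slice C G) p r"
      by (simp add: Hom_slice Comp_slice)
  next
    fix F p q assume "F \<in> Hom (slice C G) p q"
    then show "Ide (slice C G) q \<cdot>\<^bsub>slice C G\<^esub> F = F" and "F \<cdot>\<^bsub>slice C G\<^esub> Ide (slice C G) p = F"
      by (auto simp: Hom_slice Comp_slice Ide_slice id_left id_right)
  next
    fix F H K o' p q r
    assume "F \<in> Hom (slice C G) o' p" "H \<in> Hom (slice C G) p q" "K \<in> Hom (slice C G) q r"
    then show "(K \<cdot>\<^bsub>slice C G\<^esub> H) \<cdot>\<^bsub>slice C G\<^esub> F = K \<cdot>\<^bsub>slice C G\<^esub> (H \<cdot>\<^bsub>slice C G\<^esub> F)"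
      by (auto simp: Hom_slice Comp_slice intro: comp_assoc)
  qed
qed

section \<open>Morphisms, limits and colimits\<close>

definition monic :: "('o, 'm) cat \<Rightarrow> 'm \<Rightarrow> bool"
  where "monic C m \<longleftrightarrow> m \<in> Ar C \<and>
    (\<forall>T u v. u \<in> Hom C T (Dom C m) \<longrightarrow> v \<in> Hom C T (Dom C m) \<longrightarrow> m \<cdot>\<^bsub>C\<^esub> u = m \<cdot>\<^bsub>C\<^esub> v \<longrightarrow> u = v)"

definition is_iso :: "('o, 'm) cat \<Rightarrow> 'm \<Rightarrow> bool"
  where "is_iso C f \<longleftrightarrow> f \<in> Ar C \<and>
    (\<exists>g \<in> Hom C (Cod C f) (Dom C f). g \<cdot>\<^bsub>C\<^esub> f = Ide C (Dom C f) \<and> f \<cdot>\<^bsub>C\<^esub> g = Ide C (Cod C f))"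

definition is_terminal :: "('o, 'm) cat \<Rightarrow> 'o \<Rightarrow> bool"
  where "is_terminal C T \<longleftrightarrow> T \<in> Ob C \<and> (\<forall>X \<in> Ob C. \<exists>!f. f \<in> Hom C X T)"

definition is_initial :: "('o, 'm) cat \<Rightarrow> 'o \<Rightarrow> bool"
  where "is_initial C T \<longleftrightarrow> T \<in> Ob C \<and> (\<forall>X \<in> Ob C. \<exists>!f. f \<in> Hom C T X)"

definition is_zero :: "('o, 'm) cat \<Rightarrow> 'o \<Rightarrow> bool"
  where "is_zero C Z \<longleftrightarrow> is_initial C Z \<and> is_terminal C Z"

definition is_product :: "('o, 'm) cat \<Rightarrow> 'o \<Rightarrow> 'o \<Rightarrow> 'm \<Rightarrow> 'm \<Rightarrow> bool"
  where "is_product C X Y p q \<longleftrightarrow>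
    p \<in> Hom C (Dom C p) X \<and> q \<in> Hom C (Dom C p) Y \<and>
    (\<forall>T. \<forall>u \<in> Hom C T X. \<forall>v \<in> Hom C T Y.
      \<exists>!h. h \<in> Hom C T (Dom C p) \<and> p \<cdot>\<^bsub>C\<^esub> h = u \<and> q \<cdot>\<^bsub>C\<^esub> h = v)"

definition is_coproduct :: "('o, 'm) cat \<Rightarrow> 'o \<Rightarrow> 'o \<Rightarrow> 'm \<Rightarrow> 'm \<Rightarrow> bool"
  where "is_coproduct C X Y i j \<longleftrightarrow>
    i \<in> Hom C X (Cod C i) \<and> j \<in> Hom C Y (Cod C i) \<and>
    (\<forall>T. \<forall>u \<in> Hom C X T. \<forall>v \<in> Hom C Y T.
      \<exists>!h. h \<in> Hom C (Cod C i) T \<and> h \<cdot>\<^bsub>C\<^esub> i = u \<and> h \<cdot>\<^bsub>C\<^esub> j = v)"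

definition is_pullback :: "('o, 'm) cat \<Rightarrow> 'm \<Rightarrow> 'm \<Rightarrow> 'm \<Rightarrow> 'm \<Rightarrow> bool"
  where "is_pullback C f g p q \<longleftrightarrow>
    f \<in> Ar C \<and> g \<in> Ar C \<and> Cod C f = Cod C g \<and>
    p \<in> Hom C (Dom C p) (Dom C f) \<and> q \<in> Hom C (Dom C p) (Dom C g) \<and> f \<cdot>\<^bsub>C\<^esub> p = g \<cdot>\<^bsub>C\<^esub> q \<and>
    (\<forall>T. \<forall>u \<in> Hom C T (Dom C f). \<forall>v \<in> Hom C T (Dom C g). f \<cdot>\<^bsub>C\<^esub> u = g \<cdot>\<^bsub>C\<^esub> v \<longrightarrow>
      (\<exists>!h. h \<in> Hom C T (Dom C p) \<and> p \<cdot>\<^bsub>C\<^esub> h = u \<and> q \<cdot>\<^bsub>C\<^esub> h = v))"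

definition is_coequalizer :: "('o, 'm) cat \<Rightarrow> 'm \<Rightarrow> 'm \<Rightarrow> 'm \<Rightarrow> bool"
  where "is_coequalizer C u v e \<longleftrightarrow>
    u \<in> Ar C \<and> v \<in> Hom C (Dom C u) (Cod C u) \<and>
    e \<in> Hom C (Cod C u) (Cod C e) \<and> e \<cdot>\<^bsub>C\<^esub> u = e \<cdot>\<^bsub>C\<^esub> v \<and>
    (\<forall>T. \<forall>f \<in> Hom C (Cod C u) T. f \<cdot>\<^bsub>C\<^esub> u = f \<cdot>\<^bsub>C\<^esub> v \<longrightarrow>
      (\<exists>!h. h \<in> Hom C (Cod C e) T \<and> h \<cdot>\<^bsub>C\<^esub> e = f))"

definition regular_epi :: "('o, 'm) cat \<Rightarrow> 'm \<Rightarrow> bool"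
  where "regular_epi C e \<longleftrightarrow> (\<exists>u v. is_coequalizer C u v e)"

section \<open>Semi-abelian categories\<close>

definition pointed :: "('o, 'm) cat \<Rightarrow> bool"
  where "pointed C \<longleftrightarrow> (\<exists>Z. is_zero C Z)"

definition finitely_complete :: "('o, 'm) cat \<Rightarrow> bool"
  where "finitely_complete C \<longleftrightarrow> (\<exists>T. is_terminal C T) \<and>
    (\<forall>f \<in> Ar C. \<forall>g \<in> Ar C. Cod C f = Cod C g \<longrightarrow> (\<exists>p q. is_pullback C f g p q))"

definition has_finite_coproducts :: "('o, 'm) cat \<Rightarrow> bool"
  where "has_finite_coproducts C \<longleftrightarrow> (\<exists>T. is_initial C T) \<and>
    (\<forall>X \<in> Ob C. \<forall>Y \<in> Ob C. \<exists>i j. is_coproduct C X Y i j)"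

definition regular_category :: "('o, 'm) cat \<Rightarrow> bool"
  where "regular_category C \<longleftrightarrow> category C \<and> finitely_complete C \<and>
    (\<forall>f k\<^sub>0 k\<^sub>1. is_pullback C f f k\<^sub>0 k\<^sub>1 \<longrightarrow> (\<exists>e. is_coequalizer C k\<^sub>0 k\<^sub>1 e)) \<and>
    (\<forall>f g p q. regular_epi C f \<longrightarrow> is_pullback C f g p q \<longrightarrow> regular_epi C q)"

definition is_equivalence_relation :: "('o, 'm) cat \<Rightarrow> 'o \<Rightarrow> 'm \<Rightarrow> 'm \<Rightarrow> bool"
  where "is_equivalence_relation C X r\<^sub>0 r\<^sub>1 \<longleftrightarrow>
    r\<^sub>0 \<in> Hom C (Dom C r\<^sub>0) X \<and> r\<^sub>1 \<in> Hom C (Dom C r\<^sub>0) X \<and>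
    (\<forall>T. \<forall>u \<in> Hom C T (Dom C r\<^sub>0). \<forall>v \<in> Hom C T (Dom C r\<^sub>0).
      r\<^sub>0 \<cdot>\<^bsub>C\<^esub> u = r\<^sub>0 \<cdot>\<^bsub>C\<^esub> v \<longrightarrow> r\<^sub>1 \<cdot>\<^bsub>C\<^esub> u = r\<^sub>1 \<cdot>\<^bsub>C\<^esub> v \<longrightarrow> u = v) \<and>
    (\<exists>e \<in> Hom C X (Dom C r\<^sub>0). r\<^sub>0 \<cdot>\<^bsub>C\<^esub> e = Ide C X \<and> r\<^sub>1 \<cdot>\<^bsub>C\<^esub> e = Ide C X) \<and>
    (\<exists>s \<in> Hom C (Dom C r\<^sub>0) (Dom C r\<^sub>0). r\<^sub>0 \<cdot>\<^bsub>C\<^esub> s = r\<^sub>1 \<and> r\<^sub>1 \<cdot>\<^bsub>C\<^esub> s = r\<^sub>0) \<and>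
    (\<forall>u v. is_pullback C r\<^sub>1 r\<^sub>0 u v \<longrightarrow>
      (\<exists>t \<in> Hom C (Dom C u) (Dom C r\<^sub>0). r\<^sub>0 \<cdot>\<^bsub>C\<^esub> t = r\<^sub>0 \<cdot>\<^bsub>C\<^esub> u \<and> r\<^sub>1 \<cdot>\<^bsub>C\<^esub> t = r\<^sub>1 \<cdot>\<^bsub>C\<^esub> v))"

definition barr_exact :: "('o, 'm) cat \<Rightarrow> bool"
  where "barr_exact C \<longleftrightarrow> regular_category C \<and>
    (\<forall>X r\<^sub>0 r\<^sub>1. is_equivalence_relation C X r\<^sub>0 r\<^sub>1 \<longrightarrow> (\<exists>f. is_pullback C f f r\<^sub>0 r\<^sub>1))"

definition is_point :: "('o, 'm) cat \<Rightarrow> 'o \<Rightarrow> 'm \<Rightarrow> 'm \<Rightarrow> bool"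
  where "is_point C B p s \<longleftrightarrow>
    p \<in> Hom C (Dom C p) B \<and> s \<in> Hom C B (Dom C p) \<and> p \<cdot>\<^bsub>C\<^esub> s = Ide C B"

definition is_point_morphism :: "('o, 'm) cat \<Rightarrow> 'o \<Rightarrow> 'm \<Rightarrow> 'm \<Rightarrow> 'm \<Rightarrow> 'm \<Rightarrow> 'm \<Rightarrow> bool"
  where "is_point_morphism C B p s q t h \<longleftrightarrow> is_point C B p s \<and> is_point C B q t \<and>
    h \<in> Hom C (Dom C p) (Dom C q) \<and> q \<cdot>\<^bsub>C\<^esub> h = p \<and> h \<cdot>\<^bsub>C\<^esub> s = t"

text \<open>Bourn protomodularity: the change-of-base functors of the fibration of points reflect
  isomorphisms.  Below, \<open>p'\<close> and \<open>q'\<close> are the pullbacks of the points \<open>p\<close> and \<open>q\<close> along \<open>f\<close>, and \<open>h'\<close>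
  is the pullback of \<open>h\<close>; the induced sections play no role, since a morphism of points is
  invertible as soon as its underlying morphism is.\<close>

definition protomodular :: "('o, 'm) cat \<Rightarrow> bool"
  where "protomodular C \<longleftrightarrow>
    (\<forall>f p s q t h p' f\<^sub>p q' f\<^sub>q h'.
      is_point_morphism C (Cod C f) p s q t h \<longrightarrow>
      is_pullback C f p p' f\<^sub>p \<longrightarrow> is_pullback C f q q' f\<^sub>q \<longrightarrow>
      h' \<in> Hom C (Dom C p') (Dom C q') \<longrightarrow> q' \<cdot>\<^bsub>C\<^esub> h' = p' \<longrightarrow> f\<^sub>q \<cdot>\<^bsub>C\<^esub> h' = h \<cdot>\<^bsub>C\<^esub> f\<^sub>p \<longrightarrow>
      is_iso C h' \<longrightarrow> is_iso C h)"

definition semi_abelian :: "('o, 'm) cat \<Rightarrow> bool"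
  where "semi_abelian C \<longleftrightarrow>
    category C \<and> pointed C \<and> barr_exact C \<and> protomodular C \<and> has_finite_coproducts C"

section \<open>Chosen universal constructions\<close>

text \<open>From here on universal constructions are fixed by an arbitrary choice; every notion built from
  them is invariant under isomorphism.  Objects are recovered as domains or codomains
  of the chosen structure morphisms.\<close>

definition terminal_obj :: "('o, 'm) cat \<Rightarrow> 'o"
  where "terminal_obj C = (SOME T. is_terminal C T)"

definition terminal_mor :: "('o, 'm) cat \<Rightarrow> 'o \<Rightarrow> 'm"
  where "terminal_mor C X = (THE f. f \<in> Hom C X (terminal_obj C))"

definition proj1 :: "('o, 'm) cat \<Rightarrow> 'o \<Rightarrow> 'o \<Rightarrow> 'm"
  where "proj1 C X Y = fst (SOME pq. is_product C X Y (fst pq) (snd pq))"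

definition proj2 :: "('o, 'm) cat \<Rightarrow> 'o \<Rightarrow> 'o \<Rightarrow> 'm"
  where "proj2 C X Y = snd (SOME pq. is_product C X Y (fst pq) (snd pq))"

definition prod_obj :: "('o, 'm) cat \<Rightarrow> 'o \<Rightarrow> 'o \<Rightarrow> 'o"
  where "prod_obj C X Y = Dom C (proj1 C X Y)"

definition pairing :: "('o, 'm) cat \<Rightarrow> 'm \<Rightarrow> 'm \<Rightarrow> 'm"
  where "pairing C f g = (THE h. h \<in> Hom C (Dom C f) (prod_obj C (Cod C f) (Cod C g)) \<and>
    proj1 C (Cod C f) (Cod C g) \<cdot>\<^bsub>C\<^esub> h = f \<and> proj2 C (Cod C f) (Cod C g) \<cdot>\<^bsub>C\<^esub> h = g)"

definition inj1 :: "('o, 'm) cat \<Rightarrow> 'o \<Rightarrow> 'o \<Rightarrow> 'm"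
  where "inj1 C X Y = fst (SOME ij. is_coproduct C X Y (fst ij) (snd ij))"

definition inj2 :: "('o, 'm) cat \<Rightarrow> 'o \<Rightarrow> 'o \<Rightarrow> 'm"
  where "inj2 C X Y = snd (SOME ij. is_coproduct C X Y (fst ij) (snd ij))"

definition coprod_obj :: "('o, 'm) cat \<Rightarrow> 'o \<Rightarrow> 'o \<Rightarrow> 'o"
  where "coprod_obj C X Y = Cod C (inj1 C X Y)"

definition copairing :: "('o, 'm) cat \<Rightarrow> 'm \<Rightarrow> 'm \<Rightarrow> 'm"
  where "copairing C f g = (THE h. h \<in> Hom C (coprod_obj C (Dom C f) (Dom C g)) (Cod C f) \<and>
    h \<cdot>\<^bsub>C\<^esub> inj1 C (Dom C f) (Dom C g) = f \<and> h \<cdot>\<^bsub>C\<^esub> inj2 C (Dom C f) (Dom C g) = g)"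

definition coprod_mor :: "('o, 'm) cat \<Rightarrow> 'm \<Rightarrow> 'm \<Rightarrow> 'm"
  where "coprod_mor C f g = copairing C
    (inj1 C (Cod C f) (Cod C g) \<cdot>\<^bsub>C\<^esub> f) (inj2 C (Cod C f) (Cod C g) \<cdot>\<^bsub>C\<^esub> g)"

definition codiagonal :: "('o, 'm) cat \<Rightarrow> 'o \<Rightarrow> 'm"
  where "codiagonal C X = copairing C (Ide C X) (Ide C X)"

definition zero_mor :: "('o, 'm) cat \<Rightarrow> 'o \<Rightarrow> 'o \<Rightarrow> 'm"
  where "zero_mor C X Y = (THE f. \<exists>Z u v. is_zero C Z \<and> u \<in> Hom C X Z \<and> v \<in> Hom C Z Y \<and> f = v \<cdot>\<^bsub>C\<^esub> u)"

definition is_kernel :: "('o, 'm) cat \<Rightarrow> 'm \<Rightarrow> 'm \<Rightarrow> bool"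
  where "is_kernel C f k \<longleftrightarrow>
    f \<in> Ar C \<and> k \<in> Hom C (Dom C k) (Dom C f) \<and> f \<cdot>\<^bsub>C\<^esub> k = zero_mor C (Dom C k) (Cod C f) \<and>
    (\<forall>T. \<forall>u \<in> Hom C T (Dom C f). f \<cdot>\<^bsub>C\<^esub> u = zero_mor C T (Cod C f) \<longrightarrow>
      (\<exists>!h. h \<in> Hom C T (Dom C k) \<and> k \<cdot>\<^bsub>C\<^esub> h = u))"

definition is_cokernel :: "('o, 'm) cat \<Rightarrow> 'm \<Rightarrow> 'm \<Rightarrow> bool"
  where "is_cokernel C f q \<longleftrightarrow>
    f \<in> Ar C \<and> q \<in> Hom C (Cod C f) (Cod C q) \<and> q \<cdot>\<^bsub>C\<^esub> f = zero_mor C (Dom C f) (Cod C q) \<and>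
    (\<forall>T. \<forall>u \<in> Hom C (Cod C f) T. u \<cdot>\<^bsub>C\<^esub> f = zero_mor C (Dom C f) T \<longrightarrow>
      (\<exists>!h. h \<in> Hom C (Cod C q) T \<and> h \<cdot>\<^bsub>C\<^esub> q = u))"

definition kernel :: "('o, 'm) cat \<Rightarrow> 'm \<Rightarrow> 'm"
  where "kernel C f = (SOME k. is_kernel C f k)"

definition short_exact :: "('o, 'm) cat \<Rightarrow> 'm \<Rightarrow> 'm \<Rightarrow> bool"
  where "short_exact C a p \<longleftrightarrow> is_kernel C p a \<and> is_cokernel C a p"

definition kernel_pair :: "('o, 'm) cat \<Rightarrow> 'm \<Rightarrow> 'm \<times> 'm"
  where "kernel_pair C f = (SOME k. is_pullback C f f (fst k) (snd k))"

definition is_image :: "('o, 'm) cat \<Rightarrow> 'm \<Rightarrow> 'm \<Rightarrow> bool"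
  where "is_image C f i \<longleftrightarrow> monic C i \<and> Cod C i = Cod C f \<and>
    (\<exists>e \<in> Hom C (Dom C f) (Dom C i). regular_epi C e \<and> i \<cdot>\<^bsub>C\<^esub> e = f)"

definition image_mor :: "('o, 'm) cat \<Rightarrow> 'm \<Rightarrow> 'm"
  where "image_mor C f = (SOME i. is_image C f i)"

text \<open>\<open>factor C m f\<close> is the factorisation of \<open>f\<close> through the monomorphism \<open>m\<close>.\<close>

definition factor :: "('o, 'm) cat \<Rightarrow> 'm \<Rightarrow> 'm \<Rightarrow> 'm"
  where "factor C m f = (THE h. h \<in> Hom C (Dom C f) (Dom C m) \<and> m \<cdot>\<^bsub>C\<^esub> h = f)"

section \<open>Cosmash products and commutators\<close>

definition cosmash_incl :: "('o, 'm) cat \<Rightarrow> 'o \<Rightarrow> 'o \<Rightarrow> 'm"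
  where "cosmash_incl C X Y = kernel C (pairing C
    (copairing C (Ide C X) (zero_mor C Y X))
    (copairing C (zero_mor C X Y) (Ide C Y)))"

definition cosmash :: "('o, 'm) cat \<Rightarrow> 'o \<Rightarrow> 'o \<Rightarrow> 'o"
  where "cosmash C X Y = Dom C (cosmash_incl C X Y)"

definition cosmash_mor :: "('o, 'm) cat \<Rightarrow> 'm \<Rightarrow> 'm \<Rightarrow> 'm"
  where "cosmash_mor C f g = factor C (cosmash_incl C (Cod C f) (Cod C g))
    (coprod_mor C f g \<cdot>\<^bsub>C\<^esub> cosmash_incl C (Dom C f) (Dom C g))"

text \<open>Ternary coproducts are bracketed as \<open>(X + Y) + Z\<close>, ternary products likewise.\<close>

definition cosmash3_incl :: "('o, 'm) cat \<Rightarrow> 'o \<Rightarrow> 'o \<Rightarrow> 'o \<Rightarrow> 'm"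
  where "cosmash3_incl C X Y Z = kernel C (pairing C (pairing C
    (copairing C (Ide C (coprod_obj C X Y)) (zero_mor C Z (coprod_obj C X Y)))
    (copairing C (copairing C (inj1 C X Z) (zero_mor C Y (coprod_obj C X Z))) (inj2 C X Z)))
    (copairing C (copairing C (zero_mor C X (coprod_obj C Y Z)) (inj1 C Y Z)) (inj2 C Y Z)))"

definition cosmash3 :: "('o, 'm) cat \<Rightarrow> 'o \<Rightarrow> 'o \<Rightarrow> 'o \<Rightarrow> 'o"
  where "cosmash3 C X Y Z = Dom C (cosmash3_incl C X Y Z)"

definition S21 :: "('o, 'm) cat \<Rightarrow> 'o \<Rightarrow> 'o \<Rightarrow> 'm"
  where "S21 C X Y = factor C (cosmash_incl C X Y)
    (coprod_mor C (codiagonal C X) (Ide C Y) \<cdot>\<^bsub>C\<^esub> cosmash3_incl C X X Y)"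

definition commutator3 :: "('o, 'm) cat \<Rightarrow> 'm \<Rightarrow> 'm \<Rightarrow> 'm \<Rightarrow> 'm"
  where "commutator3 C k l m = image_mor C
    (copairing C (copairing C k l) m \<cdot>\<^bsub>C\<^esub> cosmash3_incl C (Dom C k) (Dom C l) (Dom C m))"

definition zero_subobject :: "('o, 'm) cat \<Rightarrow> 'm \<Rightarrow> bool"
  where "zero_subobject C m \<longleftrightarrow> monic C m \<and> is_zero C (Dom C m)"

section \<open>The Smith/Pedicchio commutator of equivalence relations\<close>

definition refl_mor :: "('o, 'm) cat \<Rightarrow> 'm \<Rightarrow> 'm \<Rightarrow> 'm"
  where "refl_mor C r\<^sub>0 r\<^sub>1 = (THE e. e \<in> Hom C (Cod C r\<^sub>0) (Dom C r\<^sub>0) \<and>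
    r\<^sub>0 \<cdot>\<^bsub>C\<^esub> e = Ide C (Cod C r\<^sub>0) \<and> r\<^sub>1 \<cdot>\<^bsub>C\<^esub> e = Ide C (Cod C r\<^sub>0))"

text \<open>Pedicchio's construction for equivalence relations \<open>R\<close> and \<open>S\<close> on \<open>X\<close>.  Let \<open>P\<close>, with projections
  \<open>u\<close> to \<open>R\<close> and \<open>v\<close> to \<open>S\<close>, be the pullback of \<open>r\<^sub>1\<close> and \<open>s\<^sub>0\<close>, whose elements are triples
  \<open>x R y S z\<close>; let \<open>i\<close> send \<open>x R y\<close> to \<open>(x, y, y)\<close> and \<open>j\<close> send \<open>y S z\<close> to \<open>(y, y, z)\<close>.
  The cocones of the diagram formed by \<open>i\<close>, \<open>r\<^sub>0\<close>, \<open>j\<close> and \<open>s\<^sub>1\<close> are the pairs \<open>(\<phi>, t)\<close>, \<open>\<phi>\<close> on \<open>P\<close> and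
  \<open>t\<close> on \<open>X\<close>, such that \<open>\<phi> i = t r\<^sub>0\<close> and \<open>\<phi> j = t s\<^sub>1\<close>.  The commutator of \<open>R\<close> and \<open>S\<close> is the
  kernel pair of the component \<open>t\<close> of the colimit of that diagram.\<close>

definition is_connecting_cocone ::
    "('o, 'm) cat \<Rightarrow> 'm \<Rightarrow> 'm \<Rightarrow> 'm \<Rightarrow> 'm \<Rightarrow> 'm \<Rightarrow> 'm \<Rightarrow> 'm \<Rightarrow> 'm \<Rightarrow> bool"
  where "is_connecting_cocone C r\<^sub>0 r\<^sub>1 s\<^sub>0 s\<^sub>1 u v \<phi> t \<longleftrightarrow>
    \<phi> \<in> Hom C (Dom C u) (Cod C t) \<and> t \<in> Hom C (Cod C r\<^sub>0) (Cod C t) \<and>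
    (\<forall>i \<in> Hom C (Dom C r\<^sub>0) (Dom C u).
      u \<cdot>\<^bsub>C\<^esub> i = Ide C (Dom C r\<^sub>0) \<longrightarrow> v \<cdot>\<^bsub>C\<^esub> i = refl_mor C s\<^sub>0 s\<^sub>1 \<cdot>\<^bsub>C\<^esub> r\<^sub>1 \<longrightarrow> \<phi> \<cdot>\<^bsub>C\<^esub> i = t \<cdot>\<^bsub>C\<^esub> r\<^sub>0) \<and>
    (\<forall>j \<in> Hom C (Dom C s\<^sub>0) (Dom C u).
      u \<cdot>\<^bsub>C\<^esub> j = refl_mor C r\<^sub>0 r\<^sub>1 \<cdot>\<^bsub>C\<^esub> s\<^sub>0 \<longrightarrow> v \<cdot>\<^bsub>C\<^esub> j = Ide C (Dom C s\<^sub>0) \<longrightarrow> \<phi> \<cdot>\<^bsub>C\<^esub> j = t \<cdot>\<^bsub>C\<^esub> s\<^sub>1)"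

definition is_connecting_colimit ::
    "('o, 'm) cat \<Rightarrow> 'm \<Rightarrow> 'm \<Rightarrow> 'm \<Rightarrow> 'm \<Rightarrow> 'm \<Rightarrow> bool"
  where "is_connecting_colimit C r\<^sub>0 r\<^sub>1 s\<^sub>0 s\<^sub>1 t \<longleftrightarrow>
    (\<exists>u v \<phi>. is_pullback C r\<^sub>1 s\<^sub>0 u v \<and> is_connecting_cocone C r\<^sub>0 r\<^sub>1 s\<^sub>0 s\<^sub>1 u v \<phi> t \<and>
      (\<forall>\<phi>' t'. is_connecting_cocone C r\<^sub>0 r\<^sub>1 s\<^sub>0 s\<^sub>1 u v \<phi>' t' \<longrightarrow>
        (\<exists>!h. h \<in> Hom C (Cod C t) (Cod C t') \<and> h \<cdot>\<^bsub>C\<^esub> \<phi> = \<phi>' \<and> h \<cdot>\<^bsub>C\<^esub> t = t')))"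

definition smith_commutator :: "('o, 'm) cat \<Rightarrow> 'm \<times> 'm \<Rightarrow> 'm \<times> 'm \<Rightarrow> 'm \<times> 'm"
  where "smith_commutator C R S =
    kernel_pair C (SOME t. is_connecting_colimit C (fst R) (snd R) (fst S) (snd S) t)"

text \<open>A relation on \<open>X\<close> is discrete if it is isomorphic to \<open>(X, 1, 1)\<close>; an equivalence relation is said to
  vanish if it is discrete.\<close>

definition discrete_relation :: "('o, 'm) cat \<Rightarrow> 'm \<times> 'm \<Rightarrow> bool"
  where "discrete_relation C R \<longleftrightarrow> is_iso C (fst R) \<and> snd R = fst R"

section \<open>Abelian objects and abelian extensions\<close>

definition abelian_group_structure :: "('o, 'm) cat \<Rightarrow> 'o \<Rightarrow> 'm \<Rightarrow> 'm \<Rightarrow> 'm \<Rightarrow> bool"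
  where "abelian_group_structure C A m e n \<longleftrightarrow>
    m \<in> Hom C (prod_obj C A A) A \<and> e \<in> Hom C (terminal_obj C) A \<and> n \<in> Hom C A A \<and>
    (let AA = prod_obj C A A;
         x = proj1 C A A \<cdot>\<^bsub>C\<^esub> proj1 C AA A; y = proj2 C A A \<cdot>\<^bsub>C\<^esub> proj1 C AA A; z = proj2 C AA A
     in m \<cdot>\<^bsub>C\<^esub> pairing C (m \<cdot>\<^bsub>C\<^esub> pairing C x y) z = m \<cdot>\<^bsub>C\<^esub> pairing C x (m \<cdot>\<^bsub>C\<^esub> pairing C y z)) \<and>
    m \<cdot>\<^bsub>C\<^esub> pairing C (Ide C A) (e \<cdot>\<^bsub>C\<^esub> terminal_mor C A) = Ide C A \<and>
    m \<cdot>\<^bsub>C\<^esub> pairing C (Ide C A) n = e \<cdot>\<^bsub>C\<^esub> terminal_mor C A \<and>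
    m \<cdot>\<^bsub>C\<^esub> pairing C (proj2 C A A) (proj1 C A A) = m"

definition abelian_object :: "('o, 'm) cat \<Rightarrow> 'o \<Rightarrow> bool"
  where "abelian_object C A \<longleftrightarrow> A \<in> Ob C \<and> (\<exists>m e n. abelian_group_structure C A m e n)"

definition maltsev_operation :: "('o, 'm) cat \<Rightarrow> 'o \<Rightarrow> 'm \<Rightarrow> bool"
  where "maltsev_operation C X m \<longleftrightarrow>
    m \<in> Hom C (prod_obj C (prod_obj C X X) X) X \<and>
    (let x = proj1 C X X; y = proj2 C X X
     in m \<cdot>\<^bsub>C\<^esub> pairing C (pairing C x y) y = x \<and> m \<cdot>\<^bsub>C\<^esub> pairing C (pairing C x x) y = y)"

definition abelian_extension :: "('o, 'm) cat \<Rightarrow> 'm \<Rightarrow> bool"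
  where "abelian_extension C p \<longleftrightarrow>
    regular_epi C p \<and> (\<exists>m. maltsev_operation (slice C (Cod C p)) p m)"

section \<open>Internal actions\<close>

text \<open>\<open>T_incl C X A\<close> is the inclusion of \<open>T\<^sub>X(A)\<close> into \<open>A + X\<close>.  The monad structure of \<open>T\<^sub>X\<close> is the usual one:
  the unit is induced by the first coproduct injection, and the multiplication by the morphism from
  \<open>T\<^sub>X(A) + X\<close> to \<open>A + X\<close> that is this inclusion on \<open>T\<^sub>X(A)\<close> and the second injection on \<open>X\<close>.\<close>

definition T_incl :: "('o, 'm) cat \<Rightarrow> 'o \<Rightarrow> 'o \<Rightarrow> 'm"
  where "T_incl C X A = kernel C (copairing C (zero_mor C A X) (Ide C X))"

definition T_obj :: "('o, 'm) cat \<Rightarrow> 'o \<Rightarrow> 'o \<Rightarrow> 'o"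
  where "T_obj C X A = Dom C (T_incl C X A)"

definition T_mor :: "('o, 'm) cat \<Rightarrow> 'o \<Rightarrow> 'm \<Rightarrow> 'm"
  where "T_mor C X f = factor C (T_incl C X (Cod C f))
    (coprod_mor C f (Ide C X) \<cdot>\<^bsub>C\<^esub> T_incl C X (Dom C f))"

definition T_unit :: "('o, 'm) cat \<Rightarrow> 'o \<Rightarrow> 'o \<Rightarrow> 'm"
  where "T_unit C X A = factor C (T_incl C X A) (inj1 C A X)"

definition T_mult :: "('o, 'm) cat \<Rightarrow> 'o \<Rightarrow> 'o \<Rightarrow> 'm"
  where "T_mult C X A = factor C (T_incl C X A)
    (copairing C (T_incl C X A) (inj2 C A X) \<cdot>\<^bsub>C\<^esub> T_incl C X (T_obj C X A))"

definition is_action :: "('o, 'm) cat \<Rightarrow> 'o \<Rightarrow> 'o \<Rightarrow> 'm \<Rightarrow> bool"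
  where "is_action C X A \<xi> \<longleftrightarrow> \<xi> \<in> Hom C (T_obj C X A) A \<and>
    \<xi> \<cdot>\<^bsub>C\<^esub> T_unit C X A = Ide C A \<and> \<xi> \<cdot>\<^bsub>C\<^esub> T_mor C X \<xi> = \<xi> \<cdot>\<^bsub>C\<^esub> T_mult C X A"

definition action_core :: "('o, 'm) cat \<Rightarrow> 'o \<Rightarrow> 'o \<Rightarrow> 'm \<Rightarrow> 'm"
  where "action_core C X A \<xi> = \<xi> \<cdot>\<^bsub>C\<^esub> factor C (T_incl C X A) (cosmash_incl C A X)"

definition is_action_core :: "('o, 'm) cat \<Rightarrow> 'o \<Rightarrow> 'o \<Rightarrow> 'm \<Rightarrow> bool"
  where "is_action_core C X A \<psi> \<longleftrightarrow> (\<exists>\<xi>. is_action C X A \<xi> \<and> \<psi> = action_core C X A \<xi>)"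

definition conj_core :: "('o, 'm) cat \<Rightarrow> 'm \<Rightarrow> 'm"
  where "conj_core C a = (let X = Cod C a in
    factor C a ((codiagonal C X \<cdot>\<^bsub>C\<^esub> cosmash_incl C X X) \<cdot>\<^bsub>C\<^esub> cosmash_mor C a (Ide C X)))"

definition conj_core21 :: "('o, 'm) cat \<Rightarrow> 'm \<Rightarrow> 'm"
  where "conj_core21 C a = conj_core C a \<cdot>\<^bsub>C\<^esub> S21 C (Dom C a) (Cod C a)"

end

theory Submission
  imports Defs
begin

text \<open>Let \<open>P\<close> be the object of triples \<open>(x, y, z)\<close> with \<open>p x = p y = p z\<close>.  Both (i) and (ii) say that
  there is a connector, a morphism \<open>P \<rightarrow> X\<close> sending \<open>(x, y, y)\<close> to \<open>x\<close> and \<open>(y, y, z)\<close> to \<open>z\<close>.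
  By protomodularity \<open>P\<close> is covered by \<open>A + A + X\<close> through the triples \<open>(a, 0, 0)\<close>, \<open>(0, 0, a)\<close> and
  \<open>(x, x, x)\<close>, so a connector exists iff the morphism \<open>A + A + X \<rightarrow> X\<close> with components \<open>a\<close>, \<open>a\<close>, \<open>1\<close>
  vanishes on the kernel of this cover, and for abelian \<open>A\<close> this amounts to its vanishing on
  \<open>A \<diamond> A \<diamond> X\<close>, which is (iii) and (iv).  The morphism \<open>1 + p\<close> is the coequalizer of a reflexive
  pair defined on \<open>A + A + X\<close>; since reflexive relations are equivalence relations, this controls the
  kernel of \<open>T\<^sub>X(A) \<rightarrow> T\<^sub>G(A)\<close>, and a connector makes the conjugation action vanish there.  Finally
  (vi) implies (iv) because words \<open>a \<diamond> a' \<diamond> x\<close> are killed by \<open>1 \<diamond> p\<close> once \<open>a'\<close> is regarded as an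
  element of \<open>X\<close>.\<close>

section \<open>Elementary category theory\<close>

text \<open>There are no elements to compute with, so generation is always expressed in one form: a
  kernel and a section of a split epimorphism are jointly strongly epic, and so are the two sections
  of a pullback of split epimorphisms. Equalities, factorisations and covers are tested on such
  pairs. The map from \<open>A + A + X\<close> to triples is treated in two stages because
  generators of the kernel are visible only stage by stage. The kernel of the first stage is split
  over \<open>A \<diamond> A\<close> with kernel inside \<open>A \<diamond> A \<diamond> X\<close>;
  the kernel of the second comes from a product, which is generated by its two axes. For (v), a
  factorisation of the core alone would say nothing about the algebra laws. The whole conjugation
  action is therefore pushed from \<open>T_X(A)\<close> to \<open>T_G(A)\<close>, and the laws
  descend along regular epimorphisms between the iterated objects. The morphism in (vi) carries no
  laws either, so the way from (vi) back to (v) leads through (iv) and (i).\<close>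

context category
begin

abbreviation comp (infixr "\<cdot>" 70)
  where "g \<cdot> f \<equiv> Comp C g f"

abbreviation hom ("\<guillemotleft>_ : _ \<rightarrow> _\<guillemotright>")
  where "\<guillemotleft>f : X \<rightarrow> Y\<guillemotright> \<equiv> f \<in> Hom C X Y"

abbreviation one ("\<one>")
  where "\<one> \<equiv> Ide C"

text \<open>Typing is kept as separate facts about \<open>Ar\<close>, \<open>Dom\<close> and
  \<open>Cod\<close>, so that the side conditions of equational rules are discharged by
  rewriting.\<close>

lemma hom_iff [simp]: "\<guillemotleft>f : X \<rightarrow> Y\<guillemotright> \<longleftrightarrow> f \<in> Ar C \<and> Dom C f = X \<and> Cod C f = Y"
  by (simp add: Hom_def)

lemma homD:
  assumes "\<guillemotleft>f : X \<rightarrow> Y\<guillemotright>"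
  shows "f \<in> Ar C" "Dom C f = X" "Cod C f = Y" "X \<in> Ob C" "Y \<in> Ob C"
  using assms dom_in_Ob cod_in_Ob by auto

lemma Dom_Ob [simp]: "f \<in> Ar C \<Longrightarrow> Dom C f \<in> Ob C"
  and Cod_Ob [simp]: "f \<in> Ar C \<Longrightarrow> Cod C f \<in> Ob C"
  by (auto intro: dom_in_Ob cod_in_Ob)

lemma one_simps [simp]:
  assumes "X \<in> Ob C"
  shows "\<one> X \<in> Ar C" "Dom C (\<one> X) = X" "Cod C (\<one> X) = X"
  using id_in_Hom[OF assms] by auto

lemma comp_simps [simp]:
  assumes "f \<in> Ar C" "g \<in> Ar C" "Cod C f = Dom C g"
  shows "g \<cdot> f \<in> Ar C" "Dom C (g \<cdot> f) = Dom C f" "Cod C (g \<cdot> f) = Cod C g"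
  using comp_in_Hom[of f "Dom C f" "Cod C f" g "Cod C g"] assms by auto

lemma one_comp [simp]: "f \<in> Ar C \<Longrightarrow> Cod C f = Y \<Longrightarrow> \<one> Y \<cdot> f = f"
  and comp_one [simp]: "f \<in> Ar C \<Longrightarrow> Dom C f = X \<Longrightarrow> f \<cdot> \<one> X = f"
  using id_left[of f] id_right[of f] by auto

lemma assoc [simp]:
  "f \<in> Ar C \<Longrightarrow> g \<in> Ar C \<Longrightarrow> h \<in> Ar C \<Longrightarrow> Cod C f = Dom C g \<Longrightarrow> Cod C g = Dom C h \<Longrightarrow>
    (h \<cdot> g) \<cdot> f = h \<cdot> g \<cdot> f"
  using comp_assoc[of f "Dom C f" "Cod C f" g "Cod C g" h "Cod C h"] by auto

text \<open>Makes an equation applicable inside a right-bracketed composite.\<close>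

lemma reduce:
  "g \<cdot> f = k \<Longrightarrow> f \<in> Ar C \<Longrightarrow> g \<in> Ar C \<Longrightarrow> Cod C f = Dom C g \<Longrightarrow> t \<in> Ar C \<Longrightarrow> Cod C t = Dom C f \<Longrightarrow>
    g \<cdot> f \<cdot> t = k \<cdot> t"
  using assoc[of t f g] by auto

text \<open>An arrow determines its endpoints, so an equation between composites carries typing
  information; these rules extract it.\<close>

lemma dom_eq: "g \<cdot> f = k \<Longrightarrow> f \<in> Ar C \<Longrightarrow> g \<in> Ar C \<Longrightarrow> Cod C f = Dom C g \<Longrightarrow> Dom C k = Dom C f"
  and cod_eq: "g \<cdot> f = k \<Longrightarrow> f \<in> Ar C \<Longrightarrow> g \<in> Ar C \<Longrightarrow> Cod C f = Dom C g \<Longrightarrow> Cod C k = Cod C g"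
  by auto

definition epic :: "'m \<Rightarrow> bool"
  where "epic e \<longleftrightarrow> e \<in> Ar C \<and> (\<forall>u v. u \<in> Ar C \<longrightarrow> v \<in> Ar C \<longrightarrow> Dom C u = Cod C e \<longrightarrow>
    Dom C v = Cod C e \<longrightarrow> u \<cdot> e = v \<cdot> e \<longrightarrow> u = v)"

lemma epicD:
  "epic e \<Longrightarrow> u \<in> Ar C \<Longrightarrow> v \<in> Ar C \<Longrightarrow> Dom C u = Cod C e \<Longrightarrow> Dom C v = Cod C e \<Longrightarrow>
    u \<cdot> e = v \<cdot> e \<Longrightarrow> u = v"
  by (simp add: epic_def)

lemma monicD:
  assumes "monic C m" "u \<in> Ar C" "v \<in> Ar C" "Cod C u = Dom C m" "Cod C v = Dom C m"
    and "m \<cdot> u = m \<cdot> v"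
  shows "u = v"
proof -
  have "Dom C u = Dom C v"
    using dom_eq[OF assms(6)] assms(1-5) by (simp add: monic_def)
  then have "\<guillemotleft>u : Dom C u \<rightarrow> Dom C m\<guillemotright>" "\<guillemotleft>v : Dom C u \<rightarrow> Dom C m\<guillemotright>" using assms by auto
  then show ?thesis using assms(1,6) unfolding monic_def by blast
qed

lemma monicI:
  assumes "m \<in> Ar C"
    and "\<And>u v. \<lbrakk>u \<in> Ar C; v \<in> Ar C; Cod C u = Dom C m; Cod C v = Dom C m; Dom C u = Dom C v;
      m \<cdot> u = m \<cdot> v\<rbrakk> \<Longrightarrow> u = v"
  shows "monic C m"
  using assms unfolding monic_def by auto

lemma monic_Ar: "monic C m \<Longrightarrow> m \<in> Ar C"
  by (simp add: monic_def)

lemma is_isoI: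
  "f \<in> Ar C \<Longrightarrow> \<guillemotleft>g : Cod C f \<rightarrow> Dom C f\<guillemotright> \<Longrightarrow> g \<cdot> f = \<one> (Dom C f) \<Longrightarrow> f \<cdot> g = \<one> (Cod C f) \<Longrightarrow> is_iso C f"
  unfolding is_iso_def by blast

lemma is_isoE:
  assumes "is_iso C f"
  obtains g where "f \<in> Ar C" "g \<in> Ar C" "Dom C g = Cod C f" "Cod C g = Dom C f"
    "g \<cdot> f = \<one> (Dom C f)" "f \<cdot> g = \<one> (Cod C f)"
  using assms unfolding is_iso_def by auto

text \<open>From \<open>m \<cdot> t \<cdot> m = m\<close> the monomorphism can be cancelled on the
  left. Arguments that a subobject is everything end here, since they produce a section of its
  inclusion.\<close>

lemma iso_if_monic_split:
  assumes "monic C m" "t \<in> Ar C" "Cod C t = Dom C m" "m \<cdot> t = \<one> (Cod C m)"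
  shows "is_iso C m"
proof -
  have m: "m \<in> Ar C" using assms by (simp add: monic_def)
  have D: "Dom C t = Cod C m"
    using dom_eq[OF assms(4)] assms(2,3) m by simp
  have "t \<cdot> m = \<one> (Dom C m)"
    by (rule monicD[OF assms(1)]) (use assms m D reduce[OF assms(4)] in auto)
  then show ?thesis using assms m D by (intro is_isoI[of m t]) auto
qed

lemma pullbackD:
  assumes "is_pullback C f g p q"
  shows "f \<in> Ar C" "g \<in> Ar C" "p \<in> Ar C" "q \<in> Ar C" "Cod C f = Cod C g"
    "Cod C p = Dom C f" "Cod C q = Dom C g" "Dom C q = Dom C p" "f \<cdot> p = g \<cdot> q"
  using assms unfolding is_pullback_def by auto

lemma pullback_lift:
  assumes "is_pullback C f g p q" "u \<in> Ar C" "v \<in> Ar C" "Cod C u = Dom C f" "Cod C v = Dom C g"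
    and "f \<cdot> u = g \<cdot> v"
  obtains h where "h \<in> Ar C" "Dom C h = Dom C u" "Cod C h = Dom C p" "p \<cdot> h = u" "q \<cdot> h = v"
proof -
  have "f \<in> Ar C" "g \<in> Ar C" using assms(1) by (auto dest: pullbackD)
  then have "Dom C u = Dom C v" using dom_eq[OF assms(6)] assms(2-5) by simp
  then have "u \<in> Hom C (Dom C u) (Dom C f)" "v \<in> Hom C (Dom C u) (Dom C g)"
    using assms by auto
  then have "\<exists>!h. \<guillemotleft>h : Dom C u \<rightarrow> Dom C p\<guillemotright> \<and> p \<cdot> h = u \<and> q \<cdot> h = v"
    using assms(1,6) unfolding is_pullback_def by blast
  then obtain h where "\<guillemotleft>h : Dom C u \<rightarrow> Dom C p\<guillemotright>" "p \<cdot> h = u" "q \<cdot> h = v" by blast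
  then show thesis using that[of h] by auto
qed

lemma pullback_ext:
  assumes "is_pullback C f g p q" "h \<in> Ar C" "k \<in> Ar C" "Cod C h = Dom C p" "Cod C k = Dom C p"
    and "p \<cdot> h = p \<cdot> k" "q \<cdot> h = q \<cdot> k"
  shows "h = k"
proof -
  note [simp] = pullbackD[OF assms(1)] reduce[OF pullbackD(9)[OF assms(1)]]
  have D: "Dom C h = Dom C k" using dom_eq[OF assms(6)] assms(2-5) by simp
  have "f \<cdot> p \<cdot> k = g \<cdot> q \<cdot> k" using assms(2-5) by simp
  moreover have "p \<cdot> k \<in> Hom C (Dom C h) (Dom C f)" "q \<cdot> k \<in> Hom C (Dom C h) (Dom C g)"
    using assms(2-5) D by auto
  ultimately have ex1: "\<exists>!l. \<guillemotleft>l : Dom C h \<rightarrow> Dom C p\<guillemotright> \<and> p \<cdot> l = p \<cdot> k \<and> q \<cdot> l = q \<cdot> k"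
    using assms(1) unfolding is_pullback_def by blast
  have "\<guillemotleft>h : Dom C h \<rightarrow> Dom C p\<guillemotright>" "\<guillemotleft>k : Dom C h \<rightarrow> Dom C p\<guillemotright>"
    using assms D by auto
  with ex1 assms(6,7) show ?thesis by blast
qed

lemma pullbackI:
  assumes "f \<in> Ar C" "g \<in> Ar C" "p \<in> Ar C" "q \<in> Ar C" "Cod C f = Cod C g"
    "Cod C p = Dom C f" "Cod C q = Dom C g" "Dom C q = Dom C p" "f \<cdot> p = g \<cdot> q"
    and lift: "\<And>u v. \<lbrakk>u \<in> Ar C; v \<in> Ar C; Cod C u = Dom C f; Cod C v = Dom C g; Dom C v = Dom C u;
      f \<cdot> u = g \<cdot> v\<rbrakk> \<Longrightarrow> \<exists>h. h \<in> Ar C \<and> Dom C h = Dom C u \<and> Cod C h = Dom C p \<and> p \<cdot> h = u \<and> q \<cdot> h = v"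
    and ext: "\<And>h k. \<lbrakk>h \<in> Ar C; k \<in> Ar C; Cod C h = Dom C p; Cod C k = Dom C p; Dom C h = Dom C k;
      p \<cdot> h = p \<cdot> k; q \<cdot> h = q \<cdot> k\<rbrakk> \<Longrightarrow> h = k"
  shows "is_pullback C f g p q"
  unfolding is_pullback_def
proof (intro conjI allI ballI impI)
  fix T u v assume "\<guillemotleft>u : T \<rightarrow> Dom C f\<guillemotright>" "\<guillemotleft>v : T \<rightarrow> Dom C g\<guillemotright>" "f \<cdot> u = g \<cdot> v"
  then obtain h where h: "h \<in> Ar C" "Dom C h = T" "Cod C h = Dom C p" "p \<cdot> h = u" "q \<cdot> h = v"
    using lift[of u v] by auto
  then show "\<exists>!h. \<guillemotleft>h : T \<rightarrow> Dom C p\<guillemotright> \<and> p \<cdot> h = u \<and> q \<cdot> h = v"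
    by (intro ex1I[of _ h]) (auto intro: ext)
qed (use assms(1-9) in auto)

lemma pullback_sym:
  assumes "is_pullback C f g p q"
  shows "is_pullback C g f q p"
proof (rule pullbackI)
  fix u v assume "u \<in> Ar C" "v \<in> Ar C" "Cod C u = Dom C g" "Cod C v = Dom C f" "Dom C v = Dom C u"
    "g \<cdot> u = f \<cdot> v"
  then show "\<exists>h. h \<in> Ar C \<and> Dom C h = Dom C u \<and> Cod C h = Dom C q \<and> q \<cdot> h = u \<and> p \<cdot> h = v"
    using pullback_lift[OF assms, of v u] pullbackD(8)[OF assms] by metis
next
  fix h k assume "h \<in> Ar C" "k \<in> Ar C" "Cod C h = Dom C q" "Cod C k = Dom C q" "q \<cdot> h = q \<cdot> k" "p \<cdot> h = p \<cdot> k"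
  then show "h = k" using pullback_ext[OF assms, of h k] pullbackD(8)[OF assms] by simp
qed (simp_all add: pullbackD[OF assms])

lemma pullback_monic:
  assumes "is_pullback C f g p q" "monic C f"
  shows "monic C q"
proof (rule monicI)
  note [simp] = pullbackD[OF assms(1)] reduce[OF pullbackD(9)[OF assms(1)]]
  show "q \<in> Ar C" by simp
  fix u v assume uv [simp]: "u \<in> Ar C" "v \<in> Ar C" "Cod C u = Dom C q" "Cod C v = Dom C q"
    "Dom C u = Dom C v" and eq: "q \<cdot> u = q \<cdot> v"
  have "p \<cdot> u = p \<cdot> v"
    by (rule monicD[OF assms(2)]) (use uv eq in auto)
  then show "u = v" using pullback_ext[OF assms(1), of u v] eq by simp
qed

section \<open>Coequalizers and regular epimorphisms\<close>

lemma coequalizerD: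
  assumes "is_coequalizer C u v e"
  shows "u \<in> Ar C" "v \<in> Ar C" "e \<in> Ar C" "Dom C v = Dom C u" "Cod C v = Cod C u"
    "Dom C e = Cod C u" "e \<cdot> u = e \<cdot> v"
proof -
  have "u \<in> Ar C \<and> v \<in> Hom C (Dom C u) (Cod C u) \<and> e \<in> Hom C (Cod C u) (Cod C e) \<and> e \<cdot> u = e \<cdot> v"
    using assms unfolding is_coequalizer_def by blast
  then show "u \<in> Ar C" "v \<in> Ar C" "e \<in> Ar C" "Dom C v = Dom C u" "Cod C v = Cod C u"
    "Dom C e = Cod C u" "e \<cdot> u = e \<cdot> v" by auto
qed

lemma coequalizer_ex1:
  assumes "is_coequalizer C u v e" "f \<in> Hom C (Cod C u) T" "f \<cdot> u = f \<cdot> v"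
  shows "\<exists>!h. h \<in> Hom C (Cod C e) T \<and> h \<cdot> e = f"
  using assms(1)[unfolded is_coequalizer_def, THEN conjunct2, THEN conjunct2, THEN conjunct2,
    THEN conjunct2, rule_format, OF assms(2,3)] .

lemma coequalizer_factor:
  assumes "is_coequalizer C u v e" "f \<in> Ar C" "Dom C f = Cod C u" "f \<cdot> u = f \<cdot> v"
  obtains h where "h \<in> Ar C" "Dom C h = Cod C e" "Cod C h = Cod C f" "h \<cdot> e = f"
proof -
  have "f \<in> Hom C (Cod C u) (Cod C f)" using assms by auto
  from coequalizer_ex1[OF assms(1) this assms(4)] obtain h where "\<guillemotleft>h : Cod C e \<rightarrow> Cod C f\<guillemotright>" "h \<cdot> e = f" by blast
  then show thesis using that[of h] by auto
qed

lemma coequalizer_epic: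
  assumes "is_coequalizer C u v e"
  shows "epic e"
  unfolding epic_def
proof (intro conjI allI impI)
  note [simp] = coequalizerD[OF assms] reduce[OF coequalizerD(7)[OF assms]]
  show "e \<in> Ar C" by simp
  fix s t assume [simp]: "s \<in> Ar C" "t \<in> Ar C" "Dom C s = Cod C e" "Dom C t = Cod C e"
    and eq: "s \<cdot> e = t \<cdot> e"
  have c: "Cod C s = Cod C t" using cod_eq[OF eq] by simp
  have "s \<cdot> e \<in> Hom C (Cod C u) (Cod C s)" "(s \<cdot> e) \<cdot> u = (s \<cdot> e) \<cdot> v" by auto
  from coequalizer_ex1[OF assms this]
  have "\<exists>!h. \<guillemotleft>h : Cod C e \<rightarrow> Cod C s\<guillemotright> \<and> h \<cdot> e = s \<cdot> e" .
  moreover have "\<guillemotleft>s : Cod C e \<rightarrow> Cod C s\<guillemotright>" "\<guillemotleft>t : Cod C e \<rightarrow> Cod C s\<guillemotright>" using c by auto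
  ultimately show "s = t" using eq by metis
qed

lemma coequalizerI:
  assumes "u \<in> Ar C" "v \<in> Ar C" "e \<in> Ar C" "Dom C v = Dom C u" "Cod C v = Cod C u"
    "Dom C e = Cod C u" "e \<cdot> u = e \<cdot> v"
    and factor: "\<And>f. \<lbrakk>f \<in> Ar C; Dom C f = Cod C u; f \<cdot> u = f \<cdot> v\<rbrakk> \<Longrightarrow>
      \<exists>h. h \<in> Ar C \<and> Dom C h = Cod C e \<and> Cod C h = Cod C f \<and> h \<cdot> e = f"
    and epic: "epic e"
  shows "is_coequalizer C u v e"
  unfolding is_coequalizer_def
proof (intro conjI allI ballI impI)
  fix T f assume "\<guillemotleft>f : Cod C u \<rightarrow> T\<guillemotright>" "f \<cdot> u = f \<cdot> v"
  then obtain h where h: "h \<in> Ar C" "Dom C h = Cod C e" "Cod C h = T" "h \<cdot> e = f"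
    using factor[of f] by auto
  then show "\<exists>!h. \<guillemotleft>h : Cod C e \<rightarrow> T\<guillemotright> \<and> h \<cdot> e = f"
    by (intro ex1I[of _ h]) (auto intro: epicD[OF epic])
qed (use assms(1-7) in auto)

lemma regular_epi_epic: "regular_epi C e \<Longrightarrow> epic e"
  unfolding regular_epi_def using coequalizer_epic by blast

lemma regular_epi_Ar: "regular_epi C e \<Longrightarrow> e \<in> Ar C"
  using regular_epi_epic epic_def by blast

text \<open>The pair that \<open>e\<close> coequalizes is also identified by \<open>u\<close>,
  because \<open>m\<close> is monic; so \<open>u\<close> descends along \<open>e\<close>. This is
  the orthogonality of regular epimorphisms and monomorphisms.\<close>

lemma regular_epi_strong:
  assumes "regular_epi C e" "monic C m"
    and "h \<in> Ar C" "Dom C h = Cod C e" "u \<in> Ar C" "Cod C u = Dom C m" "h \<cdot> e = m \<cdot> u"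
  obtains t where "t \<in> Ar C" "Dom C t = Dom C h" "Cod C t = Dom C m" "m \<cdot> t = h" "t \<cdot> e = u"
proof -
  obtain a b where c: "is_coequalizer C a b e" using assms(1) unfolding regular_epi_def by blast
  note [simp] = coequalizerD[OF c] reduce[OF coequalizerD(7)[OF c]] assms(3-6) monic_Ar[OF assms(2)]
    reduce[OF assms(7)[symmetric]]
  have [simp]: "Dom C u = Cod C a" using dom_eq[OF assms(7)] by simp
  have [simp]: "Cod C m = Cod C h" using cod_eq[OF assms(7)] by simp
  have "u \<cdot> a = u \<cdot> b" by (rule monicD[OF assms(2)]) auto
  then obtain t where t: "t \<in> Ar C" "Dom C t = Cod C e" "Cod C t = Cod C u" "t \<cdot> e = u"
    using coequalizer_factor[OF c, of u] by auto
  have "m \<cdot> t = h"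
    by (rule epicD[OF coequalizer_epic[OF c]]) (use t assms in auto)
  then show thesis using t by (intro that[of t]) auto
qed

lemma regular_epi_extremal:
  assumes "regular_epi C e" "monic C m" "u \<in> Ar C" "Cod C u = Dom C m" "e = m \<cdot> u"
  shows "is_iso C m"
proof -
  note [simp] = regular_epi_Ar[OF assms(1)] monic_Ar[OF assms(2)] assms(3,4)
  have c: "Cod C e = Cod C m" using assms by simp
  obtain t where "t \<in> Ar C" "Cod C t = Dom C m" "m \<cdot> t = \<one> (Cod C e)"
    by (rule regular_epi_strong[OF assms(1,2), of "\<one> (Cod C e)" u]) (use assms(5) in auto)
  then show ?thesis using iso_if_monic_split[OF assms(2), of t] c by simp
qed

lemma iso_comp_regular_epi:
  assumes "regular_epi C e" "is_iso C m" "Dom C m = Cod C e"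
  shows "regular_epi C (m \<cdot> e)"
proof -
  obtain a b where c: "is_coequalizer C a b e" using assms(1) unfolding regular_epi_def by blast
  obtain n where n [simp]: "m \<in> Ar C" "n \<in> Ar C" "Dom C n = Cod C m" "Cod C n = Dom C m"
    "n \<cdot> m = \<one> (Dom C m)" "m \<cdot> n = \<one> (Cod C m)" using assms(2) by (rule is_isoE)
  note [simp] = coequalizerD[OF c] assms(3) reduce[OF n(5)] reduce[OF n(6)]
  have "is_coequalizer C a b (m \<cdot> e)"
  proof (rule coequalizerI)
    fix f assume f: "f \<in> Ar C" "Dom C f = Cod C a" "f \<cdot> a = f \<cdot> b"
    obtain h where "h \<in> Ar C" "Dom C h = Cod C e" "Cod C h = Cod C f" "h \<cdot> e = f"
      using coequalizer_factor[OF c f] .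
    then show "\<exists>h. h \<in> Ar C \<and> Dom C h = Cod C (m \<cdot> e) \<and> Cod C h = Cod C f \<and> h \<cdot> m \<cdot> e = f"
      by (intro exI[of _ "h \<cdot> n"]) simp
  next
    show "epic (m \<cdot> e)" unfolding epic_def
    proof (intro conjI allI impI)
      fix u v assume uv [simp]: "u \<in> Ar C" "v \<in> Ar C" "Dom C u = Cod C (m \<cdot> e)" "Dom C v = Cod C (m \<cdot> e)"
        "u \<cdot> m \<cdot> e = v \<cdot> m \<cdot> e"
      have "u \<cdot> m = v \<cdot> m"
        by (rule epicD[OF coequalizer_epic[OF c]]) auto
      then have "(u \<cdot> m) \<cdot> n = (v \<cdot> m) \<cdot> n" by simp
      then show "u = v" using uv(3,4) by simp
    qed simp
  qed simp_all
  then show ?thesis unfolding regular_epi_def by blast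
qed

end

text \<open>Split off from the semi-abelian setting because slices are instances too: the calculus
  of pairings is needed there to evaluate Mal'tsev operations.\<close>

locale product_category = category +
  assumes ex_product: "X \<in> Ob C \<Longrightarrow> Y \<in> Ob C \<Longrightarrow> \<exists>p q. is_product C X Y p q"
begin

abbreviation pr1 where "pr1 \<equiv> proj1 C"
abbreviation pr2 where "pr2 \<equiv> proj2 C"
abbreviation pobj (infixl "\<otimes>" 68) where "X \<otimes> Y \<equiv> prod_obj C X Y"
abbreviation pair ("\<langle>_, _\<rangle>") where "\<langle>f, g\<rangle> \<equiv> pairing C f g"

lemma proj_is_product:
  assumes "X \<in> Ob C" "Y \<in> Ob C"
  shows "is_product C X Y (pr1 X Y) (pr2 X Y)"
  unfolding proj1_def proj2_def
  using ex_product[OF assms] someI_ex[of "\<lambda>pq. is_product C X Y (fst pq) (snd pq)"] by auto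

lemma proj_simps [simp]:
  assumes "X \<in> Ob C" "Y \<in> Ob C"
  shows "pr1 X Y \<in> Ar C" "Dom C (pr1 X Y) = X \<otimes> Y" "Cod C (pr1 X Y) = X"
    "pr2 X Y \<in> Ar C" "Dom C (pr2 X Y) = X \<otimes> Y" "Cod C (pr2 X Y) = Y" "X \<otimes> Y \<in> Ob C"
  using proj_is_product[OF assms] unfolding is_product_def prod_obj_def
  by (auto simp: Hom_def)

lemma pairing_ex1:
  assumes "f \<in> Ar C" "g \<in> Ar C" "Dom C g = Dom C f"
  shows "\<exists>!h. \<guillemotleft>h : Dom C f \<rightarrow> Cod C f \<otimes> Cod C g\<guillemotright> \<and>
    pr1 (Cod C f) (Cod C g) \<cdot> h = f \<and> pr2 (Cod C f) (Cod C g) \<cdot> h = g"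
proof -
  have "\<guillemotleft>f : Dom C f \<rightarrow> Cod C f\<guillemotright>" "\<guillemotleft>g : Dom C f \<rightarrow> Cod C g\<guillemotright>" using assms by auto
  then show ?thesis
    using assms proj_is_product[of "Cod C f" "Cod C g"] unfolding is_product_def prod_obj_def by auto
qed

lemma pairing_simps [simp]:
  assumes "f \<in> Ar C" "g \<in> Ar C" "Dom C g = Dom C f"
  shows "\<langle>f, g\<rangle> \<in> Ar C" "Dom C \<langle>f, g\<rangle> = Dom C f" "Cod C \<langle>f, g\<rangle> = Cod C f \<otimes> Cod C g"
    "Cod C f = X \<Longrightarrow> Cod C g = Y \<Longrightarrow> pr1 X Y \<cdot> \<langle>f, g\<rangle> = f"
    "Cod C f = X \<Longrightarrow> Cod C g = Y \<Longrightarrow> pr2 X Y \<cdot> \<langle>f, g\<rangle> = g"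
  using theI'[OF pairing_ex1[OF assms]] unfolding pairing_def by auto

lemma product_ext:
  assumes "h \<in> Ar C" "k \<in> Ar C" "Cod C h = X \<otimes> Y" "Cod C k = X \<otimes> Y"
    and "X \<in> Ob C" "Y \<in> Ob C"
    and "pr1 X Y \<cdot> h = pr1 X Y \<cdot> k" "pr2 X Y \<cdot> h = pr2 X Y \<cdot> k"
  shows "h = k"
proof -
  note [simp] = assms(1-6)
  have [simp]: "Dom C h = Dom C k" using dom_eq[OF assms(7)] by simp
  have "\<exists>!l. \<guillemotleft>l : Dom C k \<rightarrow> X \<otimes> Y\<guillemotright> \<and> pr1 X Y \<cdot> l = pr1 X Y \<cdot> k \<and> pr2 X Y \<cdot> l = pr2 X Y \<cdot> k"
    using pairing_ex1[of "pr1 X Y \<cdot> k" "pr2 X Y \<cdot> k"] by simp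
  then show ?thesis using assms(7,8) by (metis (full_types) \<open>Dom C h = Dom C k\<close> assms(1-4) hom_iff)
qed

lemma pairing_comp [simp]:
  assumes "f \<in> Ar C" "g \<in> Ar C" "Dom C g = Dom C f" "h \<in> Ar C" "Cod C h = Dom C f"
  shows "\<langle>f, g\<rangle> \<cdot> h = \<langle>f \<cdot> h, g \<cdot> h\<rangle>"
  by (rule product_ext[of _ _ "Cod C f" "Cod C g"])
    (use assms in \<open>auto simp: reduce[OF pairing_simps(4)] reduce[OF pairing_simps(5)]\<close>)

end

section \<open>Semi-abelian categories\<close>

locale semi_abelian_category = category C for C :: "('o, 'm) cat" +
  assumes semi_abelian: "semi_abelian C"
begin

lemma ex_terminal: "\<exists>T. is_terminal C T"
  and ex_pullback: "f \<in> Ar C \<Longrightarrow> g \<in> Ar C \<Longrightarrow> Cod C f = Cod C g \<Longrightarrow> \<exists>p q. is_pullback C f g p q"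
  using semi_abelian unfolding semi_abelian_def barr_exact_def regular_category_def finitely_complete_def
  by blast+

lemma terminal_unique:
  assumes "is_terminal C T" "u \<in> Ar C" "v \<in> Ar C" "Dom C u = Dom C v" "Cod C u = T" "Cod C v = T"
  shows "u = v"
proof -
  have "\<exists>!f. \<guillemotleft>f : Dom C v \<rightarrow> T\<guillemotright>" using assms(1,3) unfolding is_terminal_def by simp
  moreover have "\<guillemotleft>u : Dom C v \<rightarrow> T\<guillemotright>" "\<guillemotleft>v : Dom C v \<rightarrow> T\<guillemotright>" using assms by auto
  ultimately show ?thesis by blast
qed

lemma initial_unique:
  assumes "is_initial C T" "u \<in> Ar C" "v \<in> Ar C" "Cod C u = Cod C v" "Dom C u = T" "Dom C v = T"
  shows "u = v"
proof -
  have "\<exists>!f. \<guillemotleft>f : T \<rightarrow> Cod C v\<guillemotright>" using assms(1,3) unfolding is_initial_def by simp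
  moreover have "\<guillemotleft>u : T \<rightarrow> Cod C v\<guillemotright>" "\<guillemotleft>v : T \<rightarrow> Cod C v\<guillemotright>" using assms by auto
  ultimately show ?thesis by blast
qed

lemma pullback_over_terminal:
  assumes T: "is_terminal C T" and pb: "is_pullback C f g p q" and f: "Cod C f = T"
  shows "is_product C (Dom C f) (Dom C g) p q"
  unfolding is_product_def
proof (intro conjI allI ballI)
  have g: "Cod C g = T" using pullbackD(5)[OF pb] f by simp
  note [simp] = pullbackD(1-4,6-9)[OF pb] f g
  show "\<guillemotleft>p : Dom C p \<rightarrow> Dom C f\<guillemotright>" "\<guillemotleft>q : Dom C p \<rightarrow> Dom C g\<guillemotright>" by auto
  fix S u v assume u: "\<guillemotleft>u : S \<rightarrow> Dom C f\<guillemotright>" and v: "\<guillemotleft>v : S \<rightarrow> Dom C g\<guillemotright>"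
  note [simp] = homD[OF u] homD[OF v]
  have "f \<cdot> u = g \<cdot> v" by (rule terminal_unique[OF T]) auto
  then obtain h where h: "h \<in> Ar C" "Dom C h = S" "Cod C h = Dom C p" "p \<cdot> h = u" "q \<cdot> h = v"
    using pullback_lift[OF pb, of u v] by auto
  then show "\<exists>!h. \<guillemotleft>h : S \<rightarrow> Dom C p\<guillemotright> \<and> p \<cdot> h = u \<and> q \<cdot> h = v"
  proof (intro ex1I[of _ h])
    fix h' assume "\<guillemotleft>h' : S \<rightarrow> Dom C p\<guillemotright> \<and> p \<cdot> h' = u \<and> q \<cdot> h' = v"
    then show "h' = h" by (intro pullback_ext[OF pb, of h' h]) (simp_all add: h)
  qed simp
qed

sublocale product_category C
proof
  fix X Y assume XY: "X \<in> Ob C" "Y \<in> Ob C"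
  obtain T where T: "is_terminal C T" using ex_terminal by blast
  obtain f g where f: "\<guillemotleft>f : X \<rightarrow> T\<guillemotright>" and g: "\<guillemotleft>g : Y \<rightarrow> T\<guillemotright>"
    using T XY unfolding is_terminal_def by blast
  obtain p q where "is_pullback C f g p q" using ex_pullback[of f g] f g by auto
  from pullback_over_terminal[OF T this] show "\<exists>p q. is_product C X Y p q" using f g by auto
qed

subsection \<open>Zero morphisms\<close>

abbreviation zero ("\<zero>") where "\<zero> \<equiv> zero_mor C"

lemma zero_mor_eq:
  assumes Z: "is_zero C Z" and u: "\<guillemotleft>u : X \<rightarrow> Z\<guillemotright>" and v: "\<guillemotleft>v : Z \<rightarrow> Y\<guillemotright>"
  shows "\<zero> X Y = v \<cdot> u"
  unfolding zero_mor_def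
proof (rule the_equality)
  show "\<exists>Z u' v'. is_zero C Z \<and> \<guillemotleft>u' : X \<rightarrow> Z\<guillemotright> \<and> \<guillemotleft>v' : Z \<rightarrow> Y\<guillemotright> \<and> v \<cdot> u = v' \<cdot> u'"
    using assms by blast
  fix f assume "\<exists>Z u v. is_zero C Z \<and> \<guillemotleft>u : X \<rightarrow> Z\<guillemotright> \<and> \<guillemotleft>v : Z \<rightarrow> Y\<guillemotright> \<and> f = v \<cdot> u"
  then obtain Z' u' v' where Z': "is_zero C Z'" and u': "\<guillemotleft>u' : X \<rightarrow> Z'\<guillemotright>" and v': "\<guillemotleft>v' : Z' \<rightarrow> Y\<guillemotright>"
    and f: "f = v' \<cdot> u'" by blast
  note [simp] = homD[OF u] homD[OF v] homD[OF u'] homD[OF v']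
  \<comment> \<open>Two factorisations may use different zero objects. The comparison arrow is
    compatible with both halves, by terminality of one object and initiality of the other, so the
    description in \<open>zero_mor\<close> is single-valued.\<close>
  obtain w where w: "\<guillemotleft>w : Z \<rightarrow> Z'\<guillemotright>"
    using Z unfolding is_zero_def is_initial_def by (metis homD(5) u')
  note [simp] = homD[OF w]
  have wu: "w \<cdot> u = u'" and vw: "v' \<cdot> w = v"
    using Z Z' unfolding is_zero_def by (auto intro: terminal_unique initial_unique)
  show "f = v \<cdot> u" using reduce[OF vw, of u] f by (simp add: wu)
qed

lemma ex_zero: obtains Z where "is_zero C Z"
  using semi_abelian unfolding semi_abelian_def pointed_def by blast

lemma zero_obtain:
  assumes "X \<in> Ob C" "Y \<in> Ob C" "is_zero C Z"
  obtains u v where "\<guillemotleft>u : X \<rightarrow> Z\<guillemotright>" "\<guillemotleft>v : Z \<rightarrow> Y\<guillemotright>" "\<zero> X Y = v \<cdot> u"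
proof -
  obtain u v where "\<guillemotleft>u : X \<rightarrow> Z\<guillemotright>" "\<guillemotleft>v : Z \<rightarrow> Y\<guillemotright>"
    using assms unfolding is_zero_def is_initial_def is_terminal_def by blast
  then show thesis using zero_mor_eq[OF assms(3)] that by blast
qed

lemma zero_simps [simp]:
  assumes "X \<in> Ob C" "Y \<in> Ob C"
  shows "\<zero> X Y \<in> Ar C" "Dom C (\<zero> X Y) = X" "Cod C (\<zero> X Y) = Y"
proof -
  obtain Z where "is_zero C Z" by (rule ex_zero)
  then obtain u v where "\<guillemotleft>u : X \<rightarrow> Z\<guillemotright>" "\<guillemotleft>v : Z \<rightarrow> Y\<guillemotright>" "\<zero> X Y = v \<cdot> u"
    using zero_obtain[OF assms] by metis
  then show "\<zero> X Y \<in> Ar C" "Dom C (\<zero> X Y) = X" "Cod C (\<zero> X Y) = Y" by auto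
qed

lemma zero_comp [simp]:
  assumes "f \<in> Ar C" "Cod C f = Y" "Z \<in> Ob C"
  shows "\<zero> Y Z \<cdot> f = \<zero> (Dom C f) Z"
proof -
  obtain N where N: "is_zero C N" by (rule ex_zero)
  obtain u v where uv: "\<guillemotleft>u : Y \<rightarrow> N\<guillemotright>" "\<guillemotleft>v : N \<rightarrow> Z\<guillemotright>" "\<zero> Y Z = v \<cdot> u"
    using zero_obtain[of Y Z N] N assms by (metis Cod_Ob)
  have "\<zero> (Dom C f) Z = v \<cdot> u \<cdot> f"
    by (rule zero_mor_eq[OF N]) (use uv assms in auto)
  then show ?thesis using uv assms by auto
qed

lemma comp_zero [simp]:
  assumes "g \<in> Ar C" "Dom C g = Y" "X \<in> Ob C"
  shows "g \<cdot> \<zero> X Y = \<zero> X (Cod C g)"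
proof -
  obtain N where N: "is_zero C N" by (rule ex_zero)
  obtain u v where uv: "\<guillemotleft>u : X \<rightarrow> N\<guillemotright>" "\<guillemotleft>v : N \<rightarrow> Y\<guillemotright>" "\<zero> X Y = v \<cdot> u"
    using zero_obtain[of X Y N] N assms by (metis Dom_Ob)
  have "\<zero> X (Cod C g) = (g \<cdot> v) \<cdot> u"
    by (rule zero_mor_eq[OF N]) (use uv assms in auto)
  then show ?thesis using uv assms by auto
qed

lemma to_zero_object:
  assumes "is_zero C Z" "f \<in> Ar C" "Cod C f = Z"
  shows "f = \<zero> (Dom C f) Z"
  using assms by (intro terminal_unique[of Z]) (auto simp: is_zero_def is_terminal_def)

lemma from_zero_object:
  assumes "is_zero C Z" "f \<in> Ar C" "Dom C f = Z"
  shows "f = \<zero> Z (Cod C f)"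
  using assms by (intro initial_unique[of Z]) (auto simp: is_zero_def is_initial_def)

lemma is_zero_if_one_eq_zero:
  assumes "X \<in> Ob C" "\<one> X = \<zero> X X"
  shows "is_zero C X"
  unfolding is_zero_def is_initial_def is_terminal_def
proof (intro conjI ballI)
  fix Y assume Y: "Y \<in> Ob C"
  show "\<exists>!f. \<guillemotleft>f : X \<rightarrow> Y\<guillemotright>"
  proof (rule ex1I[of _ "\<zero> X Y"])
    fix f assume "\<guillemotleft>f : X \<rightarrow> Y\<guillemotright>"
    then show "f = \<zero> X Y" using comp_one[of f X] assms by (auto simp del: comp_one)
  qed (use assms Y in simp)
  show "\<exists>!f. \<guillemotleft>f : Y \<rightarrow> X\<guillemotright>"
  proof (rule ex1I[of _ "\<zero> Y X"])
    fix f assume "\<guillemotleft>f : Y \<rightarrow> X\<guillemotright>"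
    then show "f = \<zero> Y X" using one_comp[of f X] assms by (auto simp del: one_comp)
  qed (use assms Y in simp)
qed (use assms in auto)

lemma pairing_zero [simp]:
  "T \<in> Ob C \<Longrightarrow> X \<in> Ob C \<Longrightarrow> Y \<in> Ob C \<Longrightarrow> \<langle>\<zero> T X, \<zero> T Y\<rangle> = \<zero> T (X \<otimes> Y)"
  by (rule product_ext[of _ _ X Y]) auto

subsection \<open>Coproducts\<close>

abbreviation in1 where "in1 \<equiv> inj1 C"
abbreviation in2 where "in2 \<equiv> inj2 C"
abbreviation cobj (infixl "\<uplus>" 68) where "X \<uplus> Y \<equiv> coprod_obj C X Y"
abbreviation copair (infixl "\<triangledown>" 65) where "f \<triangledown> g \<equiv> copairing C f g"
abbreviation cmor (infixl "\<oplus>" 66) where "f \<oplus> g \<equiv> coprod_mor C f g"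

lemma inj_is_coproduct:
  assumes "X \<in> Ob C" "Y \<in> Ob C"
  shows "is_coproduct C X Y (in1 X Y) (in2 X Y)"
proof -
  have "\<exists>i j. is_coproduct C X Y i j"
    using assms semi_abelian unfolding semi_abelian_def has_finite_coproducts_def by blast
  then show ?thesis
    unfolding inj1_def inj2_def
    using someI_ex[of "\<lambda>ij. is_coproduct C X Y (fst ij) (snd ij)"] by auto
qed

lemma inj_simps [simp]:
  assumes "X \<in> Ob C" "Y \<in> Ob C"
  shows "in1 X Y \<in> Ar C" "Dom C (in1 X Y) = X" "Cod C (in1 X Y) = X \<uplus> Y"
    "in2 X Y \<in> Ar C" "Dom C (in2 X Y) = Y" "Cod C (in2 X Y) = X \<uplus> Y" "X \<uplus> Y \<in> Ob C"
proof -
  have "\<guillemotleft>in1 X Y : X \<rightarrow> X \<uplus> Y\<guillemotright> \<and> \<guillemotleft>in2 X Y : Y \<rightarrow> X \<uplus> Y\<guillemotright>"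
    using inj_is_coproduct[OF assms] unfolding is_coproduct_def coprod_obj_def by blast
  then show "in1 X Y \<in> Ar C" "Dom C (in1 X Y) = X" "Cod C (in1 X Y) = X \<uplus> Y"
    "in2 X Y \<in> Ar C" "Dom C (in2 X Y) = Y" "Cod C (in2 X Y) = X \<uplus> Y" "X \<uplus> Y \<in> Ob C"
    by (auto intro: homD(5))
qed

lemma copairing_ex1:
  assumes "f \<in> Ar C" "g \<in> Ar C" "Cod C g = Cod C f"
  shows "\<exists>!h. \<guillemotleft>h : Dom C f \<uplus> Dom C g \<rightarrow> Cod C f\<guillemotright> \<and>
    h \<cdot> in1 (Dom C f) (Dom C g) = f \<and> h \<cdot> in2 (Dom C f) (Dom C g) = g"
proof -
  have "\<guillemotleft>f : Dom C f \<rightarrow> Cod C f\<guillemotright>" "\<guillemotleft>g : Dom C g \<rightarrow> Cod C f\<guillemotright>" using assms by auto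
  then show ?thesis
    using assms inj_is_coproduct[of "Dom C f" "Dom C g"] unfolding is_coproduct_def coprod_obj_def by auto
qed

lemma copairing_simps [simp]:
  assumes "f \<in> Ar C" "g \<in> Ar C" "Cod C g = Cod C f"
  shows "f \<triangledown> g \<in> Ar C" "Dom C (f \<triangledown> g) = Dom C f \<uplus> Dom C g" "Cod C (f \<triangledown> g) = Cod C f"
    "Dom C f = X \<Longrightarrow> Dom C g = Y \<Longrightarrow> (f \<triangledown> g) \<cdot> in1 X Y = f"
    "Dom C f = X \<Longrightarrow> Dom C g = Y \<Longrightarrow> (f \<triangledown> g) \<cdot> in2 X Y = g"
  using theI'[OF copairing_ex1[OF assms]] unfolding copairing_def by auto

lemma coproduct_ext:
  assumes "h \<in> Ar C" "k \<in> Ar C" "Dom C h = X \<uplus> Y" "Dom C k = X \<uplus> Y"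
    and "X \<in> Ob C" "Y \<in> Ob C"
    and "h \<cdot> in1 X Y = k \<cdot> in1 X Y" "h \<cdot> in2 X Y = k \<cdot> in2 X Y"
  shows "h = k"
proof -
  note [simp] = assms(1-6)
  have [simp]: "Cod C h = Cod C k" using cod_eq[OF assms(7)] by simp
  have "\<exists>!l. \<guillemotleft>l : X \<uplus> Y \<rightarrow> Cod C k\<guillemotright> \<and> l \<cdot> in1 X Y = k \<cdot> in1 X Y \<and> l \<cdot> in2 X Y = k \<cdot> in2 X Y"
    using copairing_ex1[of "k \<cdot> in1 X Y" "k \<cdot> in2 X Y"] by simp
  moreover have "\<guillemotleft>h : X \<uplus> Y \<rightarrow> Cod C k\<guillemotright>" "\<guillemotleft>k : X \<uplus> Y \<rightarrow> Cod C k\<guillemotright>" by auto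
  ultimately show ?thesis using assms(7,8) by blast
qed

lemma copairing_reduce [simp]:
  assumes "f \<in> Ar C" "g \<in> Ar C" "Cod C g = Cod C f" "Dom C f = X" "Dom C g = Y"
    "t \<in> Ar C"
  shows "Cod C t = X \<Longrightarrow> (f \<triangledown> g) \<cdot> in1 X Y \<cdot> t = f \<cdot> t" "Cod C t = Y \<Longrightarrow> (f \<triangledown> g) \<cdot> in2 X Y \<cdot> t = g \<cdot> t"
  using assms by (auto simp: reduce[OF copairing_simps(4)] reduce[OF copairing_simps(5)])

lemma comp_copairing [simp]:
  assumes "f \<in> Ar C" "g \<in> Ar C" "Cod C g = Cod C f" "h \<in> Ar C" "Dom C h = Cod C f"
  shows "h \<cdot> (f \<triangledown> g) = (h \<cdot> f) \<triangledown> (h \<cdot> g)"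
  by (rule coproduct_ext[of _ _ "Dom C f" "Dom C g"]) (use assms in auto)

lemma comp_copairing_reduce [simp]:
  assumes "f \<in> Ar C" "g \<in> Ar C" "Cod C g = Cod C f" "h \<in> Ar C" "Dom C h = Cod C f"
    "t \<in> Ar C" "Cod C t = Dom C f \<uplus> Dom C g"
  shows "h \<cdot> (f \<triangledown> g) \<cdot> t = ((h \<cdot> f) \<triangledown> (h \<cdot> g)) \<cdot> t"
  using assms by (simp flip: comp_copairing)

lemma copairing_zero [simp]:
  "T \<in> Ob C \<Longrightarrow> X \<in> Ob C \<Longrightarrow> Y \<in> Ob C \<Longrightarrow> \<zero> X T \<triangledown> \<zero> Y T = \<zero> (X \<uplus> Y) T"
  by (rule coproduct_ext[of _ _ X Y]) auto

lemma copairing_in [simp]: "X \<in> Ob C \<Longrightarrow> Y \<in> Ob C \<Longrightarrow> in1 X Y \<triangledown> in2 X Y = \<one> (X \<uplus> Y)"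
  by (rule coproduct_ext[of _ _ X Y]) auto

lemma copairing_comp_in [simp]:
  "h \<in> Ar C \<Longrightarrow> Dom C h = X \<uplus> Y \<Longrightarrow> X \<in> Ob C \<Longrightarrow> Y \<in> Ob C \<Longrightarrow> (h \<cdot> in1 X Y) \<triangledown> (h \<cdot> in2 X Y) = h"
  by (rule coproduct_ext[of _ _ X Y]) auto

lemma coprod_mor_eq [simp]: "Cod C f = X \<Longrightarrow> Cod C g = Y \<Longrightarrow> f \<oplus> g = in1 X Y \<cdot> f \<triangledown> in2 X Y \<cdot> g"
  by (simp add: coprod_mor_def)

subsection \<open>Kernels\<close>

lemma kernelD:
  assumes "is_kernel C f k"
  shows "f \<in> Ar C" "k \<in> Ar C" "Cod C k = Dom C f" "f \<cdot> k = \<zero> (Dom C k) (Cod C f)"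
  using assms unfolding is_kernel_def by auto

lemma kernel_lift:
  assumes "is_kernel C f k" "u \<in> Ar C" "Cod C u = Dom C f" "f \<cdot> u = \<zero> (Dom C u) (Cod C f)"
  obtains h where "h \<in> Ar C" "Dom C h = Dom C u" "Cod C h = Dom C k" "k \<cdot> h = u"
proof -
  have "\<guillemotleft>u : Dom C u \<rightarrow> Dom C f\<guillemotright>" using assms by auto
  then have "\<exists>!h. \<guillemotleft>h : Dom C u \<rightarrow> Dom C k\<guillemotright> \<and> k \<cdot> h = u"
    using assms(1,4) unfolding is_kernel_def by blast
  then obtain h where "\<guillemotleft>h : Dom C u \<rightarrow> Dom C k\<guillemotright>" "k \<cdot> h = u" by blast
  then show thesis using that[of h] by auto
qed

lemma kernel_monic:
  assumes "is_kernel C f k"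
  shows "monic C k"
proof (rule monicI)
  note [simp] = kernelD[OF assms] reduce[OF kernelD(4)[OF assms]]
  show "k \<in> Ar C" by simp
  fix u v assume uv: "u \<in> Ar C" "v \<in> Ar C" "Cod C u = Dom C k" "Cod C v = Dom C k"
    "Dom C u = Dom C v" "k \<cdot> u = k \<cdot> v"
  have "\<guillemotleft>k \<cdot> v : Dom C v \<rightarrow> Dom C f\<guillemotright>" "f \<cdot> k \<cdot> v = \<zero> (Dom C v) (Cod C f)" using uv by auto
  then have "\<exists>!h. \<guillemotleft>h : Dom C v \<rightarrow> Dom C k\<guillemotright> \<and> k \<cdot> h = k \<cdot> v"
    using assms unfolding is_kernel_def by blast
  moreover have "\<guillemotleft>u : Dom C v \<rightarrow> Dom C k\<guillemotright>" "\<guillemotleft>v : Dom C v \<rightarrow> Dom C k\<guillemotright>" using uv by auto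
  ultimately show "u = v" using uv(6) by blast
qed

lemma kernelI:
  assumes "f \<in> Ar C" "monic C k" "Cod C k = Dom C f" "f \<cdot> k = \<zero> (Dom C k) (Cod C f)"
    and lift: "\<And>u. \<lbrakk>u \<in> Ar C; Cod C u = Dom C f; f \<cdot> u = \<zero> (Dom C u) (Cod C f)\<rbrakk> \<Longrightarrow>
      \<exists>h. h \<in> Ar C \<and> Dom C h = Dom C u \<and> Cod C h = Dom C k \<and> k \<cdot> h = u"
  shows "is_kernel C f k"
  unfolding is_kernel_def
proof (intro conjI allI ballI impI)
  fix T u assume "\<guillemotleft>u : T \<rightarrow> Dom C f\<guillemotright>" "f \<cdot> u = \<zero> T (Cod C f)"
  then obtain h where h: "h \<in> Ar C" "Dom C h = T" "Cod C h = Dom C k" "k \<cdot> h = u"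
    using lift[of u] by auto
  then show "\<exists>!h. \<guillemotleft>h : T \<rightarrow> Dom C k\<guillemotright> \<and> k \<cdot> h = u"
  proof (intro ex1I[of _ h])
    fix h' assume "\<guillemotleft>h' : T \<rightarrow> Dom C k\<guillemotright> \<and> k \<cdot> h' = u"
    then show "h' = h" by (intro monicD[OF assms(2), of h' h]) (simp_all add: h)
  qed simp
qed (use assms monic_Ar[OF assms(2)] in auto)

lemma pullback_imp_kernel:
  assumes Z: "is_zero C Z" and pb: "is_pullback C z f n k" and z: "Dom C z = Z"
  shows "is_kernel C f k"
proof -
  note [simp] = pullbackD(1-4,6-9)[OF pb] z pullbackD(5)[OF pb]
  have Z' [simp]: "Z \<in> Ob C" using Z by (simp add: is_zero_def is_initial_def)
  have z0: "z = \<zero> Z (Cod C z)" using from_zero_object[OF Z, of z] by simp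
  show ?thesis
  proof (rule kernelI)
    show "monic C k"
    proof (rule pullback_monic[OF pb], rule monicI)
      fix u v assume "u \<in> Ar C" "v \<in> Ar C" "Cod C u = Dom C z" "Cod C v = Dom C z" "Dom C u = Dom C v"
      then show "u = v" using Z unfolding is_zero_def by (auto intro: terminal_unique)
    qed simp
    have "f \<cdot> k = z \<cdot> n" by simp
    also have "\<dots> = \<zero> (Dom C k) (Cod C f)" by (subst z0) simp
    finally show "f \<cdot> k = \<zero> (Dom C k) (Cod C f)" .
    fix u assume u: "u \<in> Ar C" "Cod C u = Dom C f" "f \<cdot> u = \<zero> (Dom C u) (Cod C f)"
    have "z \<cdot> \<zero> (Dom C u) Z = f \<cdot> u" using u by simp
    then obtain h where "h \<in> Ar C" "Dom C h = Dom C u" "Cod C h = Dom C n" "k \<cdot> h = u"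
      using pullback_lift[OF pb, of "\<zero> (Dom C u) Z" u] u by auto
    then show "\<exists>h. h \<in> Ar C \<and> Dom C h = Dom C u \<and> Cod C h = Dom C k \<and> k \<cdot> h = u"
      by (intro exI[of _ h]) simp
  qed auto
qed

lemma ex_kernel:
  assumes "f \<in> Ar C"
  obtains k where "is_kernel C f k"
proof -
  obtain Z where Z: "is_zero C Z" by (rule ex_zero)
  then have "Z \<in> Ob C" by (simp add: is_zero_def is_initial_def)
  then obtain n k where "is_pullback C (\<zero> Z (Cod C f)) f n k"
    using ex_pullback[of "\<zero> Z (Cod C f)" f] assms by auto
  from pullback_imp_kernel[OF Z this] show thesis using that \<open>Z \<in> Ob C\<close> assms by auto
qed

lemma is_kernel_kernel: "f \<in> Ar C \<Longrightarrow> is_kernel C f (kernel C f)"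
  unfolding kernel_def by (rule someI_ex) (metis ex_kernel)

text \<open>Protomodularity is stated for pullbacks; read as a pullback along a morphism from a zero
  object, a kernel becomes an instance of it.\<close>

lemma kernel_imp_pullback:
  assumes Z: "is_zero C Z" and k: "is_kernel C f k"
  shows "is_pullback C (\<zero> Z (Cod C f)) f (\<zero> (Dom C k) Z) k"
proof (rule pullbackI)
  have [simp]: "Z \<in> Ob C" using Z by (simp add: is_zero_def is_initial_def)
  note [simp] = kernelD[OF k]
  show "\<zero> Z (Cod C f) \<cdot> \<zero> (Dom C k) Z = f \<cdot> k" by simp
  fix u v assume uv: "u \<in> Ar C" "v \<in> Ar C" "Cod C u = Dom C (\<zero> Z (Cod C f))" "Cod C v = Dom C f"
    "Dom C v = Dom C u" "\<zero> Z (Cod C f) \<cdot> u = f \<cdot> v"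
  then have "f \<cdot> v = \<zero> (Dom C v) (Cod C f)" by simp
  then obtain h where h: "h \<in> Ar C" "Dom C h = Dom C v" "Cod C h = Dom C k" "k \<cdot> h = v"
    using kernel_lift[OF k uv(2,4)] by metis
  have "\<zero> (Dom C k) Z \<cdot> h = u"
    using Z uv h unfolding is_zero_def by (intro terminal_unique[of Z]) auto
  with h uv show "\<exists>h. h \<in> Ar C \<and> Dom C h = Dom C u \<and> Cod C h = Dom C (\<zero> (Dom C k) Z) \<and>
      \<zero> (Dom C k) Z \<cdot> h = u \<and> k \<cdot> h = v" by (intro exI[of _ h]) simp
next
  have [simp]: "Z \<in> Ob C" using Z by (simp add: is_zero_def is_initial_def)
  note [simp] = kernelD[OF k]
  fix h l assume "h \<in> Ar C" "l \<in> Ar C" "Cod C h = Dom C (\<zero> (Dom C k) Z)"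
    "Cod C l = Dom C (\<zero> (Dom C k) Z)" "k \<cdot> h = k \<cdot> l"
  then show "h = l" by (intro monicD[OF kernel_monic[OF k], of h l]) auto
qed (use Z kernelD[OF k] in \<open>auto simp: is_zero_def is_initial_def\<close>)

end

context semi_abelian_category
begin

section \<open>Protomodularity\<close>

text \<open>Jointly strongly epic pairs. Lifting an arbitrary \<open>h\<close> instead of the
  identity lets such a pair construct morphisms directly; the case
  \<open>h = \<one> (Cod C f)\<close> says that no proper subobject contains both \<open>f\<close>
  and \<open>g\<close>.\<close>

definition jointly_strong :: "'m \<Rightarrow> 'm \<Rightarrow> bool"
  where "jointly_strong f g \<longleftrightarrow> f \<in> Ar C \<and> g \<in> Ar C \<and> Cod C g = Cod C f \<and>
    (\<forall>m h u v. monic C m \<longrightarrow> h \<in> Ar C \<longrightarrow> Dom C h = Cod C f \<longrightarrow> Cod C h = Cod C m \<longrightarrow>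
      u \<in> Ar C \<longrightarrow> v \<in> Ar C \<longrightarrow> Cod C u = Dom C m \<longrightarrow> Cod C v = Dom C m \<longrightarrow>
      h \<cdot> f = m \<cdot> u \<longrightarrow> h \<cdot> g = m \<cdot> v \<longrightarrow>
      (\<exists>t. t \<in> Ar C \<and> Dom C t = Dom C h \<and> Cod C t = Dom C m \<and> m \<cdot> t = h))"

lemma jointly_strongD:
  assumes "jointly_strong f g"
  shows "f \<in> Ar C" "g \<in> Ar C" "Cod C g = Cod C f"
  using assms unfolding jointly_strong_def by blast+

lemma jointly_strong_factor:
  assumes "jointly_strong f g" "monic C m" "h \<in> Ar C" "Dom C h = Cod C f" "Cod C h = Cod C m"
    "u \<in> Ar C" "v \<in> Ar C" "Cod C u = Dom C m" "Cod C v = Dom C m" "h \<cdot> f = m \<cdot> u" "h \<cdot> g = m \<cdot> v"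
  obtains t where "t \<in> Ar C" "Dom C t = Dom C h" "Cod C t = Dom C m" "m \<cdot> t = h"
  using assms unfolding jointly_strong_def by metis

lemma split_monic:
  assumes "s \<in> Ar C" "r \<in> Ar C" "Dom C r = Cod C s" "r \<cdot> s = \<one> X" "Dom C s = X"
  shows "monic C s"
proof (rule monicI)
  fix u v assume uv: "u \<in> Ar C" "v \<in> Ar C" "Cod C u = Dom C s" "Cod C v = Dom C s" "s \<cdot> u = s \<cdot> v"
  have *: "r \<cdot> s \<cdot> w = w" if "w \<in> Ar C" "Cod C w = Dom C s" for w
    using reduce[OF assms(4), of w] that by (simp add: assms(1-3,5))
  show "u = v" using *[of u] *[of v] uv by metis
qed (use assms in simp)

lemma monic_cancel:
  assumes "monic C (g \<cdot> f)" "f \<in> Ar C" "g \<in> Ar C" "Cod C f = Dom C g"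
  shows "monic C f"
proof (rule monicI)
  fix u v assume uv: "u \<in> Ar C" "v \<in> Ar C" "Cod C u = Dom C f" "Cod C v = Dom C f" "f \<cdot> u = f \<cdot> v"
  have "(g \<cdot> f) \<cdot> u = (g \<cdot> f) \<cdot> v" using assms uv by simp
  then show "u = v" using monicD[OF assms(1), of u v] assms uv by simp
qed (use assms in simp)

text \<open>The equalizer of \<open>u\<close> and \<open>v\<close>, obtained as the pullback of a
  diagonal along \<open>\<langle>u, v\<rangle>\<close>, is a subobject through which
  \<open>f\<close> and \<open>g\<close> factor; hence its inclusion has a section.\<close>

lemma jointly_strong_epic:
  assumes js: "jointly_strong f g"
    and "u \<in> Ar C" "v \<in> Ar C" "Dom C u = Cod C f" "Dom C v = Cod C f" "u \<cdot> f = v \<cdot> f" "u \<cdot> g = v \<cdot> g"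
  shows "u = v"
proof -
  note [simp] = jointly_strongD[OF js] assms(2-5)
  define W where "W = Cod C v"
  have W [simp]: "Cod C v = W" "Cod C u = W" "W \<in> Ob C"
    using cod_eq[OF assms(6)] unfolding W_def by auto
  obtain n m where pb: "is_pullback C \<langle>\<one> W, \<one> W\<rangle> \<langle>u, v\<rangle> n m"
    using ex_pullback[of "\<langle>\<one> W, \<one> W\<rangle>" "\<langle>u, v\<rangle>"] by auto
  have "monic C \<langle>\<one> W, \<one> W\<rangle>"
    by (rule split_monic[of _ "pr1 W W" W]) auto
  then have m: "monic C m" by (rule pullback_monic[OF pb])
  have nm [simp]: "n \<in> Ar C" "m \<in> Ar C" "Cod C n = W" "Cod C m = Cod C f" "Dom C n = Dom C m"
    using pullbackD[OF pb] by auto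
  have "pr1 W W \<cdot> \<langle>\<one> W, \<one> W\<rangle> \<cdot> n = pr1 W W \<cdot> \<langle>u, v\<rangle> \<cdot> m" "pr2 W W \<cdot> \<langle>\<one> W, \<one> W\<rangle> \<cdot> n = pr2 W W \<cdot> \<langle>u, v\<rangle> \<cdot> m"
    using pullbackD(9)[OF pb] by auto
  then have eq: "n = u \<cdot> m" "n = v \<cdot> m" by simp_all
  obtain x where x: "x \<in> Ar C" "Cod C x = Dom C m" "m \<cdot> x = f"
    by (rule pullback_lift[OF pb, of "u \<cdot> f" f]) (use assms(6) in \<open>simp_all, blast?\<close>)
  obtain y where y: "y \<in> Ar C" "Cod C y = Dom C m" "m \<cdot> y = g"
    by (rule pullback_lift[OF pb, of "u \<cdot> g" g]) (use assms(7) in \<open>simp_all, blast?\<close>)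
  obtain t where t: "t \<in> Ar C" "Dom C t = Cod C f" "Cod C t = Dom C m" "m \<cdot> t = \<one> (Cod C f)"
    using jointly_strong_factor[OF js m, of "\<one> (Cod C f)" x y] x y by auto
  have "u \<cdot> m \<cdot> t = n \<cdot> t" by (rule reduce[OF eq(1)[symmetric]]) (use t in simp_all)
  also have "\<dots> = v \<cdot> m \<cdot> t" by (rule reduce[OF eq(2)[symmetric], symmetric]) (use t in simp_all)
  finally have "u \<cdot> m \<cdot> t = v \<cdot> m \<cdot> t" .
  then show ?thesis using t by simp
qed

text \<open>Protomodularity enters only through this lemma. The pullback \<open>n\<close> of
  \<open>m\<close> along \<open>h\<close> is a morphism of points with target \<open>(p, s)\<close>.
  Since \<open>f'\<close> factors through \<open>n\<close>, the change of base of \<open>n\<close>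
  along \<open>f\<close> is invertible; hence so is \<open>n\<close>, and \<open>h\<close> factors
  through \<open>m\<close>.\<close>

lemma point_pullback_strong:
  assumes pt: "p \<in> Ar C" "s \<in> Ar C" "Cod C s = Dom C p" "p \<cdot> s = \<one> (Cod C p)"
    and pb: "is_pullback C f p p' f'"
  shows "jointly_strong f' s"
  unfolding jointly_strong_def
proof (intro conjI allI impI)
  note [simp] = pt pullbackD[OF pb] reduce[OF pullbackD(9)[OF pb]] reduce[OF pt(4)]
  have [simp]: "Dom C s = Cod C p" using dom_eq[OF pt(4)] by simp
  show "f' \<in> Ar C" "s \<in> Ar C" "Cod C s = Cod C f'" by auto
  fix m h u v assume m: "monic C m"
    and h [simp]: "h \<in> Ar C" "Dom C h = Cod C f'" "Cod C h = Cod C m"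
    and uv [simp]: "u \<in> Ar C" "v \<in> Ar C" "Cod C u = Dom C m" "Cod C v = Dom C m"
    and hf: "h \<cdot> f' = m \<cdot> u" and hs: "h \<cdot> s = m \<cdot> v"
  have m' [simp]: "m \<in> Ar C" by (rule monic_Ar[OF m])
  obtain t n where pbm: "is_pullback C m h t n" using ex_pullback[of m h] by auto
  have n: "monic C n" by (rule pullback_monic[OF pbm m])
  note tn [simp] = pullbackD(3,4,6-8)[OF pbm]
  note mt = pullbackD(9)[OF pbm]
  obtain x where x [simp]: "x \<in> Ar C" "Dom C x = Dom C p'" "Cod C x = Dom C t" "n \<cdot> x = f'"
    by (rule pullback_lift[OF pbm, of u f']) (use hf dom_eq[OF hf] in \<open>simp_all, metis?\<close>)
  obtain y where y [simp]: "y \<in> Ar C" "Dom C y = Cod C p" "Cod C y = Dom C t" "n \<cdot> y = s"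
    by (rule pullback_lift[OF pbm, of v s]) (use hs dom_eq[OF hs] in \<open>simp_all, metis?\<close>)
  note [simp] = reduce[OF x(4)] reduce[OF y(4)]
  obtain p'' f'' where pb2: "is_pullback C f (p \<cdot> n) p'' f''"
    using ex_pullback[of f "p \<cdot> n"] by auto
  have pn [simp]: "p'' \<in> Ar C" "f'' \<in> Ar C" "Cod C p'' = Dom C f" "Cod C f'' = Dom C t" "Dom C f'' = Dom C p''"
    using pullbackD[OF pb2] by auto
  have eq2: "f \<cdot> p'' = p \<cdot> n \<cdot> f''" using pullbackD(9)[OF pb2] by simp
  obtain h' where h' [simp]: "h' \<in> Ar C" "Dom C h' = Dom C p''" "Cod C h' = Dom C p'"
    "p' \<cdot> h' = p''" "f' \<cdot> h' = n \<cdot> f''"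
    by (rule pullback_lift[OF pb, of p'' "n \<cdot> f''"]) (use eq2 in auto)
  note [simp] = reduce[OF h'(4)] reduce[OF h'(5)]
  \<comment> \<open>The future inverse of \<open>h'\<close>, available because \<open>x\<close>
    lifts \<open>f'\<close> to the subobject.\<close>
  obtain k where k [simp]: "k \<in> Ar C" "Dom C k = Dom C p'" "Cod C k = Dom C p''" "p'' \<cdot> k = p'" "f'' \<cdot> k = x"
    by (rule pullback_lift[OF pb2, of p' x]) auto
  note [simp] = reduce[OF k(4)] reduce[OF k(5)]
  have nx: "n \<cdot> x \<cdot> h' = n \<cdot> f''" by simp
  have xh [simp]: "x \<cdot> h' = f''"
    by (rule monicD[OF n]) simp_all
  have iso: "is_iso C h'"
  proof (rule is_isoI[of _ k])
    show "h' \<cdot> k = \<one> (Cod C h')"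
      by (rule pullback_ext[OF pb]) auto
    show "k \<cdot> h' = \<one> (Dom C h')"
      by (rule pullback_ext[OF pb2]) auto
  qed auto
  have pm: "is_point_morphism C (Cod C f) (p \<cdot> n) y p s n"
    unfolding is_point_morphism_def is_point_def by auto
  have "f' \<cdot> h' = n \<cdot> f''" "p' \<cdot> h' = p''" "\<guillemotleft>h' : Dom C p'' \<rightarrow> Dom C p'\<guillemotright>" by auto
  then have "is_iso C n"
    using semi_abelian pm pb pb2 iso unfolding semi_abelian_def protomodular_def by blast
  then obtain l where l: "l \<in> Ar C" "Dom C l = Cod C n" "Cod C l = Dom C n" "n \<cdot> l = \<one> (Cod C n)"
    by (rule is_isoE)
  have "m \<cdot> t \<cdot> l = h"
    using reduce[OF mt, of l] l by simp
  then show "\<exists>t. t \<in> Ar C \<and> Dom C t = Dom C h \<and> Cod C t = Dom C m \<and> m \<cdot> t = h"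
    using l by (intro exI[of _ "t \<cdot> l"]) auto
qed

text \<open>Base change from a zero object: a kernel and a section together generate a split
  extension.\<close>

lemma point_kernel_strong:
  assumes "p \<in> Ar C" "s \<in> Ar C" "Cod C s = Dom C p" "p \<cdot> s = \<one> (Cod C p)" "is_kernel C p k"
  shows "jointly_strong k s"
proof -
  obtain Z where "is_zero C Z" by (rule ex_zero)
  from point_pullback_strong[OF assms(1-4) kernel_imp_pullback[OF this assms(5)]] show ?thesis .
qed

text \<open>The second projection is split by the second axis, and its kernel is the first axis.
  This is unitality of semi-abelian categories.\<close>

lemma product_jointly_strong:
  assumes "X \<in> Ob C" "Y \<in> Ob C"
  shows "jointly_strong \<langle>\<one> X, \<zero> X Y\<rangle> \<langle>\<zero> Y X, \<one> Y\<rangle>"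
proof (rule point_kernel_strong)
  show "is_kernel C (pr2 X Y) \<langle>\<one> X, \<zero> X Y\<rangle>"
  proof (rule kernelI)
    show "monic C \<langle>\<one> X, \<zero> X Y\<rangle>" by (rule split_monic[of _ "pr1 X Y" X]) (use assms in auto)
    fix u assume u: "u \<in> Ar C" "Cod C u = Dom C (pr2 X Y)" "pr2 X Y \<cdot> u = \<zero> (Dom C u) (Cod C (pr2 X Y))"
    have "\<langle>\<one> X, \<zero> X Y\<rangle> \<cdot> pr1 X Y \<cdot> u = u"
      by (rule product_ext[of _ _ X Y]) (use assms u in auto)
    then show "\<exists>h. h \<in> Ar C \<and> Dom C h = Dom C u \<and> Cod C h = Dom C \<langle>\<one> X, \<zero> X Y\<rangle> \<and> \<langle>\<one> X, \<zero> X Y\<rangle> \<cdot> h = u"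
      using assms u by (intro exI[of _ "pr1 X Y \<cdot> u"]) auto
  qed (use assms in auto)
qed (use assms in auto)

text \<open>Base change keeps the kernel object, through the lift of \<open>k\<close> with zero
  second component. When \<open>p2\<close> has a section, a question about an arbitrary
  \<open>q\<close> becomes one about a split epimorphism.\<close>

lemma pullback_kernel:
  assumes pb: "is_pullback C q r p1 p2" and k: "is_kernel C q k"
  obtains l where "is_kernel C p2 l" "l \<in> Ar C" "Dom C l = Dom C k" "Cod C l = Dom C p1"
    "p1 \<cdot> l = k" "p2 \<cdot> l = \<zero> (Dom C k) (Cod C p2)"
proof -
  note [simp] = pullbackD[OF pb] kernelD[OF k]
  obtain l where l [simp]: "l \<in> Ar C" "Dom C l = Dom C k" "Cod C l = Dom C p1"
    "p1 \<cdot> l = k" "p2 \<cdot> l = \<zero> (Dom C k) (Cod C p2)"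
    by (rule pullback_lift[OF pb, of k "\<zero> (Dom C k) (Cod C p2)"]) auto
  note [simp] = reduce[OF l(4)] reduce[OF l(5)] reduce[OF pullbackD(9)[OF pb]]
  have "is_kernel C p2 l"
  proof (rule kernelI)
    show "monic C l" using monic_cancel[of p1 l] kernel_monic[OF k] by simp
    fix u assume u [simp]: "u \<in> Ar C" "Cod C u = Dom C p2" "p2 \<cdot> u = \<zero> (Dom C u) (Cod C p2)"
    obtain h where h: "h \<in> Ar C" "Dom C h = Dom C u" "Cod C h = Dom C k" "k \<cdot> h = p1 \<cdot> u"
      by (rule kernel_lift[OF k, of "p1 \<cdot> u"]) auto
    have "l \<cdot> h = u" by (rule pullback_ext[OF pb]) (use h in auto)
    with h show "\<exists>h. h \<in> Ar C \<and> Dom C h = Dom C u \<and> Cod C h = Dom C l \<and> l \<cdot> h = u"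
      by (intro exI[of _ h]) simp
  qed auto
  then show thesis using that l by blast
qed

section \<open>Regular epimorphisms and images\<close>

lemma regular_epi_pullback: "regular_epi C f \<Longrightarrow> is_pullback C f g p q \<Longrightarrow> regular_epi C q"
  and ex_coequalizer_kernel_pair: "is_pullback C f f p q \<Longrightarrow> \<exists>e. is_coequalizer C p q e"
  using semi_abelian unfolding semi_abelian_def barr_exact_def regular_category_def by blast+

lemma kernel_pair_diagonal:
  assumes "is_pullback C f f r0 r1"
  obtains d where "d \<in> Ar C" "Dom C d = Dom C f" "Cod C d = Dom C r0" "r0 \<cdot> d = \<one> (Dom C f)" "r1 \<cdot> d = \<one> (Dom C f)"
  by (rule pullback_lift[OF assms, of "\<one> (Dom C f)" "\<one> (Dom C f)"]) (use pullbackD(1-4,6-9)[OF assms] in auto)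

text \<open>The projection \<open>r1\<close> of the kernel pair is split by the diagonal. Its kernel
  consists of pairs \<open>(x, 0)\<close> with \<open>m x = 0\<close>, so both projections are zero
  on it; they also agree on the diagonal, hence coincide.\<close>

lemma monic_if_trivial_kernel:
  assumes m: "m \<in> Ar C"
    and triv: "\<And>u. u \<in> Ar C \<Longrightarrow> Cod C u = Dom C m \<Longrightarrow> m \<cdot> u = \<zero> (Dom C u) (Cod C m) \<Longrightarrow> u = \<zero> (Dom C u) (Dom C m)"
  shows "monic C m"
proof -
  obtain r0 r1 where pb: "is_pullback C m m r0 r1" using ex_pullback m by blast
  obtain d where d [simp]: "d \<in> Ar C" "Dom C d = Dom C m" "Cod C d = Dom C r0" "r0 \<cdot> d = \<one> (Dom C m)" "r1 \<cdot> d = \<one> (Dom C m)"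
    by (rule kernel_pair_diagonal[OF pb])
  note [simp] = pullbackD(1-4,6-9)[OF pb] reduce[OF pullbackD(9)[OF pb]]
  obtain k where k: "is_kernel C r1 k" using ex_kernel[of r1] by auto
  note [simp] = kernelD[OF k]
  have "r0 \<cdot> k = \<zero> (Dom C (r0 \<cdot> k)) (Dom C m)" by (rule triv) simp_all
  then have [simp]: "r0 \<cdot> k = r1 \<cdot> k" by simp
  have "r0 = r1"
    by (rule jointly_strong_epic[OF point_kernel_strong[OF _ _ _ _ k, of d]]) auto
  show ?thesis
  proof (rule monicI)
    fix u v assume uv: "u \<in> Ar C" "v \<in> Ar C" "Cod C u = Dom C m" "Cod C v = Dom C m"
      "Dom C u = Dom C v" "m \<cdot> u = m \<cdot> v"
    then obtain h where "r0 \<cdot> h = u" "r1 \<cdot> h = v" using pullback_lift[OF pb, of u v] by metis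
    then show "u = v" using \<open>r0 = r1\<close> by simp
  qed (rule m)
qed

lemma image_factorization:
  assumes f [simp]: "f \<in> Ar C"
  obtains e m where "regular_epi C e" "monic C m" "e \<in> Ar C" "m \<in> Ar C" "Dom C e = Dom C f"
    "Cod C e = Dom C m" "Cod C m = Cod C f" "m \<cdot> e = f"
proof -
  obtain k0 k1 where pb: "is_pullback C f f k0 k1" using ex_pullback f by blast
  obtain e where e: "is_coequalizer C k0 k1 e" using ex_coequalizer_kernel_pair[OF pb] by blast
  note [simp] = pullbackD(1-4,6-9)[OF pb] coequalizerD(3,6)[OF e]
  note ek = coequalizerD(7)[OF e]
  obtain m where m [simp]: "m \<in> Ar C" "Dom C m = Cod C e" "Cod C m = Cod C f" "m \<cdot> e = f"
    by (rule coequalizer_factor[OF e, of f]) (simp_all, blast?)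
  note [simp] = reduce[OF m(4)]
  have reg: "regular_epi C e" unfolding regular_epi_def using e by blast
  have "monic C m"
  proof (rule monic_if_trivial_kernel)
    fix u assume u: "u \<in> Ar C" "Cod C u = Dom C m" "m \<cdot> u = \<zero> (Dom C u) (Cod C m)"
    obtain x y where xy: "is_pullback C e u x y" using ex_pullback[of e u] u by auto
    note [simp] = pullbackD(3,4,6-8)[OF xy] u(1,2)
    note eq = pullbackD(9)[OF xy]
    have "f \<cdot> x = m \<cdot> e \<cdot> x" by simp
    also have "\<dots> = m \<cdot> u \<cdot> y" by (simp only: eq)
    also have "\<dots> = \<zero> (Dom C x) (Cod C f)" using reduce[OF u(3), of y] by simp
    finally have fx: "f \<cdot> x = \<zero> (Dom C x) (Cod C f)" .
    \<comment> \<open>The pair \<open>(x, 0)\<close> lies in the kernel pair of \<open>f\<close>, so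
      \<open>e\<close> identifies its components. This makes \<open>u \<cdot> y\<close> zero, and
      \<open>y\<close> is epic as a pullback of \<open>e\<close>.\<close>
    obtain t where t: "t \<in> Ar C" "Cod C t = Dom C k0" "k0 \<cdot> t = x" "k1 \<cdot> t = \<zero> (Dom C x) (Dom C f)"
      "Dom C t = Dom C x"
      by (rule pullback_lift[OF pb, of x "\<zero> (Dom C x) (Dom C f)"]) (use fx in auto)
    have "e \<cdot> x = e \<cdot> k1 \<cdot> t" using reduce[OF ek, of t] t by simp
    then have [simp]: "u \<cdot> y = \<zero> (Dom C y) (Cod C e)" using t eq by simp
    show "u = \<zero> (Dom C u) (Dom C m)"
      by (rule epicD[OF regular_epi_epic[OF regular_epi_pullback[OF reg xy]]]) auto
  qed simp
  then show thesis using that[of e m] reg by auto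
qed

text \<open>The image factorisation shows that extremal epimorphisms are regular. Covers are
  recognised by this rule, without naming a pair that they coequalize.\<close>

lemma regular_epiI:
  assumes e: "e \<in> Ar C"
    and ext: "\<And>m u. \<lbrakk>monic C m; m \<in> Ar C; u \<in> Ar C; Cod C u = Dom C m; Dom C u = Dom C e; Cod C m = Cod C e; m \<cdot> u = e\<rbrakk>
      \<Longrightarrow> \<exists>t. t \<in> Ar C \<and> Cod C t = Dom C m \<and> m \<cdot> t = \<one> (Cod C e)"
  shows "regular_epi C e"
proof -
  obtain r m where *: "regular_epi C r" "monic C m" "r \<in> Ar C" "m \<in> Ar C" "Dom C r = Dom C e"
    "Cod C r = Dom C m" "Cod C m = Cod C e" "m \<cdot> r = e" by (rule image_factorization[OF e])
  then obtain t where "t \<in> Ar C" "Cod C t = Dom C m" "m \<cdot> t = \<one> (Cod C m)"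
    using ext[of m r] by auto
  then have "is_iso C m" using iso_if_monic_split * by blast
  then show ?thesis using iso_comp_regular_epi[OF *(1), of m] * by simp
qed

lemma regular_epi_cancel:
  assumes "regular_epi C (g \<cdot> f)" "f \<in> Ar C" "g \<in> Ar C" "Cod C f = Dom C g"
  shows "regular_epi C g"
proof (rule regular_epiI)
  fix m u assume m: "monic C m" "m \<in> Ar C" and u: "u \<in> Ar C" "Cod C u = Dom C m" "Dom C u = Dom C g"
    "Cod C m = Cod C g" "m \<cdot> u = g"
  obtain s where "s \<in> Ar C" "Cod C s = Dom C m" "m \<cdot> s = \<one> (Cod C g)"
    by (rule regular_epi_strong[OF assms(1) m(1), of "\<one> (Cod C g)" "u \<cdot> f"])
      (use assms u m reduce[OF u(5)] in auto)
  then show "\<exists>t. t \<in> Ar C \<and> Cod C t = Dom C m \<and> m \<cdot> t = \<one> (Cod C g)" by auto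
qed (rule assms)

lemma regular_epi_coprod_mor:
  assumes "regular_epi C f" "regular_epi C g"
  shows "regular_epi C (f \<oplus> g)"
proof (rule regular_epiI)
  note [simp] = regular_epi_Ar[OF assms(1)] regular_epi_Ar[OF assms(2)]
  define X Y X' Y' where defs: "X = Dom C f" "Y = Dom C g" "X' = Cod C f" "Y' = Cod C g"
  have [simp]: "Dom C f = X" "Dom C g = Y" "Cod C f = X'" "Cod C g = Y'" "X \<in> Ob C" "Y \<in> Ob C"
    "X' \<in> Ob C" "Y' \<in> Ob C" unfolding defs by auto
  show "f \<oplus> g \<in> Ar C" by simp
  fix m u assume m: "monic C m" "m \<in> Ar C" and u: "u \<in> Ar C" "Cod C u = Dom C m" "Dom C u = Dom C (f \<oplus> g)"
    "Cod C m = Cod C (f \<oplus> g)" "m \<cdot> u = f \<oplus> g"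
  note [simp] = m(2) u
  note [simp] = reduce[OF u(5)]
  obtain t where t: "t \<in> Ar C" "Dom C t = X'" "Cod C t = Dom C m" "m \<cdot> t = in1 X' Y'"
    by (rule regular_epi_strong[OF assms(1) m(1), of "in1 X' Y'" "u \<cdot> in1 X Y"]) auto
  obtain s where s: "s \<in> Ar C" "Dom C s = Y'" "Cod C s = Dom C m" "m \<cdot> s = in2 X' Y'"
    by (rule regular_epi_strong[OF assms(2) m(1), of "in2 X' Y'" "u \<cdot> in2 X Y"]) auto
  show "\<exists>t. t \<in> Ar C \<and> Cod C t = Dom C m \<and> m \<cdot> t = \<one> (Cod C (f \<oplus> g))"
    using t s by (intro exI[of _ "t \<triangledown> s"]) auto
qed

lemma regular_epi_kernel_pair_factor:
  assumes "regular_epi C e" "is_pullback C e e k0 k1" "f \<in> Ar C" "Dom C f = Dom C e" "f \<cdot> k0 = f \<cdot> k1"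
  obtains h where "h \<in> Ar C" "Dom C h = Cod C e" "Cod C h = Cod C f" "h \<cdot> e = f"
proof -
  obtain u v where c: "is_coequalizer C u v e" using assms(1) unfolding regular_epi_def by blast
  note [simp] = coequalizerD(1-6)[OF c] assms(3,4) pullbackD(1-4,6-9)[OF assms(2)]
  obtain t where t: "t \<in> Ar C" "Cod C t = Dom C k0" "k0 \<cdot> t = u" "k1 \<cdot> t = v"
    by (rule pullback_lift[OF assms(2), of u v]) (use coequalizerD(7)[OF c] in auto)
  have "f \<cdot> u = f \<cdot> v" using reduce[OF assms(5), of t] t by simp
  then obtain h where "h \<in> Ar C" "Dom C h = Cod C e" "Cod C h = Cod C f" "h \<cdot> e = f"
    using coequalizer_factor[OF c assms(3)] assms(4) by auto
  then show thesis by (rule that)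
qed

text \<open>The point is that the kernel pair of \<open>f\<close> is covered by the diagonal and the kernel of \<open>f\<close>.\<close>

lemma regular_epi_kernel_factor:
  assumes "regular_epi C f" and k: "is_kernel C f k"
    and g: "g \<in> Ar C" "Dom C g = Dom C f" "g \<cdot> k = \<zero> (Dom C k) (Cod C g)"
  obtains h where "h \<in> Ar C" "Dom C h = Cod C f" "Cod C h = Cod C g" "h \<cdot> f = g"
proof -
  obtain r0 r1 where pb: "is_pullback C f f r0 r1" using ex_pullback kernelD(1)[OF k] by blast
  obtain d where d [simp]: "d \<in> Ar C" "Dom C d = Dom C f" "Cod C d = Dom C r0" "r0 \<cdot> d = \<one> (Dom C f)" "r1 \<cdot> d = \<one> (Dom C f)"
    by (rule kernel_pair_diagonal[OF pb])
  obtain l where l: "is_kernel C r1 l" "l \<in> Ar C" "Dom C l = Dom C k" "Cod C l = Dom C r0"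
    "r0 \<cdot> l = k" "r1 \<cdot> l = \<zero> (Dom C k) (Cod C r1)" by (rule pullback_kernel[OF pb k])
  note [simp] = pullbackD(1-4,6-9)[OF pb] g l(2-) kernelD[OF k]
  have "g \<cdot> r0 = g \<cdot> r1"
    by (rule jointly_strong_epic[OF point_kernel_strong[OF _ _ _ _ l(1), of d]]) auto
  then show thesis using regular_epi_kernel_pair_factor[OF assms(1) pb g(1,2)] that by blast
qed

text \<open>Pull \<open>q\<close> back along \<open>q \<cdot> m\<close>. The projection
  \<open>p2\<close> is split by the lift of \<open>m\<close> and has the kernel of \<open>q\<close>;
  on both generators \<open>p1\<close> factors through \<open>m\<close>, so \<open>p1\<close> itself
  does. But \<open>p1\<close> is a regular epimorphism, being a pullback of
  \<open>q \<cdot> m\<close>.\<close>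

lemma short_five_monic:
  assumes m: "monic C m" and q: "q \<in> Ar C" "Dom C q = Cod C m" and reg: "regular_epi C (q \<cdot> m)"
    and k: "is_kernel C q k" and u: "u \<in> Ar C" "Cod C u = Dom C m" "m \<cdot> u = k"
  shows "is_iso C m"
proof -
  note [simp] = monic_Ar[OF m] q kernelD[OF k] u
  obtain p1 p2 where pb: "is_pullback C q (q \<cdot> m) p1 p2" using ex_pullback[of q "q \<cdot> m"] by auto
  obtain l where l: "is_kernel C p2 l" "l \<in> Ar C" "Dom C l = Dom C k" "Cod C l = Dom C p1"
    "p1 \<cdot> l = k" "p2 \<cdot> l = \<zero> (Dom C k) (Cod C p2)" by (rule pullback_kernel[OF pb k])
  note [simp] = l(2-)
  obtain s where s [simp]: "s \<in> Ar C" "Dom C s = Dom C m" "Cod C s = Dom C p1" "p1 \<cdot> s = m" "p2 \<cdot> s = \<one> (Dom C m)"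
    by (rule pullback_lift[OF pb, of m "\<one> (Dom C m)"]) auto
  have [simp]: "p1 \<in> Ar C" "p2 \<in> Ar C" "Cod C p1 = Cod C m" "Cod C p2 = Dom C m" "Dom C p2 = Dom C p1"
    using pullbackD[OF pb] by auto
  obtain t where t: "t \<in> Ar C" "Dom C t = Dom C p1" "Cod C t = Dom C m" "m \<cdot> t = p1"
    by (rule jointly_strong_factor[OF point_kernel_strong[OF _ _ _ _ l(1), of s] m, of p1 u "\<one> (Dom C m)"]) auto
  have "regular_epi C p1" using regular_epi_pullback[OF reg pullback_sym[OF pb]] .
  from regular_epi_extremal[OF this m, of t] t show ?thesis by simp
qed

text \<open>The comparison \<open>c\<close> into the pullback of \<open>p'\<close> along
  \<open>g\<close> is a regular epimorphism, and \<open>l\<close> is a pullback of \<open>c\<close>.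
  The section \<open>s\<close> is what makes \<open>c\<close> a cover, since it lifts the kernel of
  \<open>g\<close>.\<close>

lemma kernel_map_regular_epi:
  assumes pt: "p \<in> Ar C" "s \<in> Ar C" "Cod C s = Dom C p" "p \<cdot> s = \<one> (Cod C p)"
    and pt': "p' \<in> Ar C" "s' \<in> Ar C" "Cod C s' = Dom C p'" "p' \<cdot> s' = \<one> (Cod C p')"
    and f: "regular_epi C f" "Dom C f = Dom C p" "Cod C f = Dom C p'"
    and g: "regular_epi C g" "Dom C g = Cod C p" "Cod C g = Cod C p'"
    and sq: "p' \<cdot> f = g \<cdot> p" "f \<cdot> s = s' \<cdot> g"
    and k: "is_kernel C p k" and k': "is_kernel C p' k'"
    and l: "l \<in> Ar C" "Dom C l = Dom C k" "Cod C l = Dom C k'" "k' \<cdot> l = f \<cdot> k"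
  shows "regular_epi C l"
proof -
  note [simp] = pt pt' regular_epi_Ar[OF f(1)] regular_epi_Ar[OF g(1)] f(2,3) g(2,3) sq kernelD[OF k] kernelD[OF k'] l
  note [simp] = reduce[OF pt(4)] reduce[OF pt'(4)] reduce[OF sq(1)] reduce[OF sq(2)]
    reduce[OF kernelD(4)[OF k]] reduce[OF kernelD(4)[OF k']] reduce[OF l(4)]
  have [simp]: "Dom C s = Cod C p" "Dom C s' = Cod C p'" using dom_eq[OF pt(4)] dom_eq[OF pt'(4)] by auto
  obtain p1 p2 where pb: "is_pullback C p' g p1 p2" using ex_pullback[of p' g] by auto
  note [simp] = pullbackD(3,4,6-9)[OF pb] reduce[OF pullbackD(9)[OF pb]]
  obtain c where c [simp]: "c \<in> Ar C" "Dom C c = Dom C p" "Cod C c = Dom C p1" "p1 \<cdot> c = f" "p2 \<cdot> c = p"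
    by (rule pullback_lift[OF pb, of f p]) auto
  note [simp] = reduce[OF c(4)] reduce[OF c(5)]
  obtain n where n: "is_kernel C g n" using ex_kernel[of g] by auto
  obtain n' where n': "is_kernel C p1 n'" "n' \<in> Ar C" "Dom C n' = Dom C n" "Cod C n' = Dom C p2"
    "p2 \<cdot> n' = n" "p1 \<cdot> n' = \<zero> (Dom C n) (Cod C p1)" by (rule pullback_kernel[OF pullback_sym[OF pb] n])
  note [simp] = kernelD[OF n] n'(2-)
  have creg: "regular_epi C c"
  proof (rule regular_epiI)
    fix m u assume m: "monic C m" "m \<in> Ar C" and u: "u \<in> Ar C" "Cod C u = Dom C m" "Dom C u = Dom C c"
      "Cod C m = Cod C c" "m \<cdot> u = c"
    note [simp] = m(2) u reduce[OF u(5)]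
    \<comment> \<open>The kernel of \<open>p1\<close> is that of \<open>g\<close>, and it is reached
      by \<open>c\<close> along the section \<open>s\<close>.\<close>
    have *: "m \<cdot> u \<cdot> s \<cdot> n = n'"
      by (rule pullback_ext[OF pb]) auto
    have "regular_epi C ((p1 \<cdot> m) \<cdot> u)" using f(1) by simp
    then have "regular_epi C (p1 \<cdot> m)" by (rule regular_epi_cancel) auto
    from short_five_monic[OF m(1) _ _ this n'(1), of "u \<cdot> s \<cdot> n"] * have "is_iso C m" by simp
    then show "\<exists>t. t \<in> Ar C \<and> Cod C t = Dom C m \<and> m \<cdot> t = \<one> (Cod C c)"
      by (rule is_isoE) auto
  qed simp
  \<comment> \<open>The kernel of \<open>p'\<close> sits in the pullback as the pairs
    \<open>(k', 0)\<close>; over these, \<open>c\<close> restricts to \<open>l\<close>.\<close>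
  obtain j where j [simp]: "j \<in> Ar C" "Dom C j = Dom C k'" "Cod C j = Dom C p1" "p1 \<cdot> j = k'"
    "p2 \<cdot> j = \<zero> (Dom C k') (Cod C p)"
    by (rule pullback_lift[OF pb, of k' "\<zero> (Dom C k') (Cod C p)"]) auto
  note [simp] = reduce[OF j(4)] reduce[OF j(5)]
  have "is_pullback C c j k l"
  proof (rule pullbackI)
    show "c \<cdot> k = j \<cdot> l" by (rule pullback_ext[OF pb]) auto
    fix u v assume u: "u \<in> Ar C" "v \<in> Ar C" "Cod C u = Dom C c" "Cod C v = Dom C j" "Dom C v = Dom C u"
      "c \<cdot> u = j \<cdot> v"
    have "p \<cdot> u = p2 \<cdot> c \<cdot> u" using u(1-5) by simp
    also have "\<dots> = p2 \<cdot> j \<cdot> v" by (simp only: u(6))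
    also have "\<dots> = \<zero> (Dom C u) (Cod C p)" using u(1-5) by simp
    finally have pu: "p \<cdot> u = \<zero> (Dom C u) (Cod C p)" .
    obtain h where h: "h \<in> Ar C" "Dom C h = Dom C u" "Cod C h = Dom C k" "k \<cdot> h = u"
      by (rule kernel_lift[OF k, of u]) (use u pu in auto)
    have "k' \<cdot> l \<cdot> h = p1 \<cdot> c \<cdot> u" using h u(1-5) by simp
    also have "\<dots> = p1 \<cdot> j \<cdot> v" by (simp only: u(6))
    also have "\<dots> = k' \<cdot> v" using u(1-5) by simp
    finally have "l \<cdot> h = v" using h u(1-5) by (intro monicD[OF kernel_monic[OF k'], of "l \<cdot> h" v]) simp_all
    with h show "\<exists>h. h \<in> Ar C \<and> Dom C h = Dom C u \<and> Cod C h = Dom C k \<and> k \<cdot> h = u \<and> l \<cdot> h = v"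
      by blast
  next
    fix h h' assume "h \<in> Ar C" "h' \<in> Ar C" "Cod C h = Dom C k" "Cod C h' = Dom C k" "k \<cdot> h = k \<cdot> h'"
    then show "h = h'" by (intro monicD[OF kernel_monic[OF k], of h h'])
  qed auto
  from regular_epi_pullback[OF creg this] show ?thesis .
qed

section \<open>Reflexive relations and coequalizers\<close>

text \<open>The relation is first seen to be Euclidean: \<open>x R y\<close> and \<open>x R z\<close> imply
  \<open>y R z\<close>, because this holds for \<open>y = z\<close> and for \<open>y = x\<close>.\<close>

lemma reflexive_relation_equivalence:
  assumes r: "r0 \<in> Ar C" "r1 \<in> Ar C" "Dom C r1 = Dom C r0" "Cod C r0 = X" "Cod C r1 = X"
    and mon: "monic C \<langle>r0, r1\<rangle>"
    and e: "e \<in> Ar C" "Cod C e = Dom C r0" "r0 \<cdot> e = \<one> X" "r1 \<cdot> e = \<one> X"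
  shows "is_equivalence_relation C X r0 r1"
proof -
  note [simp] = r e reduce[OF e(3)] reduce[OF e(4)]
  have [simp]: "X \<in> Ob C" using r(4) r(1) Cod_Ob by blast
  have [simp]: "Dom C e = X" using dom_eq[OF e(3)] by simp
  have jm: "u = v" if "u \<in> Ar C" "v \<in> Ar C" "Cod C u = Dom C r0" "Cod C v = Dom C r0"
    "r0 \<cdot> u = r0 \<cdot> v" "r1 \<cdot> u = r1 \<cdot> v" for u v
    using that by (intro monicD[OF mon, of u v]) auto
  obtain a b where pb: "is_pullback C r0 r0 a b" using ex_pullback by (metis r(1))
  note [simp] = pullbackD(1-4,6-9)[OF pb] reduce[OF pullbackD(9)[OF pb]]
  obtain d where d [simp]: "d \<in> Ar C" "Dom C d = Dom C r0" "Cod C d = Dom C a" "a \<cdot> d = \<one> (Dom C r0)" "b \<cdot> d = \<one> (Dom C r0)"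
    by (rule kernel_pair_diagonal[OF pb])
  obtain c where c [simp]: "c \<in> Ar C" "Dom C c = Dom C r0" "Cod C c = Dom C a" "a \<cdot> c = e \<cdot> r0" "b \<cdot> c = \<one> (Dom C r0)"
    by (rule pullback_lift[OF pb, of "e \<cdot> r0" "\<one> (Dom C r0)"]) auto
  note [simp] = reduce[OF c(4)] reduce[OF c(5)]
  \<comment> \<open>The pairs \<open>(x R y, x R z)\<close> are split over \<open>x R y\<close> by
    \<open>d\<close>. Changing base along \<open>e\<close> forces \<open>y = x\<close> and leaves
    the relation itself, embedded by \<open>c\<close>; so \<open>c\<close> and \<open>d\<close>
    generate.\<close>
  have "is_pullback C e a r0 c"
  proof (rule pullbackI)
    fix u v assume u: "u \<in> Ar C" "v \<in> Ar C" "Cod C u = Dom C e" "Cod C v = Dom C a" "Dom C v = Dom C u" "e \<cdot> u = a \<cdot> v"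
    have "r0 \<cdot> b \<cdot> v = r0 \<cdot> a \<cdot> v" using u(1-5) by simp
    also have "\<dots> = r0 \<cdot> e \<cdot> u" by (simp only: u(6))
    also have "\<dots> = u" using u(1-5) by simp
    finally have 1: "r0 \<cdot> b \<cdot> v = u" .
    have "c \<cdot> b \<cdot> v = v"
      by (rule pullback_ext[OF pb]) (use u 1 in auto)
    with 1 u show "\<exists>h. h \<in> Ar C \<and> Dom C h = Dom C u \<and> Cod C h = Dom C r0 \<and> r0 \<cdot> h = u \<and> c \<cdot> h = v"
      by (intro exI[of _ "b \<cdot> v"]) simp
  next
    fix h k assume h: "h \<in> Ar C" "k \<in> Ar C" "Cod C h = Dom C r0" "Cod C k = Dom C r0" "c \<cdot> h = c \<cdot> k"
    have "b \<cdot> c \<cdot> h = b \<cdot> c \<cdot> k" by (simp only: h(5))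
    then show "h = k" using h(1-4) by simp
  qed auto
  then have js: "jointly_strong c d" by (intro point_pullback_strong) auto
  obtain t where t [simp]: "t \<in> Ar C" "Dom C t = Dom C a" "Cod C t = Dom C r0" and
    mt: "\<langle>r0, r1\<rangle> \<cdot> t = \<langle>r1 \<cdot> a, r1 \<cdot> b\<rangle>"
    by (rule jointly_strong_factor[OF js mon, of "\<langle>r1 \<cdot> a, r1 \<cdot> b\<rangle>" "\<one> (Dom C r0)" "e \<cdot> r1"]) auto
  have "pr1 X X \<cdot> \<langle>r0, r1\<rangle> \<cdot> t = pr1 X X \<cdot> \<langle>r1 \<cdot> a, r1 \<cdot> b\<rangle>"
    "pr2 X X \<cdot> \<langle>r0, r1\<rangle> \<cdot> t = pr2 X X \<cdot> \<langle>r1 \<cdot> a, r1 \<cdot> b\<rangle>" using mt by auto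
  then have rt [simp]: "r0 \<cdot> t = r1 \<cdot> a" "r1 \<cdot> t = r1 \<cdot> b" by simp_all
  note [simp] = reduce[OF rt(1)] reduce[OF rt(2)]
  obtain x where x [simp]: "x \<in> Ar C" "Dom C x = Dom C r0" "Cod C x = Dom C a" "a \<cdot> x = \<one> (Dom C r0)" "b \<cdot> x = e \<cdot> r0"
    by (rule pullback_lift[OF pb, of "\<one> (Dom C r0)" "e \<cdot> r0"]) auto
  \<comment> \<open>Symmetry: \<open>x R y\<close> and \<open>x R x\<close> give
    \<open>y R x\<close>.\<close>
  define s where "s = t \<cdot> x"
  have s [simp]: "s \<in> Ar C" "Dom C s = Dom C r0" "Cod C s = Dom C r0" "r0 \<cdot> s = r1" "r1 \<cdot> s = r0"
    unfolding s_def by auto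
  note [simp] = reduce[OF s(4)] reduce[OF s(5)]
  show ?thesis
    unfolding is_equivalence_relation_def
  proof (intro conjI allI ballI impI)
    show "\<exists>e\<in>Hom C X (Dom C r0). r0 \<cdot> e = \<one> X \<and> r1 \<cdot> e = \<one> X" by (intro bexI[of _ e]) auto
    show "\<exists>s\<in>Hom C (Dom C r0) (Dom C r0). r0 \<cdot> s = r1 \<and> r1 \<cdot> s = r0" by (intro bexI[of _ s]) auto
    fix T u v assume "\<guillemotleft>u : T \<rightarrow> Dom C r0\<guillemotright>" "\<guillemotleft>v : T \<rightarrow> Dom C r0\<guillemotright>" "r0 \<cdot> u = r0 \<cdot> v" "r1 \<cdot> u = r1 \<cdot> v"
    then show "u = v" by (intro jm[of u v]) auto
  next
    fix u v assume uv: "is_pullback C r1 r0 u v"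
    note uvD = pullbackD[OF uv]
    \<comment> \<open>Transitivity: symmetry turns \<open>x R y\<close> into \<open>y R x\<close>,
      and the Euclidean property applies to \<open>y R x\<close> and \<open>y R z\<close>.\<close>
    obtain y where y: "y \<in> Ar C" "Dom C y = Dom C u" "Cod C y = Dom C a" "a \<cdot> y = s \<cdot> u" "b \<cdot> y = v"
      by (rule pullback_lift[OF pb, of "s \<cdot> u" v]) (use uvD in auto)
    then show "\<exists>t\<in>Hom C (Dom C u) (Dom C r0). r0 \<cdot> t = r0 \<cdot> u \<and> r1 \<cdot> t = r1 \<cdot> v"
      using uvD by (intro bexI[of _ "t \<cdot> y"]) auto
  qed auto
qed

text \<open>The image of a reflexive pair is a reflexive relation, hence an equivalence relation,
  hence a kernel pair by exactness; \<open>e\<close> is the cover of that image.\<close>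

lemma reflexive_pair_effective:
  assumes d: "d0 \<in> Ar C" "d1 \<in> Ar C" "Dom C d1 = Dom C d0" "Cod C d1 = Cod C d0"
    and s: "s \<in> Ar C" "Cod C s = Dom C d0" "d0 \<cdot> s = \<one> (Cod C d0)" "d1 \<cdot> s = \<one> (Cod C d0)"
  obtains f r0 r1 e where "is_pullback C f f r0 r1" "regular_epi C e" "e \<in> Ar C" "Dom C e = Dom C d0" "Cod C e = Dom C r0"
    "r0 \<cdot> e = d0" "r1 \<cdot> e = d1" "Dom C f = Cod C d0"
proof -
  define Y where "Y = Cod C d0"
  note [simp] = d s
  have [simp]: "Cod C d0 = Y" "Y \<in> Ob C" unfolding Y_def by auto
  obtain e m where em: "regular_epi C e" "monic C m" "e \<in> Ar C" "m \<in> Ar C" "Dom C e = Dom C d0"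
    "Cod C e = Dom C m" "Cod C m = Y \<otimes> Y" "m \<cdot> e = \<langle>d0, d1\<rangle>"
    by (rule image_factorization[of "\<langle>d0, d1\<rangle>"]) auto
  note [simp] = em(3-8) reduce[OF em(8)]
  define r0 r1 where r_def: "r0 = pr1 Y Y \<cdot> m" "r1 = pr2 Y Y \<cdot> m"
  have r [simp]: "r0 \<in> Ar C" "r1 \<in> Ar C" "Dom C r0 = Dom C m" "Dom C r1 = Dom C m" "Cod C r0 = Y" "Cod C r1 = Y"
    "r0 \<cdot> e = d0" "r1 \<cdot> e = d1"
    unfolding r_def by auto
  note [simp] = reduce[OF r(7)] reduce[OF r(8)]
  have "\<langle>r0, r1\<rangle> = m" unfolding r_def by (rule product_ext[of _ _ Y Y]) auto
  then have "is_equivalence_relation C Y r0 r1"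
    by (intro reflexive_relation_equivalence[of _ _ _ "e \<cdot> s"]) (use em in auto)
  then obtain f where "is_pullback C f f r0 r1"
    using semi_abelian unfolding semi_abelian_def barr_exact_def by blast
  then show thesis using that[of f r0 r1 e] em pullbackD(6)[of f f r0 r1] by auto
qed

text \<open>The kernel pair supplied by exactness belongs to some \<open>f\<close>. It is also that
  of \<open>q\<close>: on the one hand \<open>f\<close> factors through \<open>q\<close>, on the
  other \<open>q\<close> identifies \<open>r0\<close> and \<open>r1\<close> because \<open>e\<close>
  is epic.\<close>

lemma reflexive_pair_covers_kernel_pair:
  assumes d: "d0 \<in> Ar C" "d1 \<in> Ar C" "Dom C d1 = Dom C d0" "Cod C d1 = Cod C d0"
    and s: "s \<in> Ar C" "Cod C s = Dom C d0" "d0 \<cdot> s = \<one> (Cod C d0)" "d1 \<cdot> s = \<one> (Cod C d0)"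
    and q: "q \<in> Ar C" "Dom C q = Cod C d0" "q \<cdot> d0 = q \<cdot> d1"
    and factor: "\<And>f. f \<in> Ar C \<Longrightarrow> Dom C f = Cod C d0 \<Longrightarrow> f \<cdot> d0 = f \<cdot> d1 \<Longrightarrow>
      \<exists>h. h \<in> Ar C \<and> Dom C h = Cod C q \<and> Cod C h = Cod C f \<and> h \<cdot> q = f"
  obtains r0 r1 e where "is_pullback C q q r0 r1" "regular_epi C e" "e \<in> Ar C" "Dom C e = Dom C d0" "Cod C e = Dom C r0"
    "r0 \<cdot> e = d0" "r1 \<cdot> e = d1"
proof -
  obtain f r0 r1 e where pb: "is_pullback C f f r0 r1" and e: "regular_epi C e" "e \<in> Ar C" "Dom C e = Dom C d0" "Cod C e = Dom C r0"
    and re: "r0 \<cdot> e = d0" "r1 \<cdot> e = d1" and f: "Dom C f = Cod C d0"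
    by (rule reflexive_pair_effective[OF d s])
  note [simp] = d q(1,2) e(2-) re f pullbackD(1-4,6-8)[OF pb] reduce[OF re(1)] reduce[OF re(2)]
  note fr = pullbackD(9)[OF pb]
  have "f \<cdot> d0 = f \<cdot> d1" using reduce[OF fr, of e] by simp
  then obtain h where h: "h \<in> Ar C" "Dom C h = Cod C q" "Cod C h = Cod C f" "h \<cdot> q = f"
    using factor[of f] by auto
  have qr: "q \<cdot> r0 = q \<cdot> r1"
    by (rule epicD[OF regular_epi_epic[OF e(1)]]) (use q(3) in auto)
  have "is_pullback C q q r0 r1"
  proof (rule pullbackI)
    fix u v assume u: "u \<in> Ar C" "v \<in> Ar C" "Cod C u = Dom C q" "Cod C v = Dom C q" "Dom C v = Dom C u" "q \<cdot> u = q \<cdot> v"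
    have "h \<cdot> q \<cdot> u = h \<cdot> q \<cdot> v" using u(6) by simp
    then have "f \<cdot> u = f \<cdot> v" using reduce[OF h(4), of u] reduce[OF h(4), of v] h u(1-5) by simp
    then show "\<exists>h. h \<in> Ar C \<and> Dom C h = Dom C u \<and> Cod C h = Dom C r0 \<and> r0 \<cdot> h = u \<and> r1 \<cdot> h = v"
      using pullback_lift[OF pb, of u v] u by (metis f q(2))
  next
    fix a b assume "a \<in> Ar C" "b \<in> Ar C" "Cod C a = Dom C r0" "Cod C b = Dom C r0" "r0 \<cdot> a = r0 \<cdot> b" "r1 \<cdot> a = r1 \<cdot> b"
    then show "a = b" by (intro pullback_ext[OF pb, of a b])
  qed (use qr in auto)
  then show thesis using that e re by blast
qed

lemma ex_coequalizer:
  assumes u: "u \<in> Ar C" "v \<in> Ar C" "Dom C v = Dom C u" "Cod C v = Cod C u"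
  obtains e where "is_coequalizer C u v e"
proof -
  define Z Y where defs: "Z = Dom C u" "Y = Cod C u"
  have [simp]: "Dom C u = Z" "Dom C v = Z" "Cod C u = Y" "Cod C v = Y" "u \<in> Ar C" "v \<in> Ar C" "Z \<in> Ob C" "Y \<in> Ob C"
    using u unfolding defs by auto
  \<comment> \<open>An extra summand \<open>Y\<close>, mapped by the identity, makes the pair
    reflexive without changing which morphisms identify it.\<close>
  obtain f r0 r1 e where pb: "is_pullback C f f r0 r1" and e: "regular_epi C e" "e \<in> Ar C" "Dom C e = Z \<uplus> Y" "Cod C e = Dom C r0"
    and re: "r0 \<cdot> e = u \<triangledown> \<one> Y" "r1 \<cdot> e = v \<triangledown> \<one> Y" and f: "Dom C f = Y"
    by (rule reflexive_pair_effective[of "u \<triangledown> \<one> Y" "v \<triangledown> \<one> Y" "in2 Z Y"]) auto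
  obtain q where q: "is_coequalizer C r0 r1 q" using ex_coequalizer_kernel_pair[OF pb] by blast
  note [simp] = e(2-) re f pullbackD(1-4,6-8)[OF pb] reduce[OF re(1)] reduce[OF re(2)] coequalizerD(3,6)[OF q]
  note qr = coequalizerD(7)[OF q]
  have "is_coequalizer C u v q"
  proof (rule coequalizerI)
    have "q \<cdot> r0 \<cdot> e \<cdot> in1 Z Y = q \<cdot> r1 \<cdot> e \<cdot> in1 Z Y" using reduce[OF qr, of "e \<cdot> in1 Z Y"] by (simp del: re)
    then show "q \<cdot> u = q \<cdot> v" by simp
    fix g assume g: "g \<in> Ar C" "Dom C g = Cod C u" "g \<cdot> u = g \<cdot> v"
    have "g \<cdot> r0 = g \<cdot> r1"
      by (rule epicD[OF regular_epi_epic[OF e(1)]]) (use g in auto)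
    then show "\<exists>h. h \<in> Ar C \<and> Dom C h = Cod C q \<and> Cod C h = Cod C g \<and> h \<cdot> q = g"
      using coequalizer_factor[OF q, of g] g by (metis \<open>Cod C r0 = Dom C f\<close> \<open>Cod C u = Y\<close> f)
  qed (use coequalizer_epic[OF q] in auto)
  then show thesis by (rule that)
qed

end

context semi_abelian_category
begin

section \<open>Cosmash products\<close>

lemma factor_eq:
  assumes "monic C m" "h \<in> Ar C" "Cod C h = Dom C m" "m \<cdot> h = f"
  shows "factor C m f = h"
  unfolding factor_def
proof (rule the_equality)
  note [simp] = monic_Ar[OF assms(1)]
  show "\<guillemotleft>h : Dom C f \<rightarrow> Dom C m\<guillemotright> \<and> m \<cdot> h = f" using assms(2-4) by auto
  fix h' assume "\<guillemotleft>h' : Dom C f \<rightarrow> Dom C m\<guillemotright> \<and> m \<cdot> h' = f"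
  then show "h' = h" using assms by (intro monicD[OF assms(1), of h' h]) auto
qed

lemma factor_kernel:
  assumes k: "is_kernel C f k" and u: "u \<in> Ar C" "Cod C u = Dom C f" "f \<cdot> u = \<zero> (Dom C u) (Cod C f)"
  shows "factor C k u \<in> Ar C" "Dom C (factor C k u) = Dom C u" "Cod C (factor C k u) = Dom C k"
    "k \<cdot> factor C k u = u"
proof -
  obtain h where "h \<in> Ar C" "Dom C h = Dom C u" "Cod C h = Dom C k" "k \<cdot> h = u"
    using kernel_lift[OF k u] .
  moreover from this have "factor C k u = h" by (intro factor_eq[OF kernel_monic[OF k]])
  ultimately show "factor C k u \<in> Ar C" "Dom C (factor C k u) = Dom C u" "Cod C (factor C k u) = Dom C k"
    "k \<cdot> factor C k u = u" by auto
qed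

lemma comp_zero_via:
  assumes "h = l \<cdot> m" "l \<in> Ar C" "m \<in> Ar C" "Dom C l = Cod C m" "k \<in> Ar C" "Cod C k = Dom C m"
    "m \<cdot> k = \<zero> (Dom C k) (Cod C m)"
  shows "h \<cdot> k = \<zero> (Dom C k) (Cod C h)"
proof -
  have "h \<cdot> k = l \<cdot> m \<cdot> k" using assms(2-6) by (simp add: assms(1))
  also have "\<dots> = \<zero> (Dom C k) (Cod C h)" using assms(2-6) by (simp add: assms(7) assms(1))
  finally show ?thesis .
qed

lemma cosmash_kernel:
  assumes "X \<in> Ob C" "Y \<in> Ob C"
  shows "is_kernel C \<langle>\<one> X \<triangledown> \<zero> Y X, \<zero> X Y \<triangledown> \<one> Y\<rangle> (cosmash_incl C X Y)"
  unfolding cosmash_incl_def by (rule is_kernel_kernel) (use assms in simp)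

lemma cosmash_incl_simps [simp]:
  assumes "X \<in> Ob C" "Y \<in> Ob C"
  shows "cosmash_incl C X Y \<in> Ar C" "Dom C (cosmash_incl C X Y) = cosmash C X Y"
    "Cod C (cosmash_incl C X Y) = X \<uplus> Y" "cosmash C X Y \<in> Ob C"
  using kernelD[OF cosmash_kernel[OF assms]] assms by (auto simp: cosmash_def)

lemma cosmash_incl_monic: "X \<in> Ob C \<Longrightarrow> Y \<in> Ob C \<Longrightarrow> monic C (cosmash_incl C X Y)"
  by (rule kernel_monic[OF cosmash_kernel])

text \<open>A morphism that is zero on one summand factors through the projection onto the other,
  and both projections kill the cosmash product.\<close>

lemma cosmash_incl_zero:
  assumes XY: "X \<in> Ob C" "Y \<in> Ob C" and h: "h \<in> Ar C" "Dom C h = X \<uplus> Y"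
    and z: "h \<cdot> in1 X Y = \<zero> X (Cod C h) \<or> h \<cdot> in2 X Y = \<zero> Y (Cod C h)"
  shows "h \<cdot> cosmash_incl C X Y = \<zero> (cosmash C X Y) (Cod C h)"
proof -
  note [simp] = XY h
  let ?k = "cosmash_incl C X Y"
  have "\<langle>\<one> X \<triangledown> \<zero> Y X, \<zero> X Y \<triangledown> \<one> Y\<rangle> \<cdot> ?k = \<zero> (cosmash C X Y) (X \<otimes> Y)"
    using kernelD[OF cosmash_kernel[OF XY]] by simp
  then have "pr1 X Y \<cdot> \<langle>\<one> X \<triangledown> \<zero> Y X, \<zero> X Y \<triangledown> \<one> Y\<rangle> \<cdot> ?k = \<zero> (cosmash C X Y) X"
    "pr2 X Y \<cdot> \<langle>\<one> X \<triangledown> \<zero> Y X, \<zero> X Y \<triangledown> \<one> Y\<rangle> \<cdot> ?k = \<zero> (cosmash C X Y) Y" by (simp_all del: pairing_comp)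
  then have k: "(\<one> X \<triangledown> \<zero> Y X) \<cdot> ?k = \<zero> (cosmash C X Y) X" "(\<zero> X Y \<triangledown> \<one> Y) \<cdot> ?k = \<zero> (cosmash C X Y) Y"
    by simp_all
  from z show ?thesis
  proof
    assume z: "h \<cdot> in1 X Y = \<zero> X (Cod C h)"
    have "h = (h \<cdot> in2 X Y) \<cdot> (\<zero> X Y \<triangledown> \<one> Y)"
      by (rule coproduct_ext[of _ _ X Y]) (use z in auto)
    from comp_zero_via[OF this, of ?k] show ?thesis using k(2) by simp
  next
    assume z: "h \<cdot> in2 X Y = \<zero> Y (Cod C h)"
    have "h = (h \<cdot> in1 X Y) \<cdot> (\<one> X \<triangledown> \<zero> Y X)"
      by (rule coproduct_ext[of _ _ X Y]) (use z in auto)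
    from comp_zero_via[OF this, of ?k] show ?thesis using k(1) by simp
  qed
qed

lemma cosmash_lift:
  assumes XY: "X \<in> Ob C" "Y \<in> Ob C" and u: "u \<in> Ar C" "Cod C u = X \<uplus> Y"
    "(\<one> X \<triangledown> \<zero> Y X) \<cdot> u = \<zero> (Dom C u) X" "(\<zero> X Y \<triangledown> \<one> Y) \<cdot> u = \<zero> (Dom C u) Y"
  shows "factor C (cosmash_incl C X Y) u \<in> Ar C" "Dom C (factor C (cosmash_incl C X Y) u) = Dom C u"
    "Cod C (factor C (cosmash_incl C X Y) u) = cosmash C X Y"
    "cosmash_incl C X Y \<cdot> factor C (cosmash_incl C X Y) u = u"
  using factor_kernel[OF cosmash_kernel[OF XY], of u] XY u by simp_all

lemma cosmash_mor_simps [simp]: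
  assumes "f \<in> Ar C" "g \<in> Ar C"
  shows "cosmash_mor C f g \<in> Ar C" "Dom C (cosmash_mor C f g) = cosmash C (Dom C f) (Dom C g)"
    "Cod C (cosmash_mor C f g) = cosmash C (Cod C f) (Cod C g)"
    "Cod C f = X \<Longrightarrow> Cod C g = Y \<Longrightarrow>
      cosmash_incl C X Y \<cdot> cosmash_mor C f g = (f \<oplus> g) \<cdot> cosmash_incl C (Dom C f) (Dom C g)"
proof -
  let ?u = "(f \<oplus> g) \<cdot> cosmash_incl C (Dom C f) (Dom C g)"
  have 1: "(\<one> (Cod C f) \<triangledown> \<zero> (Cod C g) (Cod C f)) \<cdot> ?u = \<zero> (Dom C ?u) (Cod C f)"
    using assms by (simp add: cosmash_incl_zero)
  have 2: "(\<zero> (Cod C f) (Cod C g) \<triangledown> \<one> (Cod C g)) \<cdot> ?u = \<zero> (Dom C ?u) (Cod C g)"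
    using assms by (simp add: cosmash_incl_zero)
  note * = cosmash_lift[OF _ _ _ _ 1 2, folded cosmash_mor_def]
  show "cosmash_mor C f g \<in> Ar C" "Dom C (cosmash_mor C f g) = cosmash C (Dom C f) (Dom C g)"
    "Cod C (cosmash_mor C f g) = cosmash C (Cod C f) (Cod C g)"
    "Cod C f = X \<Longrightarrow> Cod C g = Y \<Longrightarrow> cosmash_incl C X Y \<cdot> cosmash_mor C f g = ?u"
    using * assms by auto
qed

lemma cosmash_mor_reduce [simp]:
  assumes "f \<in> Ar C" "g \<in> Ar C" "Cod C f = X" "Cod C g = Y" "t \<in> Ar C" "Cod C t = cosmash C (Dom C f) (Dom C g)"
  shows "cosmash_incl C X Y \<cdot> cosmash_mor C f g \<cdot> t = (f \<oplus> g) \<cdot> cosmash_incl C (Dom C f) (Dom C g) \<cdot> t"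
proof -
  have "cosmash_incl C X Y \<cdot> cosmash_mor C f g \<cdot> t = ((f \<oplus> g) \<cdot> cosmash_incl C (Dom C f) (Dom C g)) \<cdot> t"
    by (rule reduce[OF cosmash_mor_simps(4)]) (use assms in auto)
  then show ?thesis unfolding assms(3,4)[symmetric] using assms(1,2,5,6) by simp
qed

lemma cosmash3_kernel:
  assumes "X \<in> Ob C" "Y \<in> Ob C" "Z \<in> Ob C"
  shows "is_kernel C
    \<langle>\<langle>\<one> (X \<uplus> Y) \<triangledown> \<zero> Z (X \<uplus> Y), in1 X Z \<triangledown> \<zero> Y (X \<uplus> Z) \<triangledown> in2 X Z\<rangle>, \<zero> X (Y \<uplus> Z) \<triangledown> in1 Y Z \<triangledown> in2 Y Z\<rangle>
    (cosmash3_incl C X Y Z)"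
  unfolding cosmash3_incl_def by (rule is_kernel_kernel) (use assms in simp)

lemma cosmash3_incl_simps [simp]:
  assumes "X \<in> Ob C" "Y \<in> Ob C" "Z \<in> Ob C"
  shows "cosmash3_incl C X Y Z \<in> Ar C" "Dom C (cosmash3_incl C X Y Z) = cosmash3 C X Y Z"
    "Cod C (cosmash3_incl C X Y Z) = X \<uplus> Y \<uplus> Z" "cosmash3 C X Y Z \<in> Ob C"
  using kernelD[OF cosmash3_kernel[OF assms]] assms by (auto simp: cosmash3_def)

lemma cosmash3_lift:
  assumes XYZ [simp]: "X \<in> Ob C" "Y \<in> Ob C" "Z \<in> Ob C" and u [simp]: "u \<in> Ar C" "Cod C u = X \<uplus> Y \<uplus> Z"
    and z [simp]: "(\<one> (X \<uplus> Y) \<triangledown> \<zero> Z (X \<uplus> Y)) \<cdot> u = \<zero> (Dom C u) (X \<uplus> Y)"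
    "(in1 X Z \<triangledown> \<zero> Y (X \<uplus> Z) \<triangledown> in2 X Z) \<cdot> u = \<zero> (Dom C u) (X \<uplus> Z)"
    "(\<zero> X (Y \<uplus> Z) \<triangledown> in1 Y Z \<triangledown> in2 Y Z) \<cdot> u = \<zero> (Dom C u) (Y \<uplus> Z)"
  obtains h where "h \<in> Ar C" "Dom C h = Dom C u" "Cod C h = cosmash3 C X Y Z" "cosmash3_incl C X Y Z \<cdot> h = u"
  by (rule kernel_lift[OF cosmash3_kernel[OF XYZ], of u]) auto

lemma cosmash3_incl_zero_aux:
  assumes XYZ [simp]: "X \<in> Ob C" "Y \<in> Ob C" "Z \<in> Ob C"
  shows "(\<one> (X \<uplus> Y) \<triangledown> \<zero> Z (X \<uplus> Y)) \<cdot> cosmash3_incl C X Y Z = \<zero> (cosmash3 C X Y Z) (X \<uplus> Y)"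
    "(in1 X Z \<triangledown> \<zero> Y (X \<uplus> Z) \<triangledown> in2 X Z) \<cdot> cosmash3_incl C X Y Z = \<zero> (cosmash3 C X Y Z) (X \<uplus> Z)"
    "(\<zero> X (Y \<uplus> Z) \<triangledown> in1 Y Z \<triangledown> in2 Y Z) \<cdot> cosmash3_incl C X Y Z = \<zero> (cosmash3 C X Y Z) (Y \<uplus> Z)"
proof -
  let ?k = "cosmash3_incl C X Y Z" and ?D = "cosmash3 C X Y Z"
  let ?a = "\<one> (X \<uplus> Y) \<triangledown> \<zero> Z (X \<uplus> Y)" and ?b = "in1 X Z \<triangledown> \<zero> Y (X \<uplus> Z) \<triangledown> in2 X Z"
    and ?c = "\<zero> X (Y \<uplus> Z) \<triangledown> in1 Y Z \<triangledown> in2 Y Z"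
  have eq: "\<langle>\<langle>?a, ?b\<rangle>, ?c\<rangle> \<cdot> ?k = \<zero> ?D ((X \<uplus> Y) \<otimes> (X \<uplus> Z) \<otimes> (Y \<uplus> Z))"
    using kernelD[OF cosmash3_kernel[OF XYZ]] by simp
  have "pr2 ((X \<uplus> Y) \<otimes> (X \<uplus> Z)) (Y \<uplus> Z) \<cdot> \<langle>\<langle>?a, ?b\<rangle>, ?c\<rangle> \<cdot> ?k = \<zero> ?D (Y \<uplus> Z)"
    by (subst eq) simp
  then show "?c \<cdot> ?k = \<zero> ?D (Y \<uplus> Z)" by simp
  have 1: "pr1 ((X \<uplus> Y) \<otimes> (X \<uplus> Z)) (Y \<uplus> Z) \<cdot> \<langle>\<langle>?a, ?b\<rangle>, ?c\<rangle> \<cdot> ?k = \<zero> ?D ((X \<uplus> Y) \<otimes> (X \<uplus> Z))"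
    by (subst eq) simp
  then have 2: "\<langle>?a, ?b\<rangle> \<cdot> ?k = \<zero> ?D ((X \<uplus> Y) \<otimes> (X \<uplus> Z))" by simp
  have "pr1 (X \<uplus> Y) (X \<uplus> Z) \<cdot> \<langle>?a, ?b\<rangle> \<cdot> ?k = \<zero> ?D (X \<uplus> Y)" by (subst 2) simp
  then show "?a \<cdot> ?k = \<zero> ?D (X \<uplus> Y)" by simp
  have "pr2 (X \<uplus> Y) (X \<uplus> Z) \<cdot> \<langle>?a, ?b\<rangle> \<cdot> ?k = \<zero> ?D (X \<uplus> Z)" by (subst 2) simp
  then show "?b \<cdot> ?k = \<zero> ?D (X \<uplus> Z)" by simp
qed

lemma coproduct3_ext:
  assumes "h \<in> Ar C" "k \<in> Ar C" "Dom C h = X \<uplus> Y \<uplus> Z" "Dom C k = X \<uplus> Y \<uplus> Z"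
    and "X \<in> Ob C" "Y \<in> Ob C" "Z \<in> Ob C"
    and "h \<cdot> in1 (X \<uplus> Y) Z \<cdot> in1 X Y = k \<cdot> in1 (X \<uplus> Y) Z \<cdot> in1 X Y"
    "h \<cdot> in1 (X \<uplus> Y) Z \<cdot> in2 X Y = k \<cdot> in1 (X \<uplus> Y) Z \<cdot> in2 X Y"
    "h \<cdot> in2 (X \<uplus> Y) Z = k \<cdot> in2 (X \<uplus> Y) Z"
  shows "h = k"
  by (rule coproduct_ext[of _ _ "X \<uplus> Y" Z], (use assms in simp)+, rule coproduct_ext[of _ _ X Y])
    (use assms in simp_all)

text \<open>A morphism that is zero on one of three summands factors through the coproduct of the
  other two, and each of these three projections kills the ternary cosmash product.\<close>

lemma cosmash3_incl_zero:
  assumes XYZ [simp]: "X \<in> Ob C" "Y \<in> Ob C" "Z \<in> Ob C" and h [simp]: "h \<in> Ar C" "Dom C h = X \<uplus> Y \<uplus> Z"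
    and z: "h \<cdot> in1 (X \<uplus> Y) Z \<cdot> in1 X Y = \<zero> X (Cod C h) \<or>
      h \<cdot> in1 (X \<uplus> Y) Z \<cdot> in2 X Y = \<zero> Y (Cod C h) \<or> h \<cdot> in2 (X \<uplus> Y) Z = \<zero> Z (Cod C h)"
  shows "h \<cdot> cosmash3_incl C X Y Z = \<zero> (cosmash3 C X Y Z) (Cod C h)"
proof -
  let ?k = "cosmash3_incl C X Y Z"
  note [simp] = cosmash3_incl_zero_aux
  have thr: ?thesis if "h = l \<cdot> m" "l \<in> Ar C" "m \<in> Ar C" "Dom C l = Cod C m" "Dom C m = X \<uplus> Y \<uplus> Z"
    "m \<cdot> ?k = \<zero> (cosmash3 C X Y Z) (Cod C m)" for l m
    using comp_zero_via[OF that(1-4), of ?k] that(5,6) by simp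
  from z show ?thesis
  proof (elim disjE)
    assume z: "h \<cdot> in1 (X \<uplus> Y) Z \<cdot> in1 X Y = \<zero> X (Cod C h)"
    show ?thesis
    proof (rule thr)
      show "h = ((h \<cdot> in1 (X \<uplus> Y) Z \<cdot> in2 X Y) \<triangledown> (h \<cdot> in2 (X \<uplus> Y) Z)) \<cdot> (\<zero> X (Y \<uplus> Z) \<triangledown> in1 Y Z \<triangledown> in2 Y Z)"
        by (rule coproduct3_ext[of _ _ X Y Z]) (use z in auto)
    qed auto
  next
    assume z: "h \<cdot> in1 (X \<uplus> Y) Z \<cdot> in2 X Y = \<zero> Y (Cod C h)"
    show ?thesis
    proof (rule thr)
      show "h = ((h \<cdot> in1 (X \<uplus> Y) Z \<cdot> in1 X Y) \<triangledown> (h \<cdot> in2 (X \<uplus> Y) Z)) \<cdot> (in1 X Z \<triangledown> \<zero> Y (X \<uplus> Z) \<triangledown> in2 X Z)"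
        by (rule coproduct3_ext[of _ _ X Y Z]) (use z in auto)
    qed auto
  next
    assume z: "h \<cdot> in2 (X \<uplus> Y) Z = \<zero> Z (Cod C h)"
    show ?thesis
    proof (rule thr)
      show "h = (h \<cdot> in1 (X \<uplus> Y) Z) \<cdot> (\<one> (X \<uplus> Y) \<triangledown> \<zero> Z (X \<uplus> Y))"
        by (rule coproduct_ext[of _ _ "X \<uplus> Y" Z]) (use z in auto)
    qed auto
  qed
qed

lemma S21_simps [simp]:
  assumes XY [simp]: "X \<in> Ob C" "Y \<in> Ob C"
  shows "S21 C X Y \<in> Ar C" "Dom C (S21 C X Y) = cosmash3 C X X Y" "Cod C (S21 C X Y) = cosmash C X Y"
    "cosmash_incl C X Y \<cdot> S21 C X Y = (in1 X Y \<triangledown> in1 X Y \<triangledown> in2 X Y) \<cdot> cosmash3_incl C X X Y"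
proof -
  let ?u = "(codiagonal C X \<oplus> \<one> Y) \<cdot> cosmash3_incl C X X Y"
  have u: "?u = (in1 X Y \<triangledown> in1 X Y \<triangledown> in2 X Y) \<cdot> cosmash3_incl C X X Y"
    by (simp add: codiagonal_def)
  have 1: "(\<one> X \<triangledown> \<zero> Y X) \<cdot> ?u = \<zero> (Dom C ?u) X" "(\<zero> X Y \<triangledown> \<one> Y) \<cdot> ?u = \<zero> (Dom C ?u) Y"
    unfolding u by (simp_all add: cosmash3_incl_zero)
  note * = cosmash_lift[OF XY _ _ 1, folded S21_def]
  show "S21 C X Y \<in> Ar C" "Dom C (S21 C X Y) = cosmash3 C X X Y" "Cod C (S21 C X Y) = cosmash C X Y"
    "cosmash_incl C X Y \<cdot> S21 C X Y = (in1 X Y \<triangledown> in1 X Y \<triangledown> in2 X Y) \<cdot> cosmash3_incl C X X Y"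
    using * unfolding u by auto
qed

section \<open>The monad of internal actions\<close>

lemma T_kernel:
  assumes "X \<in> Ob C" "A \<in> Ob C"
  shows "is_kernel C (\<zero> A X \<triangledown> \<one> X) (T_incl C X A)"
  unfolding T_incl_def by (rule is_kernel_kernel) (use assms in simp)

lemma T_incl_monic: "X \<in> Ob C \<Longrightarrow> A \<in> Ob C \<Longrightarrow> monic C (T_incl C X A)"
  by (rule kernel_monic[OF T_kernel])

lemma T_incl_simps [simp]:
  assumes "X \<in> Ob C" "A \<in> Ob C"
  shows "T_incl C X A \<in> Ar C" "Dom C (T_incl C X A) = T_obj C X A" "Cod C (T_incl C X A) = A \<uplus> X"
    "T_obj C X A \<in> Ob C" "(\<zero> A X \<triangledown> \<one> X) \<cdot> T_incl C X A = \<zero> (T_obj C X A) X"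
  using kernelD[OF T_kernel[OF assms]] assms by (auto simp: T_obj_def)

lemma T_incl_zero:
  assumes [simp]: "X \<in> Ob C" "A \<in> Ob C" "f \<in> Ar C" "Dom C f = X"
  shows "(\<zero> A (Cod C f) \<triangledown> f) \<cdot> T_incl C X A = \<zero> (T_obj C X A) (Cod C f)"
proof -
  have "(\<zero> A (Cod C f) \<triangledown> f) \<cdot> T_incl C X A = f \<cdot> (\<zero> A X \<triangledown> \<one> X) \<cdot> T_incl C X A"
    by (simp del: T_incl_simps(5))
  also have "\<dots> = \<zero> (T_obj C X A) (Cod C f)" by (simp del: comp_copairing_reduce)
  finally show ?thesis .
qed

lemma T_lift:
  assumes XA: "X \<in> Ob C" "A \<in> Ob C" and u: "u \<in> Ar C" "Cod C u = A \<uplus> X" "(\<zero> A X \<triangledown> \<one> X) \<cdot> u = \<zero> (Dom C u) X"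
  shows "factor C (T_incl C X A) u \<in> Ar C" "Dom C (factor C (T_incl C X A) u) = Dom C u"
    "Cod C (factor C (T_incl C X A) u) = T_obj C X A" "T_incl C X A \<cdot> factor C (T_incl C X A) u = u"
  using factor_kernel[OF T_kernel[OF XA], of u] XA u by simp_all

lemma T_mor_simps [simp]:
  assumes f: "f \<in> Ar C" and X: "X \<in> Ob C"
  shows "T_mor C X f \<in> Ar C" "Dom C (T_mor C X f) = T_obj C X (Dom C f)" "Cod C (T_mor C X f) = T_obj C X (Cod C f)"
    "Cod C f = B \<Longrightarrow> T_incl C X B \<cdot> T_mor C X f = (f \<oplus> \<one> X) \<cdot> T_incl C X (Dom C f)"
proof -
  have [simp]: "(\<zero> (Cod C f) X \<triangledown> \<one> X) \<cdot> (f \<oplus> \<one> X) \<cdot> T_incl C X (Dom C f) = \<zero> (T_obj C X (Dom C f)) X"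
    using assms by simp
  note * = T_lift[of X "Cod C f" "(f \<oplus> \<one> X) \<cdot> T_incl C X (Dom C f)", folded T_mor_def]
  show "T_mor C X f \<in> Ar C" "Dom C (T_mor C X f) = T_obj C X (Dom C f)" "Cod C (T_mor C X f) = T_obj C X (Cod C f)"
    "Cod C f = B \<Longrightarrow> T_incl C X B \<cdot> T_mor C X f = (f \<oplus> \<one> X) \<cdot> T_incl C X (Dom C f)"
    using * assms by auto
qed

lemma T_unit_simps [simp]:
  assumes [simp]: "A \<in> Ob C" "X \<in> Ob C"
  shows "T_unit C X A \<in> Ar C" "Dom C (T_unit C X A) = A" "Cod C (T_unit C X A) = T_obj C X A"
    "T_incl C X A \<cdot> T_unit C X A = in1 A X"
  using T_lift[of X A "in1 A X", folded T_unit_def] by auto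

lemma T_mult_simps [simp]:
  assumes [simp]: "A \<in> Ob C" "X \<in> Ob C"
  shows "T_mult C X A \<in> Ar C" "Dom C (T_mult C X A) = T_obj C X (T_obj C X A)" "Cod C (T_mult C X A) = T_obj C X A"
    "T_incl C X A \<cdot> T_mult C X A = (T_incl C X A \<triangledown> in2 A X) \<cdot> T_incl C X (T_obj C X A)"
  using T_lift[of X A "(T_incl C X A \<triangledown> in2 A X) \<cdot> T_incl C X (T_obj C X A)", folded T_mult_def] by auto

definition cosmash_in_T :: "'o \<Rightarrow> 'o \<Rightarrow> 'm"
  where "cosmash_in_T X A = factor C (T_incl C X A) (cosmash_incl C A X)"

lemma cosmash_in_T_simps [simp]:
  assumes [simp]: "A \<in> Ob C" "X \<in> Ob C"
  shows "cosmash_in_T X A \<in> Ar C" "Dom C (cosmash_in_T X A) = cosmash C A X" "Cod C (cosmash_in_T X A) = T_obj C X A"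
    "T_incl C X A \<cdot> cosmash_in_T X A = cosmash_incl C A X"
  using T_lift[of X A "cosmash_incl C A X", folded cosmash_in_T_def] by (auto simp: cosmash_incl_zero)

lemmas T_reduce [simp] = reduce[OF T_mor_simps(4)] reduce[OF T_unit_simps(4)] reduce[OF T_mult_simps(4)]
  reduce[OF cosmash_in_T_simps(4)]

text \<open>With \<open>T_unit\<close> as a section, this presents the cosmash product as the kernel
  of a split epimorphism, so that \<open>kernel_map_regular_epi\<close> applies to it.\<close>

lemma cosmash_in_T_kernel:
  assumes [simp]: "A \<in> Ob C" "X \<in> Ob C"
  shows "is_kernel C ((\<one> A \<triangledown> \<zero> X A) \<cdot> T_incl C X A) (cosmash_in_T X A)"
proof (rule kernelI)
  show "monic C (cosmash_in_T X A)"
    using monic_cancel[of "T_incl C X A" "cosmash_in_T X A"] cosmash_incl_monic by simp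
  fix u assume u: "u \<in> Ar C" "Cod C u = Dom C ((\<one> A \<triangledown> \<zero> X A) \<cdot> T_incl C X A)"
    "((\<one> A \<triangledown> \<zero> X A) \<cdot> T_incl C X A) \<cdot> u = \<zero> (Dom C u) (Cod C ((\<one> A \<triangledown> \<zero> X A) \<cdot> T_incl C X A))"
  have z: "(\<one> A \<triangledown> \<zero> X A) \<cdot> T_incl C X A \<cdot> u = \<zero> (Dom C u) A" using u by simp
  note [simp] = u(1,2)
  let ?h = "factor C (cosmash_incl C A X) (T_incl C X A \<cdot> u)"
  have h: "?h \<in> Ar C" "Dom C ?h = Dom C u" "Cod C ?h = cosmash C A X" "cosmash_incl C A X \<cdot> ?h = T_incl C X A \<cdot> u"
    using cosmash_lift[of A X "T_incl C X A \<cdot> u"] z reduce[OF T_incl_simps(5), of X A u] by auto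
  have "cosmash_in_T X A \<cdot> ?h = u"
    by (rule monicD[OF T_incl_monic[of X A]]) (use h in auto)
  with h show "\<exists>h. h \<in> Ar C \<and> Dom C h = Dom C u \<and> Cod C h = Dom C (cosmash_in_T X A) \<and> cosmash_in_T X A \<cdot> h = u"
    by (intro exI[of _ ?h]) simp
qed (auto simp: cosmash_incl_zero)

text \<open>Whereas \<open>T_mor\<close> varies only the object acted on, here the acting object
  varies too, as in the comparison from \<open>T_X(A)\<close> to \<open>T_G(A)\<close> along
  \<open>p\<close>.\<close>

definition T_map :: "'m \<Rightarrow> 'm \<Rightarrow> 'm"
  where "T_map g f = factor C (T_incl C (Cod C g) (Cod C f)) ((f \<oplus> g) \<cdot> T_incl C (Dom C g) (Dom C f))"

lemma T_map_simps [simp]: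
  assumes f: "f \<in> Ar C" and g: "g \<in> Ar C"
  shows "T_map g f \<in> Ar C" "Dom C (T_map g f) = T_obj C (Dom C g) (Dom C f)"
    "Cod C (T_map g f) = T_obj C (Cod C g) (Cod C f)"
    "Cod C g = Y \<Longrightarrow> Cod C f = B \<Longrightarrow> T_incl C Y B \<cdot> T_map g f = (f \<oplus> g) \<cdot> T_incl C (Dom C g) (Dom C f)"
proof -
  have [simp]: "(\<zero> (Dom C f) (Cod C g) \<triangledown> g) \<cdot> T_incl C (Dom C g) (Dom C f) =
      \<zero> (T_obj C (Dom C g) (Dom C f)) (Cod C g)"
    using assms T_incl_zero[of "Dom C g" "Dom C f" g] by simp
  note * = T_lift[of "Cod C g" "Cod C f" "(f \<oplus> g) \<cdot> T_incl C (Dom C g) (Dom C f)", folded T_map_def]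
  show "T_map g f \<in> Ar C" "Dom C (T_map g f) = T_obj C (Dom C g) (Dom C f)"
    "Cod C (T_map g f) = T_obj C (Cod C g) (Cod C f)"
    "Cod C g = Y \<Longrightarrow> Cod C f = B \<Longrightarrow> T_incl C Y B \<cdot> T_map g f = (f \<oplus> g) \<cdot> T_incl C (Dom C g) (Dom C f)"
    using * assms by auto
qed

lemmas T_map_reduce [simp] = reduce[OF T_map_simps(4)]

text \<open>Each of the two objects is the kernel of a split epimorphism on a coproduct, and a
  coproduct of regular epimorphisms is a regular epimorphism.\<close>

lemma T_map_regular_epi:
  assumes f: "regular_epi C f" and g: "regular_epi C g"
  shows "regular_epi C (T_map g f)"
proof -
  define A X B Y where defs: "A = Dom C f" "X = Dom C g" "B = Cod C f" "Y = Cod C g"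
  note fg [simp] = regular_epi_Ar[OF f] regular_epi_Ar[OF g]
  have [simp]: "Dom C f = A" "Dom C g = X" "Cod C f = B" "Cod C g = Y" "A \<in> Ob C" "X \<in> Ob C" "B \<in> Ob C" "Y \<in> Ob C"
    unfolding defs by auto
  show ?thesis
    by (rule kernel_map_regular_epi[of "\<zero> A X \<triangledown> \<one> X" "in2 A X" "\<zero> B Y \<triangledown> \<one> Y" "in2 B Y" "f \<oplus> g" g
      "T_incl C X A" "T_incl C Y B"]) (auto simp: T_kernel g intro!: regular_epi_coprod_mor f g simp del: coprod_mor_eq, auto)
qed

text \<open>The argument for \<open>T_map\<close> is repeated one level up, for the split
  epimorphisms from \<open>T_X(A)\<close> to \<open>A\<close>. It makes the action of the quotient
  unique.\<close>

lemma cosmash_mor_regular_epi: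
  assumes A [simp]: "A \<in> Ob C" and g: "regular_epi C g"
  shows "regular_epi C (cosmash_mor C (\<one> A) g)"
proof -
  define X Y where defs: "X = Dom C g" "Y = Cod C g"
  note [simp] = regular_epi_Ar[OF g]
  have [simp]: "Dom C g = X" "Cod C g = Y" "X \<in> Ob C" "Y \<in> Ob C"
    unfolding defs by auto
  have one: "regular_epi C (\<one> A)"
    by (rule regular_epiI) auto
  show ?thesis
  proof (rule kernel_map_regular_epi[of "(\<one> A \<triangledown> \<zero> X A) \<cdot> T_incl C X A" "T_unit C X A" "(\<one> A \<triangledown> \<zero> Y A) \<cdot> T_incl C Y A" "T_unit C Y A"
      "T_map g (\<one> A)" "\<one> A" "cosmash_in_T X A" "cosmash_in_T Y A"])
    show "regular_epi C (T_map g (\<one> A))" by (rule T_map_regular_epi[OF one g])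
    show "regular_epi C (\<one> A)" by (rule one)
    show "is_kernel C ((\<one> A \<triangledown> \<zero> X A) \<cdot> T_incl C X A) (cosmash_in_T X A)"
      "is_kernel C ((\<one> A \<triangledown> \<zero> Y A) \<cdot> T_incl C Y A) (cosmash_in_T Y A)" by (auto intro: cosmash_in_T_kernel)
    show "T_map g (\<one> A) \<cdot> T_unit C X A = T_unit C Y A \<cdot> \<one> A"
      by (rule monicD[OF T_incl_monic[of Y A]]) auto
    show "cosmash_in_T Y A \<cdot> cosmash_mor C (\<one> A) g = T_map g (\<one> A) \<cdot> cosmash_in_T X A"
      by (rule monicD[OF T_incl_monic[of Y A]]) auto
  qed auto
qed

end

section \<open>Extensions\<close>

context semi_abelian_category
begin

text \<open>The projection \<open>q1\<close> is split by \<open>s1\<close>, and its change of base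
  along the section \<open>s\<close> is \<open>g\<close>, embedded by \<open>s2\<close>. The lemma
  serves both the triples and the product over \<open>X\<close> of two copies of
  \<open>A + X\<close>.\<close>

lemma split_pullback_strong:
  assumes pb: "is_pullback C f g q1 q2"
    and s: "s \<in> Ar C" "Cod C s = Dom C f" "f \<cdot> s = \<one> (Cod C f)"
    and t: "t \<in> Ar C" "Cod C t = Dom C g" "g \<cdot> t = \<one> (Cod C f)"
  obtains s1 s2 where "s1 \<in> Ar C" "Dom C s1 = Dom C f" "Cod C s1 = Dom C q1" "q1 \<cdot> s1 = \<one> (Dom C f)" "q2 \<cdot> s1 = t \<cdot> f"
    "s2 \<in> Ar C" "Dom C s2 = Dom C g" "Cod C s2 = Dom C q1" "q1 \<cdot> s2 = s \<cdot> g" "q2 \<cdot> s2 = \<one> (Dom C g)"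
    "jointly_strong s2 s1"
proof -
  define B where "B = Cod C f"
  have [simp]: "Cod C f = B" "Cod C g = B" "B \<in> Ob C"
    using pullbackD[OF pb] by (auto simp: B_def)
  note [simp] = pullbackD(1-4,6-9)[OF pb] s(1,2) t(1,2) reduce[OF pullbackD(9)[OF pb]]
  have st [simp]: "f \<cdot> s = \<one> B" "g \<cdot> t = \<one> B" using s(3) t(3) by simp_all
  note [simp] = reduce[OF st(1)] reduce[OF st(2)]
  have [simp]: "Dom C s = B" "Dom C t = B" using dom_eq[OF st(1)] dom_eq[OF st(2)] by auto
  obtain s1 where s1 [simp]: "s1 \<in> Ar C" "Dom C s1 = Dom C f" "Cod C s1 = Dom C q1" "q1 \<cdot> s1 = \<one> (Dom C f)" "q2 \<cdot> s1 = t \<cdot> f"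
    by (rule pullback_lift[OF pb, of "\<one> (Dom C f)" "t \<cdot> f"]) auto
  obtain s2 where s2 [simp]: "s2 \<in> Ar C" "Dom C s2 = Dom C g" "Cod C s2 = Dom C q1" "q1 \<cdot> s2 = s \<cdot> g" "q2 \<cdot> s2 = \<one> (Dom C g)"
    by (rule pullback_lift[OF pb, of "s \<cdot> g" "\<one> (Dom C g)"]) auto
  note [simp] = reduce[OF s2(4)] reduce[OF s2(5)]
  have "is_pullback C s q1 g s2"
  proof (rule pullbackI)
    fix x y assume x: "x \<in> Ar C" "y \<in> Ar C" "Cod C x = Dom C s" "Cod C y = Dom C q1" "Dom C y = Dom C x" "s \<cdot> x = q1 \<cdot> y"
    have "g \<cdot> q2 \<cdot> y = f \<cdot> q1 \<cdot> y" using x(1-5) by simp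
    also have "\<dots> = f \<cdot> s \<cdot> x" by (simp only: x(6))
    also have "\<dots> = x" using x(1-5) by simp
    finally have 1: "g \<cdot> q2 \<cdot> y = x" .
    have "s2 \<cdot> q2 \<cdot> y = y" by (rule pullback_ext[OF pb]) (use x 1 in auto)
    with 1 x show "\<exists>h. h \<in> Ar C \<and> Dom C h = Dom C x \<and> Cod C h = Dom C g \<and> g \<cdot> h = x \<and> s2 \<cdot> h = y"
      by (intro exI[of _ "q2 \<cdot> y"]) simp
  next
    fix h k assume h: "h \<in> Ar C" "k \<in> Ar C" "Cod C h = Dom C g" "Cod C k = Dom C g" "s2 \<cdot> h = s2 \<cdot> k"
    have "q2 \<cdot> s2 \<cdot> h = q2 \<cdot> s2 \<cdot> k" by (simp only: h(5))
    then show "h = k" using h(1-4) by simp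
  qed auto
  then have "jointly_strong s2 s1" by (intro point_pullback_strong) auto
  then show thesis using that[of s1 s2] by simp
qed

lemma jointly_strong_regular_epi:
  assumes js: "jointly_strong f g" and c: "c \<in> Ar C" "Cod C c = Cod C f"
    and f': "f' \<in> Ar C" "Cod C f' = Dom C c" "f = c \<cdot> f'"
    and g': "g' \<in> Ar C" "Cod C g' = Dom C c" "g = c \<cdot> g'"
  shows "regular_epi C c"
proof (rule regular_epiI)
  fix m u assume m: "monic C m" "m \<in> Ar C" and u: "u \<in> Ar C" "Cod C u = Dom C m" "Dom C u = Dom C c"
    "Cod C m = Cod C c" "m \<cdot> u = c"
  have "m \<cdot> u \<cdot> f' = c \<cdot> f'" "m \<cdot> u \<cdot> g' = c \<cdot> g'"
    using reduce[OF u(5), of f'] reduce[OF u(5), of g'] u m f' g' by simp_all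
  then obtain t where "t \<in> Ar C" "Cod C t = Dom C m" "m \<cdot> t = \<one> (Cod C c)"
    using jointly_strong_factor[OF js m(1), of "\<one> (Cod C c)" "u \<cdot> f'" "u \<cdot> g'"] jointly_strongD[OF js]
      c f'(1,2) g'(1,2) m u(1-4) by (simp add: f'(3)[symmetric] g'(3)[symmetric]) metis
  then show "\<exists>t. t \<in> Ar C \<and> Cod C t = Dom C m \<and> m \<cdot> t = \<one> (Cod C c)" by auto
qed (rule c)

lemma is_image_image_mor: "f \<in> Ar C \<Longrightarrow> is_image C f (image_mor C f)"
  unfolding image_mor_def
proof (rule someI_ex)
  assume "f \<in> Ar C"
  then obtain e m where *: "regular_epi C e" "monic C m" "e \<in> Ar C" "m \<in> Ar C" "Dom C e = Dom C f"
    "Cod C e = Dom C m" "Cod C m = Cod C f" "m \<cdot> e = f" by (rule image_factorization)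
  then have "e \<in> Hom C (Dom C f) (Dom C m)" by simp
  with * show "\<exists>i. is_image C f i" unfolding is_image_def by blast
qed

text \<open>If the morphism is zero, cancelling its epic part makes the image inclusion zero, and
  cancelling that monomorphism makes the identity of the image zero.\<close>

lemma zero_subobject_image_iff:
  assumes [simp]: "f \<in> Ar C"
  shows "zero_subobject C (image_mor C f) \<longleftrightarrow> f = \<zero> (Dom C f) (Cod C f)"
proof -
  define m where "m = image_mor C f"
  obtain e where m: "monic C m" "Cod C m = Cod C f" and e: "regular_epi C e" "e \<in> Ar C" "Dom C e = Dom C f"
    "Cod C e = Dom C m" "m \<cdot> e = f"
    using is_image_image_mor[of f] unfolding is_image_def m_def by auto
  note [simp] = m(2) monic_Ar[OF m(1)] e(2-4)
  have "f = \<zero> (Dom C f) (Cod C f)" if "is_zero C (Dom C m)"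
    using to_zero_object[OF that, of e] e(5) comp_zero[of m "Dom C m" "Dom C f"] by simp
  moreover have "is_zero C (Dom C m)" if f: "f = \<zero> (Dom C f) (Cod C f)"
  proof (rule is_zero_if_one_eq_zero)
    have "m \<cdot> e = \<zero> (Dom C m) (Cod C f) \<cdot> e" using e(5) f by simp
    then have "m = \<zero> (Dom C m) (Cod C f)" by (intro epicD[OF regular_epi_epic[OF e(1)], of m]) auto
    then have "m \<cdot> \<one> (Dom C m) = m \<cdot> \<zero> (Dom C m) (Dom C m)" by simp
    then show "\<one> (Dom C m) = \<zero> (Dom C m) (Dom C m)" by (rule monicD[OF m(1), rotated -1]) auto
  qed simp
  ultimately show ?thesis using m(1) unfolding zero_subobject_def m_def by blast
qed

text \<open>By the unit law and commutativity, the addition is the identity on both axes. So the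
  codiagonal factors through the canonical morphism from \<open>A + A\<close> to the product and
  kills its kernel.\<close>

lemma abelian_cosmash_zero:
  assumes "abelian_object C A"
  shows "(\<one> A \<triangledown> \<one> A) \<cdot> cosmash_incl C A A = \<zero> (cosmash C A A) A"
proof -
  have A [simp]: "A \<in> Ob C" using assms unfolding abelian_object_def by simp
  obtain m e n where *: "abelian_group_structure C A m e n" using assms unfolding abelian_object_def by blast
  have m [simp]: "m \<in> Ar C" "Dom C m = A \<otimes> A" "Cod C m = A" and
    unit: "m \<cdot> \<langle>\<one> A, e \<cdot> terminal_mor C A\<rangle> = \<one> A" and
    comm: "m \<cdot> \<langle>pr2 A A, pr1 A A\<rangle> = m" and e: "\<guillemotleft>e : terminal_obj C \<rightarrow> A\<guillemotright>"
    using * unfolding abelian_group_structure_def by (auto simp: Let_def)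
  have trm: "is_terminal C (terminal_obj C)"
    unfolding terminal_obj_def using ex_terminal by (rule someI_ex)
  note eD [simp] = homD[OF e]
  have "\<exists>!f. \<guillemotleft>f : A \<rightarrow> terminal_obj C\<guillemotright>" using trm A unfolding is_terminal_def by blast
  then have "\<guillemotleft>terminal_mor C A : A \<rightarrow> terminal_obj C\<guillemotright>"
    unfolding terminal_mor_def by (rule theI')
  note tD [simp] = homD[OF this]
  \<comment> \<open>The terminal object is a zero object, so the neutral element is a zero morphism
    and the unit law becomes an equation on an axis.\<close>
  have "\<one> (terminal_obj C) = \<zero> (terminal_obj C) (terminal_obj C)"
    by (rule terminal_unique[OF trm]) auto
  then have "e = e \<cdot> \<zero> (terminal_obj C) (terminal_obj C)" using comp_one[of e "terminal_obj C"] by (simp del: comp_one)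
  then have "e = \<zero> (terminal_obj C) A" by simp
  then have u1: "m \<cdot> \<langle>\<one> A, \<zero> A A\<rangle> = \<one> A" using unit by simp
  have "m \<cdot> \<langle>\<zero> A A, \<one> A\<rangle> = (m \<cdot> \<langle>pr2 A A, pr1 A A\<rangle>) \<cdot> \<langle>\<zero> A A, \<one> A\<rangle>" by (simp only: comm)
  then have u2: "m \<cdot> \<langle>\<zero> A A, \<one> A\<rangle> = \<one> A" using u1 by simp
  have "\<one> A \<triangledown> \<one> A = m \<cdot> \<langle>\<one> A \<triangledown> \<zero> A A, \<zero> A A \<triangledown> \<one> A\<rangle>"
    by (rule coproduct_ext[of _ _ A A]) (simp_all add: u1 u2)
  then have "(\<one> A \<triangledown> \<one> A) \<cdot> cosmash_incl C A A =
      \<zero> (Dom C (cosmash_incl C A A)) (Cod C (\<one> A \<triangledown> \<one> A))"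
    by (rule comp_zero_via) (use kernelD(4)[OF cosmash_kernel[OF A A]] in simp_all)
  then show ?thesis by simp
qed

end

section \<open>A fixed extension: conjugation core and ternary commutator\<close>

locale extension = semi_abelian_category C for C :: "('o, 'm) cat" +
  fixes A X G :: 'o and a p :: 'm
  assumes a: "\<guillemotleft>a : A \<rightarrow> X\<guillemotright>" and p: "\<guillemotleft>p : X \<rightarrow> G\<guillemotright>" and exact: "short_exact C a p"
begin

lemmas ap_simps [simp] = homD[OF a] homD[OF p]

lemma kernel_a: "is_kernel C p a" and cokernel_p: "is_cokernel C a p"
  using exact unfolding short_exact_def by auto

lemma pa [simp]: "p \<cdot> a = \<zero> A G"
  using kernelD[OF kernel_a] by simp

lemma monic_a: "monic C a"
  by (rule kernel_monic[OF kernel_a])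

lemma p_factor:
  assumes "g \<in> Ar C" "Dom C g = X" "g \<cdot> a = \<zero> A (Cod C g)"
  shows "\<exists>h. h \<in> Ar C \<and> Dom C h = G \<and> Cod C h = Cod C g \<and> h \<cdot> p = g"
proof -
  have "\<exists>!h. \<guillemotleft>h : G \<rightarrow> Cod C g\<guillemotright> \<and> h \<cdot> p = g"
    using cokernel_p assms unfolding is_cokernel_def by simp
  then obtain h where "\<guillemotleft>h : G \<rightarrow> Cod C g\<guillemotright>" "h \<cdot> p = g" by blast
  then show ?thesis by auto
qed

lemma regular_epi_p: "regular_epi C p"
proof -
  have "is_coequalizer C a (\<zero> A X) p"
    using cokernel_p unfolding is_coequalizer_def is_cokernel_def
  proof (elim conjE, intro conjI allI ballI impI)
    fix T f assume f: "\<guillemotleft>f : Cod C a \<rightarrow> T\<guillemotright>" "f \<cdot> a = f \<cdot> \<zero> A X"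
      and univ: "\<forall>T. \<forall>u\<in>Hom C (Cod C a) T. u \<cdot> a = \<zero> (Dom C a) T \<longrightarrow> (\<exists>!h. \<guillemotleft>h : Cod C p \<rightarrow> T\<guillemotright> \<and> h \<cdot> p = u)"
    have "f \<cdot> a = \<zero> (Dom C a) T" using f by auto
    then show "\<exists>!h. \<guillemotleft>h : Cod C p \<rightarrow> T\<guillemotright> \<and> h \<cdot> p = f" using univ f(1) by blast
  qed auto
  then show ?thesis unfolding regular_epi_def by blast
qed

abbreviation core :: 'm where "core \<equiv> conj_core C a"

text \<open>Composition with the monomorphism \<open>a\<close> makes the core explicit. The
  factorisation exists because \<open>p\<close> turns \<open>a \<triangledown> \<one> X\<close> into
  a morphism that is zero on \<open>A\<close>.\<close>

lemma core_simps [simp]: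
  shows "core \<in> Ar C" "Dom C core = cosmash C A X" "Cod C core = A"
    "a \<cdot> core = (a \<triangledown> \<one> X) \<cdot> cosmash_incl C A X"
proof -
  let ?u = "(codiagonal C X \<cdot> cosmash_incl C X X) \<cdot> cosmash_mor C a (\<one> X)"
  have u: "?u = (a \<triangledown> \<one> X) \<cdot> cosmash_incl C A X" by (simp add: codiagonal_def)
  have "p \<cdot> ?u = \<zero> (cosmash C A X) G" unfolding u by (simp add: cosmash_incl_zero)
  then show "core \<in> Ar C" "Dom C core = cosmash C A X" "Cod C core = A"
    "a \<cdot> core = (a \<triangledown> \<one> X) \<cdot> cosmash_incl C A X"
    using factor_kernel[OF kernel_a, of ?u] unfolding conj_core_def Let_def ap_simps u by auto
qed

lemmas core_reduce [simp] = reduce[OF core_simps(4)]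

lemma core21_simps [simp]:
  shows "conj_core21 C a \<in> Ar C" "Dom C (conj_core21 C a) = cosmash3 C A A X" "Cod C (conj_core21 C a) = A"
    "a \<cdot> conj_core21 C a = (a \<triangledown> a \<triangledown> \<one> X) \<cdot> cosmash3_incl C A A X"
  by (auto simp: conj_core21_def)

lemma core21_zero_iff:
  "conj_core21 C a = \<zero> (cosmash3 C A A X) A \<longleftrightarrow>
    (a \<triangledown> a \<triangledown> \<one> X) \<cdot> cosmash3_incl C A A X = \<zero> (cosmash3 C A A X) X"
proof
  assume *: "(a \<triangledown> a \<triangledown> \<one> X) \<cdot> cosmash3_incl C A A X = \<zero> (cosmash3 C A A X) X"
  show "conj_core21 C a = \<zero> (cosmash3 C A A X) A"
    by (rule monicD[OF monic_a]) (use * in auto)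
next
  assume "conj_core21 C a = \<zero> (cosmash3 C A A X) A"
  then have "a \<cdot> conj_core21 C a = a \<cdot> \<zero> (cosmash3 C A A X) A" by simp
  then show "(a \<triangledown> a \<triangledown> \<one> X) \<cdot> cosmash3_incl C A A X = \<zero> (cosmash3 C A A X) X" by simp
qed

text \<open>The commutator is the image of \<open>a \<cdot> conj_core21 C a\<close>, and
  \<open>a\<close> is monic; so (iii) and (iv) express the same vanishing.\<close>

lemma commutator3_zero_iff:
  "zero_subobject C (commutator3 C a a (\<one> X)) \<longleftrightarrow> conj_core21 C a = \<zero> (cosmash3 C A A X) A"
  unfolding commutator3_def core21_zero_iff by (subst zero_subobject_image_iff) auto

text \<open>Evaluating \<open>c\<close> on words \<open>a \<diamond> a' \<diamond> x\<close> in which \<open>a'\<close> is regarded as an element of \<open>X\<close> gives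
  \<open>c\<^sub>2\<^sub>,\<^sub>1\<close>; but \<open>1 \<diamond> p\<close> annihilates such words.\<close>

lemma core21_zero_if_factors:
  assumes psi: "\<guillemotleft>\<psi> : cosmash C A G \<rightarrow> A\<guillemotright>" and eq: "core = \<psi> \<cdot> cosmash_mor C (\<one> A) p"
  shows "conj_core21 C a = \<zero> (cosmash3 C A A X) A"
proof -
  note [simp] = homD[OF psi]
  let ?k = "cosmash3_incl C A A X"
  \<comment> \<open>The middle letter is moved to \<open>X\<close> along \<open>a\<close>. Killing
    \<open>A\<close> then kills the last two letters, killing \<open>X\<close>-free words kills the
    first; either way the ternary word vanishes, so \<open>?u\<close> lands in the binary cosmash
    product.\<close>
  let ?u = "(in1 A X \<triangledown> in2 A X \<cdot> a \<triangledown> in2 A X) \<cdot> ?k"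
  have z: "(\<one> A \<triangledown> \<zero> X A) \<cdot> ?u = \<zero> (Dom C ?u) A" "(\<zero> A X \<triangledown> \<one> X) \<cdot> ?u = \<zero> (Dom C ?u) X"
    by (simp_all add: cosmash3_incl_zero)
  define s where "s = factor C (cosmash_incl C A X) ?u"
  have s [simp]: "s \<in> Ar C" "Dom C s = cosmash3 C A A X" "Cod C s = cosmash C A X" "cosmash_incl C A X \<cdot> s = ?u"
    using cosmash_lift[OF _ _ _ _ z] unfolding s_def by auto
  have z: "cosmash_mor C (\<one> A) p \<cdot> s = \<zero> (cosmash3 C A A X) (cosmash C A G)"
    by (rule monicD[OF cosmash_incl_monic[of A G]]) (auto simp: cosmash3_incl_zero)
  have "conj_core21 C a = core \<cdot> s"
    by (rule monicD[OF monic_a]) auto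
  also have "\<dots> = \<zero> (cosmash3 C A A X) A" by (simp add: eq z)
  finally show ?thesis .
qed

end

text \<open>The pullbacks are parameters, not chosen ones, because the colimit behind the
  Smith/Pedicchio commutator brings its own \<open>u\<close> and \<open>v\<close>.\<close>

locale extension_triples = extension C A X G a p
  for C :: "('o, 'm) cat" and A X G :: 'o and a p :: 'm +
  fixes r0 r1 u v :: 'm
  assumes pair: "is_pullback C p p r0 r1" and triple: "is_pullback C r1 r0 u v"
begin

text \<open>The domain of \<open>u\<close> is the object of triples \<open>(x, y, z)\<close> with \<open>p x = p y = p z\<close>; the coordinates
  are \<open>r\<^sub>0 u\<close>, \<open>r\<^sub>1 u = r\<^sub>0 v\<close> and \<open>r\<^sub>1 v\<close>.\<close>

lemma pair_simps [simp]:
  "r0 \<in> Ar C" "r1 \<in> Ar C" "Cod C r0 = X" "Cod C r1 = X" "Dom C r1 = Dom C r0" "p \<cdot> r0 = p \<cdot> r1"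
  "u \<in> Ar C" "v \<in> Ar C" "Cod C u = Dom C r0" "Cod C v = Dom C r0" "Dom C v = Dom C u" "r1 \<cdot> u = r0 \<cdot> v"
  using pullbackD[OF pair] pullbackD[OF triple] by auto

lemmas pair_reduce [simp] = reduce[OF pair_simps(6)] reduce[OF pair_simps(12)]

lemma triple_ext:
  assumes "s \<in> Ar C" "t \<in> Ar C" "Cod C s = Dom C u" "Cod C t = Dom C u"
    "r0 \<cdot> u \<cdot> s = r0 \<cdot> u \<cdot> t" "r0 \<cdot> v \<cdot> s = r0 \<cdot> v \<cdot> t" "r1 \<cdot> v \<cdot> s = r1 \<cdot> v \<cdot> t"
  shows "s = t"
proof (rule pullback_ext[OF triple])
  show "u \<cdot> s = u \<cdot> t" by (rule pullback_ext[OF pair]) (use assms in auto)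
  show "v \<cdot> s = v \<cdot> t" by (rule pullback_ext[OF pair]) (use assms in auto)
qed (use assms in auto)

lemma triple_lift:
  assumes "f \<in> Ar C" "g \<in> Ar C" "h \<in> Ar C" "Cod C f = X" "Cod C g = X" "Cod C h = X"
    "p \<cdot> f = p \<cdot> g" "p \<cdot> g = p \<cdot> h"
  obtains t where "t \<in> Ar C" "Dom C t = Dom C f" "Cod C t = Dom C u"
    "r0 \<cdot> u \<cdot> t = f" "r0 \<cdot> v \<cdot> t = g" "r1 \<cdot> v \<cdot> t = h"
proof -
  have D: "Dom C g = Dom C f" using assms(1,2,4,5) dom_eq[OF assms(7)] by auto
  obtain s where s: "s \<in> Ar C" "Dom C s = Dom C f" "Cod C s = Dom C r0" "r0 \<cdot> s = f" "r1 \<cdot> s = g"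
    using pullback_lift[OF pair, of f g] assms by auto
  obtain s' where s': "s' \<in> Ar C" "Dom C s' = Dom C f" "Cod C s' = Dom C r0" "r0 \<cdot> s' = g" "r1 \<cdot> s' = h"
    using pullback_lift[OF pair, of g h] assms D by auto
  obtain t where t: "t \<in> Ar C" "Dom C t = Dom C s" "Cod C t = Dom C u" "u \<cdot> t = s" "v \<cdot> t = s'"
    using pullback_lift[OF triple, of s s'] s s' by auto
  then show thesis using that[of t] s s' by simp
qed

text \<open>The two Mal'tsev identities are imposed on generalised elements \<open>t\<close> of the
  object of triples, so that they can be evaluated at any triple whose neighbouring coordinates
  agree.\<close>

definition connector :: "'m \<Rightarrow> bool"
  where "connector \<phi> \<longleftrightarrow> \<phi> \<in> Ar C \<and> Dom C \<phi> = Dom C u \<and> Cod C \<phi> = X \<and>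
    (\<forall>t. t \<in> Ar C \<longrightarrow> Cod C t = Dom C u \<longrightarrow> r0 \<cdot> u \<cdot> t = r0 \<cdot> v \<cdot> t \<longrightarrow> \<phi> \<cdot> t = r1 \<cdot> v \<cdot> t) \<and>
    (\<forall>t. t \<in> Ar C \<longrightarrow> Cod C t = Dom C u \<longrightarrow> r0 \<cdot> v \<cdot> t = r1 \<cdot> v \<cdot> t \<longrightarrow> \<phi> \<cdot> t = r0 \<cdot> u \<cdot> t)"

lemma connectorD:
  assumes "connector \<phi>"
  shows "\<phi> \<in> Ar C" "Dom C \<phi> = Dom C u" "Cod C \<phi> = X"
    "t \<in> Ar C \<Longrightarrow> Cod C t = Dom C u \<Longrightarrow> r0 \<cdot> u \<cdot> t = r0 \<cdot> v \<cdot> t \<Longrightarrow> \<phi> \<cdot> t = r1 \<cdot> v \<cdot> t"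
    "t \<in> Ar C \<Longrightarrow> Cod C t = Dom C u \<Longrightarrow> r0 \<cdot> v \<cdot> t = r1 \<cdot> v \<cdot> t \<Longrightarrow> \<phi> \<cdot> t = r0 \<cdot> u \<cdot> t"
  using assms unfolding connector_def by auto

text \<open>\<open>i\<close> sends \<open>(x, y)\<close> to \<open>(x, y, y)\<close>, and
  \<open>j\<close> sends \<open>(y, z)\<close> to \<open>(y, y, z)\<close>. They are the two
  sections of a pullback of split epimorphisms and therefore generate the triples.\<close>

lemma sections:
  obtains d i j where "d \<in> Ar C" "Dom C d = X" "Cod C d = Dom C r0" "r0 \<cdot> d = \<one> X" "r1 \<cdot> d = \<one> X"
    "i \<in> Ar C" "Dom C i = Dom C r0" "Cod C i = Dom C u" "u \<cdot> i = \<one> (Dom C r0)" "v \<cdot> i = d \<cdot> r1"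
    "j \<in> Ar C" "Dom C j = Dom C r0" "Cod C j = Dom C u" "u \<cdot> j = d \<cdot> r0" "v \<cdot> j = \<one> (Dom C r0)"
    "jointly_strong j i"
proof -
  obtain d where d: "d \<in> Ar C" "Dom C d = X" "Cod C d = Dom C r0" "r0 \<cdot> d = \<one> X" "r1 \<cdot> d = \<one> X"
    using kernel_pair_diagonal[OF pair] by auto
  show thesis
    by (rule split_pullback_strong[OF triple, of d d]) (use d that in auto)
qed

text \<open>A triple whose first two coordinates agree is \<open>j \<cdot> v \<cdot> t\<close>, and
  one whose last two agree is \<open>i \<cdot> u \<cdot> t\<close>; equations on \<open>i\<close>
  and \<open>j\<close> thus cover all generalised elements.\<close>

lemma connectorI:
  assumes d: "d \<in> Ar C" "Dom C d = X" "Cod C d = Dom C r0" "r0 \<cdot> d = \<one> X" "r1 \<cdot> d = \<one> X"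
    and i: "i \<in> Ar C" "Dom C i = Dom C r0" "Cod C i = Dom C u" "u \<cdot> i = \<one> (Dom C r0)" "v \<cdot> i = d \<cdot> r1"
    and j: "j \<in> Ar C" "Dom C j = Dom C r0" "Cod C j = Dom C u" "u \<cdot> j = d \<cdot> r0" "v \<cdot> j = \<one> (Dom C r0)"
    and \<phi>: "\<phi> \<in> Ar C" "Dom C \<phi> = Dom C u" "Cod C \<phi> = X" "\<phi> \<cdot> i = r0" "\<phi> \<cdot> j = r1"
  shows "connector \<phi>"
  unfolding connector_def
proof (intro conjI allI impI)
  note [simp] = d i j \<phi> reduce[OF d(4)] reduce[OF d(5)] reduce[OF i(4)] reduce[OF i(5)]
    reduce[OF j(4)] reduce[OF j(5)] reduce[OF \<phi>(4)] reduce[OF \<phi>(5)]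
  fix t assume t: "t \<in> Ar C" "Cod C t = Dom C u"
  note [simp] = t
  {
    assume "r0 \<cdot> u \<cdot> t = r0 \<cdot> v \<cdot> t"
    then have "t = j \<cdot> v \<cdot> t" by (intro triple_ext[of t "j \<cdot> v \<cdot> t"]) simp_all
    then have "\<phi> \<cdot> t = \<phi> \<cdot> j \<cdot> v \<cdot> t" by (rule arg_cong)
    then show "\<phi> \<cdot> t = r1 \<cdot> v \<cdot> t" by simp
  next
    assume "r0 \<cdot> v \<cdot> t = r1 \<cdot> v \<cdot> t"
    then have "t = i \<cdot> u \<cdot> t" by (intro triple_ext[of t "i \<cdot> u \<cdot> t"]) simp_all
    then have "\<phi> \<cdot> t = \<phi> \<cdot> i \<cdot> u \<cdot> t" by (rule arg_cong)
    then show "\<phi> \<cdot> t = r0 \<cdot> u \<cdot> t" by simp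
  }
qed (use \<phi> in auto)

end

context extension_triples
begin

text \<open>The map from \<open>A + A + X\<close> to \<open>X\<close> with components \<open>a\<close>, \<open>a\<close> and \<open>1\<close> is pushed forward along two
  regular epimorphisms, first to the product of two copies of \<open>A + X\<close> over \<open>X\<close>, then to the object
  of triples.  The kernel of the first one is generated by \<open>A \<diamond> A\<close> and \<open>A \<diamond> A \<diamond> X\<close>.\<close>

lemma connector_if_core21_zero:
  assumes c21: "conj_core21 C a = \<zero> (cosmash3 C A A X) A" and ab: "abelian_object C A"
  shows "\<exists>\<phi>. connector \<phi>"
proof -
  \<comment> \<open>\<open>e1\<close> and \<open>e2\<close> forget the second and the first copy of
    \<open>A\<close>. They agree after \<open>\<epsilon>\<close> and so induce the comparison
    \<open>c\<close> to the pullback of \<open>\<epsilon>\<close> with itself.\<close>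
  define \<epsilon> where "\<epsilon> = \<zero> A X \<triangledown> \<one> X"
  define \<gamma> where "\<gamma> = a \<triangledown> a \<triangledown> \<one> X"
  define e1 where "e1 = in1 A X \<triangledown> \<zero> A (A \<uplus> X) \<triangledown> in2 A X"
  define e2 where "e2 = \<zero> A (A \<uplus> X) \<triangledown> in1 A X \<triangledown> in2 A X"
  note defs = \<epsilon>_def \<gamma>_def e1_def e2_def
  have \<gamma>k: "\<gamma> \<cdot> cosmash3_incl C A A X = \<zero> (cosmash3 C A A X) X"
    using c21 unfolding core21_zero_iff \<gamma>_def .
  obtain q1 q2 where Q: "is_pullback C \<epsilon> \<epsilon> q1 q2"
    using ex_pullback[of \<epsilon> \<epsilon>] unfolding \<epsilon>_def by auto
  have q [simp]: "q1 \<in> Ar C" "q2 \<in> Ar C" "Cod C q1 = A \<uplus> X" "Cod C q2 = A \<uplus> X" "Dom C q2 = Dom C q1"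
    and eq: "\<epsilon> \<cdot> q1 = \<epsilon> \<cdot> q2"
    using pullbackD[OF Q] unfolding \<epsilon>_def by auto
  have [simp]: "\<epsilon> \<in> Ar C" "Dom C \<epsilon> = A \<uplus> X" "Cod C \<epsilon> = X" unfolding \<epsilon>_def by auto
  have \<epsilon>in: "\<epsilon> \<cdot> in2 A X = \<one> X" unfolding \<epsilon>_def by simp
  obtain s1 s2 where s [simp]: "s1 \<in> Ar C" "Dom C s1 = A \<uplus> X" "Cod C s1 = Dom C q1"
    "s2 \<in> Ar C" "Dom C s2 = A \<uplus> X" "Cod C s2 = Dom C q1" and
    qs: "q1 \<cdot> s1 = \<one> (A \<uplus> X)" "q2 \<cdot> s1 = in2 A X \<cdot> \<epsilon>" "q1 \<cdot> s2 = in2 A X \<cdot> \<epsilon>" "q2 \<cdot> s2 = \<one> (A \<uplus> X)"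
    and js: "jointly_strong s2 s1"
    by (rule split_pullback_strong[OF Q, of "in2 A X" "in2 A X"]) (use \<epsilon>in in \<open>simp_all, blast?\<close>)
  have qs' [simp]: "q1 \<cdot> s1 = \<one> (A \<uplus> X)" "q2 \<cdot> s1 = \<zero> A (A \<uplus> X) \<triangledown> in2 A X"
    "q1 \<cdot> s2 = \<zero> A (A \<uplus> X) \<triangledown> in2 A X" "q2 \<cdot> s2 = \<one> (A \<uplus> X)"
    using qs unfolding \<epsilon>_def by simp_all
  note [simp] = reduce[OF qs'(1)] reduce[OF qs'(2)] reduce[OF qs'(3)] reduce[OF qs'(4)]
  have "\<epsilon> \<cdot> e1 = \<epsilon> \<cdot> e2" unfolding defs by simp
  then obtain c where c [simp]: "c \<in> Ar C" "Dom C c = A \<uplus> A \<uplus> X" "Cod C c = Dom C q1" and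
    qc: "q1 \<cdot> c = e1" "q2 \<cdot> c = e2"
    by (rule pullback_lift[OF Q, rotated 4]) (simp_all add: e1_def e2_def)
  note [simp] = qc[unfolded e1_def e2_def]
  note [simp] = reduce[OF qc(1)[unfolded e1_def e2_def]] reduce[OF qc(2)[unfolded e1_def e2_def]]
  \<comment> \<open>Both generating sections of the pullback come from
    \<open>A + A + X\<close>.\<close>
  have s1c: "s1 = c \<cdot> (in1 (A \<uplus> A) X \<cdot> in1 A A \<triangledown> in2 (A \<uplus> A) X)"
    by (rule pullback_ext[OF Q]) auto
  have s2c: "s2 = c \<cdot> (in1 (A \<uplus> A) X \<cdot> in2 A A \<triangledown> in2 (A \<uplus> A) X)"
    by (rule pullback_ext[OF Q]) auto
  have creg: "regular_epi C c"
    by (rule jointly_strong_regular_epi[OF js _ _ _ _ s2c _ _ s1c]) auto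

  obtain k where k: "is_kernel C c k" using ex_kernel[of c] by auto
  note kD [simp] = kernelD[OF k]
  have e1k: "e1 \<cdot> k = \<zero> (Dom C k) (A \<uplus> X)" and e2k: "e2 \<cdot> k = \<zero> (Dom C k) (A \<uplus> X)"
    using reduce[OF qc(1), of k] reduce[OF qc(2), of k] by simp_all
  \<comment> \<open>Forgetting \<open>X\<close> sends the kernel of \<open>c\<close> into
    \<open>A \<diamond> A\<close>: each projection to \<open>A\<close> can be read off from
    \<open>e1\<close> or \<open>e2\<close>, which are zero there.\<close>
  define \<delta> where "\<delta> = \<one> (A \<uplus> A) \<triangledown> \<zero> X (A \<uplus> A)"
  have \<delta> [simp]: "\<delta> \<in> Ar C" "Dom C \<delta> = A \<uplus> A \<uplus> X" "Cod C \<delta> = A \<uplus> A" unfolding \<delta>_def by auto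
  have 1: "(\<one> A \<triangledown> \<zero> A A) \<cdot> \<delta> \<cdot> k = \<zero> (Dom C (\<delta> \<cdot> k)) A"
  proof -
    have "(\<one> A \<triangledown> \<zero> A A) \<cdot> \<delta> = (\<one> A \<triangledown> \<zero> X A) \<cdot> e1" unfolding \<delta>_def e1_def by simp
    then have "(\<one> A \<triangledown> \<zero> A A) \<cdot> \<delta> \<cdot> k = (\<one> A \<triangledown> \<zero> X A) \<cdot> e1 \<cdot> k"
      using reduce[of "\<one> A \<triangledown> \<zero> A A" \<delta> "(\<one> A \<triangledown> \<zero> X A) \<cdot> e1" k] by (simp add: e1_def)
    then show ?thesis unfolding e1k by simp
  qed
  have 2: "(\<zero> A A \<triangledown> \<one> A) \<cdot> \<delta> \<cdot> k = \<zero> (Dom C (\<delta> \<cdot> k)) A"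
  proof -
    have "(\<zero> A A \<triangledown> \<one> A) \<cdot> \<delta> = (\<one> A \<triangledown> \<zero> X A) \<cdot> e2" unfolding \<delta>_def e2_def by simp
    then have "(\<zero> A A \<triangledown> \<one> A) \<cdot> \<delta> \<cdot> k = (\<one> A \<triangledown> \<zero> X A) \<cdot> e2 \<cdot> k"
      using reduce[of "\<zero> A A \<triangledown> \<one> A" \<delta> "(\<one> A \<triangledown> \<zero> X A) \<cdot> e2" k] by (simp add: e2_def)
    then show ?thesis unfolding e2k by simp
  qed
  define \<pi> where "\<pi> = factor C (cosmash_incl C A A) (\<delta> \<cdot> k)"
  have \<pi> [simp]: "\<pi> \<in> Ar C" "Dom C \<pi> = Dom C k" "Cod C \<pi> = cosmash C A A" "cosmash_incl C A A \<cdot> \<pi> = \<delta> \<cdot> k"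
    using cosmash_lift[OF _ _ _ _ 1 2] unfolding \<pi>_def by auto
  let ?\<iota> = "cosmash_incl C A A"
  \<comment> \<open>Conversely \<open>A \<diamond> A\<close> lies in the kernel of \<open>c\<close>,
    which splits \<open>\<pi>\<close>. That kernel is thereby generated by \<open>\<sigma>\<close>
    and the kernel \<open>l\<close> of \<open>\<pi>\<close>.\<close>
  have "c \<cdot> in1 (A \<uplus> A) X \<cdot> ?\<iota> = \<zero> (cosmash C A A) (Dom C q1)"
    by (rule pullback_ext[OF Q]) (auto simp: cosmash_incl_zero)
  then obtain \<sigma> where \<sigma> [simp]: "\<sigma> \<in> Ar C" "Dom C \<sigma> = cosmash C A A" "Cod C \<sigma> = Dom C k"
    "k \<cdot> \<sigma> = in1 (A \<uplus> A) X \<cdot> ?\<iota>"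
    using kernel_lift[OF k, of "in1 (A \<uplus> A) X \<cdot> ?\<iota>"] by auto
  have \<pi>\<sigma>: "\<pi> \<cdot> \<sigma> = \<one> (cosmash C A A)"
    by (rule monicD[OF cosmash_incl_monic[of A A]])
      (simp_all add: reduce[OF \<pi>(4)] \<delta>_def)
  obtain l where l: "is_kernel C \<pi> l" using ex_kernel[of \<pi>] by auto
  note lD [simp] = kernelD[OF l]
  have "\<delta> \<cdot> k \<cdot> l = \<zero> (Dom C l) (A \<uplus> A)"
    using reduce[OF \<pi>(4), of l] by simp
  moreover have "e1 \<cdot> k \<cdot> l = \<zero> (Dom C l) (A \<uplus> X)" "e2 \<cdot> k \<cdot> l = \<zero> (Dom C l) (A \<uplus> X)"
    using reduce[OF e1k, of l] reduce[OF e2k, of l] by (simp_all add: e1_def e2_def)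
  \<comment> \<open>The three morphisms defining the ternary cosmash product all vanish here, so
    \<open>k \<cdot> l\<close> factors through it, and \<open>\<gamma>\<close> is zero there by
    hypothesis.\<close>
  ultimately obtain h where h: "h \<in> Ar C" "Dom C h = Dom C l" "Cod C h = cosmash3 C A A X" "cosmash3_incl C A A X \<cdot> h = k \<cdot> l"
    using cosmash3_lift[of A A X "k \<cdot> l"] unfolding \<delta>_def e1_def e2_def by auto
  have [simp]: "\<gamma> \<in> Ar C" "Dom C \<gamma> = A \<uplus> A \<uplus> X" "Cod C \<gamma> = X" unfolding \<gamma>_def by auto
  have "\<gamma> \<cdot> k \<cdot> l = \<zero> (Dom C l) X"
    using reduce[OF \<gamma>k, of h] h by simp
  moreover have "\<gamma> \<cdot> k \<cdot> \<sigma> = \<zero> (cosmash C A A) X"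
  proof -
    have "\<gamma> \<cdot> k \<cdot> \<sigma> = (a \<triangledown> a) \<cdot> ?\<iota>" by (simp add: \<gamma>_def)
    also have "\<dots> = a \<cdot> (\<one> A \<triangledown> \<one> A) \<cdot> ?\<iota>" by simp
    also have "\<dots> = \<zero> (cosmash C A A) X" unfolding abelian_cosmash_zero[OF ab] by simp
    finally show ?thesis .
  qed
  ultimately have "\<gamma> \<cdot> k = \<zero> (Dom C k) X"
    using \<pi>\<sigma> by (intro jointly_strong_epic[OF point_kernel_strong[OF _ _ _ _ l, of \<sigma>], of "\<gamma> \<cdot> k" "\<zero> (Dom C k) X"]) auto
  then obtain \<theta> where \<theta> [simp]: "\<theta> \<in> Ar C" "Dom C \<theta> = Dom C q1" "Cod C \<theta> = X" and \<theta>c: "\<theta> \<cdot> c = \<gamma>"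
    using regular_epi_kernel_factor[OF creg k, of \<gamma>] by auto
  have \<theta>s: "\<theta> \<cdot> s1 = a \<triangledown> \<one> X" "\<theta> \<cdot> s2 = a \<triangledown> \<one> X"
    unfolding s1c s2c using \<theta>c by (simp_all del: comp_copairing add: reduce[OF \<theta>c], simp_all add: \<gamma>_def)

  have \<epsilon>q: "(\<zero> A X \<triangledown> \<one> X) \<cdot> q1 = (\<zero> A X \<triangledown> \<one> X) \<cdot> q2" using eq unfolding \<epsilon>_def .
  have pq: "(\<zero> A G \<triangledown> p) \<cdot> q1 = (\<zero> A G \<triangledown> p) \<cdot> q2"
  proof -
    have "p \<cdot> (\<zero> A X \<triangledown> \<one> X) \<cdot> q1 = p \<cdot> (\<zero> A X \<triangledown> \<one> X) \<cdot> q2" unfolding \<epsilon>q ..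
    then show ?thesis by simp
  qed
  \<comment> \<open>Two words of \<open>A + X\<close> over the same element of \<open>X\<close>
    yield a triple: their values in \<open>X\<close> are the outer coordinates, the common element
    is the middle one.\<close>
  obtain f where f [simp]: "f \<in> Ar C" "Dom C f = Dom C q1" "Cod C f = Dom C u" and
    xyz: "r0 \<cdot> u \<cdot> f = (a \<triangledown> \<one> X) \<cdot> q1" "r0 \<cdot> v \<cdot> f = (\<zero> A X \<triangledown> \<one> X) \<cdot> q1" "r1 \<cdot> v \<cdot> f = (a \<triangledown> \<one> X) \<cdot> q2"
    by (rule triple_lift[of "(a \<triangledown> \<one> X) \<cdot> q1" "(\<zero> A X \<triangledown> \<one> X) \<cdot> q1" "(a \<triangledown> \<one> X) \<cdot> q2"])
      (use pq in auto)
  have xyz': "r0 \<cdot> u \<cdot> f \<cdot> t = (a \<triangledown> \<one> X) \<cdot> q1 \<cdot> t" "r0 \<cdot> v \<cdot> f \<cdot> t = (\<zero> A X \<triangledown> \<one> X) \<cdot> q1 \<cdot> t"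
    "r1 \<cdot> v \<cdot> f \<cdot> t = (a \<triangledown> \<one> X) \<cdot> q2 \<cdot> t" if "t \<in> Ar C" "Cod C t = Dom C q1" for t
    using that arg_cong[OF xyz(1), of "\<lambda>h. h \<cdot> t"] arg_cong[OF xyz(2), of "\<lambda>h. h \<cdot> t"] arg_cong[OF xyz(3), of "\<lambda>h. h \<cdot> t"]
    by simp_all
  note [simp] = xyz xyz'
  obtain d i j where d: "d \<in> Ar C" "Dom C d = X" "Cod C d = Dom C r0" "r0 \<cdot> d = \<one> X" "r1 \<cdot> d = \<one> X"
    and i: "i \<in> Ar C" "Dom C i = Dom C r0" "Cod C i = Dom C u" "u \<cdot> i = \<one> (Dom C r0)" "v \<cdot> i = d \<cdot> r1"
    and j: "j \<in> Ar C" "Dom C j = Dom C r0" "Cod C j = Dom C u" "u \<cdot> j = d \<cdot> r0" "v \<cdot> j = \<one> (Dom C r0)"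
    and ji: "jointly_strong j i" by (rule sections)
  note [simp] = d i j reduce[OF d(4)] reduce[OF d(5)] reduce[OF i(4)] reduce[OF i(5)] reduce[OF j(4)] reduce[OF j(5)]
  \<comment> \<open>The kernels of the two projections consist of the pairs \<open>(a, 0)\<close>
    and \<open>(0, a)\<close>. Each generates the kernel pair together with the diagonal, which is
    how \<open>f\<close> is seen to reach \<open>i\<close> and \<open>j\<close>.\<close>
  obtain a0 where a0: "is_kernel C r1 a0" "a0 \<in> Ar C" "Dom C a0 = A" "Cod C a0 = Dom C r0"
    "r0 \<cdot> a0 = a" "r1 \<cdot> a0 = \<zero> A X"
    by (rule pullback_kernel[OF pair kernel_a]) simp
  obtain a1 where a1: "is_kernel C r0 a1" "a1 \<in> Ar C" "Dom C a1 = A" "Cod C a1 = Dom C r0"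
    "r1 \<cdot> a1 = a" "r0 \<cdot> a1 = \<zero> A X"
    by (rule pullback_kernel[OF pullback_sym[OF pair] kernel_a]) simp
  note [simp] = a0(2-) a1(2-)
  have js0: "jointly_strong a0 d" by (rule point_kernel_strong[OF _ _ _ _ a0(1)]) auto
  have js1: "jointly_strong a1 d" by (rule point_kernel_strong[OF _ _ _ _ a1(1)]) auto
  have fs: "f \<cdot> s1 \<cdot> in1 A X = i \<cdot> a0" "f \<cdot> s1 \<cdot> in2 A X = i \<cdot> d" "f \<cdot> s2 \<cdot> in1 A X = j \<cdot> a1" "f \<cdot> s2 \<cdot> in2 A X = j \<cdot> d"
    by (rule triple_ext; simp)+
  have freg: "regular_epi C f"
  proof (rule regular_epiI)
    fix m w assume m: "monic C m" "m \<in> Ar C" and w: "w \<in> Ar C" "Cod C w = Dom C m" "Dom C w = Dom C f"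
      "Cod C m = Cod C f" "m \<cdot> w = f"
    note [simp] = m(2) w(1-4) reduce[OF w(5)] fs
    obtain i' where i': "i' \<in> Ar C" "Cod C i' = Dom C m" "m \<cdot> i' = i"
      by (rule jointly_strong_factor[OF js0 m(1), of i "w \<cdot> s1 \<cdot> in1 A X" "w \<cdot> s1 \<cdot> in2 A X"]) (simp_all, blast?)
    obtain j' where j': "j' \<in> Ar C" "Cod C j' = Dom C m" "m \<cdot> j' = j"
      by (rule jointly_strong_factor[OF js1 m(1), of j "w \<cdot> s2 \<cdot> in1 A X" "w \<cdot> s2 \<cdot> in2 A X"]) (simp_all, blast?)
    obtain t where "t \<in> Ar C" "Cod C t = Dom C m" "m \<cdot> t = \<one> (Cod C f)"
      by (rule jointly_strong_factor[OF ji m(1), of "\<one> (Cod C f)" j' i']) (use i' j' in auto)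
    then show "\<exists>t. t \<in> Ar C \<and> Cod C t = Dom C m \<and> m \<cdot> t = \<one> (Cod C f)" by blast
  qed simp

  \<comment> \<open>The kernel of \<open>\<kappa>\<close> consists of the words that have value zero
    and lie over zero. An element of the kernel of \<open>f\<close> is a pair of such words, that
    is, it factors through \<open>\<mu>\<close>.\<close>
  define \<kappa> where "\<kappa> = \<langle>a \<triangledown> \<one> X, \<zero> A X \<triangledown> \<one> X\<rangle>"
  have \<kappa> [simp]: "\<kappa> \<in> Ar C" "Dom C \<kappa> = A \<uplus> X" "Cod C \<kappa> = X \<otimes> X" unfolding \<kappa>_def by auto
  obtain \<nu> where \<nu>: "is_kernel C \<kappa> \<nu>" using ex_kernel[of \<kappa>] by auto
  note \<nu>D [simp] = kernelD(2,3)[OF \<nu>]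
  define N where "N = Dom C \<nu>"
  have N [simp]: "Dom C \<nu> = N" "N \<in> Ob C" unfolding N_def by auto
  have \<kappa>\<nu>: "\<kappa> \<cdot> \<nu> = \<zero> N (X \<otimes> X)" using kernelD(4)[OF \<nu>] by simp
  have "pr1 X X \<cdot> \<kappa> \<cdot> \<nu> = \<zero> N X" "pr2 X X \<cdot> \<kappa> \<cdot> \<nu> = \<zero> N X" unfolding \<kappa>\<nu> by simp_all
  then have \<nu>z: "(a \<triangledown> \<one> X) \<cdot> \<nu> = \<zero> N X" "(\<zero> A X \<triangledown> \<one> X) \<cdot> \<nu> = \<zero> N X"
    unfolding \<kappa>_def by simp_all
  note [simp] = \<nu>z reduce[OF \<nu>z(1)] reduce[OF \<nu>z(2)]
  obtain \<mu> where \<mu> [simp]: "\<mu> \<in> Ar C" "Dom C \<mu> = N \<otimes> N" "Cod C \<mu> = Dom C q1" and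
    q\<mu> [simp]: "q1 \<cdot> \<mu> = \<nu> \<cdot> pr1 N N" "q2 \<cdot> \<mu> = \<nu> \<cdot> pr2 N N"
    by (rule pullback_lift[OF Q, of "\<nu> \<cdot> pr1 N N" "\<nu> \<cdot> pr2 N N"]) (auto simp: \<epsilon>_def)
  note [simp] = reduce[OF q\<mu>(1)] reduce[OF q\<mu>(2)]
  have in2\<nu> [simp]: "(\<zero> A (A \<uplus> X) \<triangledown> in2 A X) \<cdot> \<nu> = \<zero> N (A \<uplus> X)"
    using arg_cong[OF \<nu>z(2), of "\<lambda>h. in2 A X \<cdot> h"] by (simp del: \<nu>z)
  \<comment> \<open>On the axes of the product, \<open>\<mu>\<close> is
    \<open>s1 \<cdot> \<nu>\<close> and \<open>s2 \<cdot> \<nu>\<close>, where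
    \<open>\<theta>\<close> is given by \<open>a \<triangledown> \<one> X\<close> and vanishes by
    the choice of \<open>\<nu>\<close>.\<close>
  have "\<theta> \<cdot> \<mu> = \<zero> (N \<otimes> N) X"
  proof (rule jointly_strong_epic[OF product_jointly_strong[of N N]])
    have "\<mu> \<cdot> \<langle>\<one> N, \<zero> N N\<rangle> = s1 \<cdot> \<nu>" "\<mu> \<cdot> \<langle>\<zero> N N, \<one> N\<rangle> = s2 \<cdot> \<nu>"
      by (rule pullback_ext[OF Q]; simp)+
    then show "(\<theta> \<cdot> \<mu>) \<cdot> \<langle>\<one> N, \<zero> N N\<rangle> = \<zero> (N \<otimes> N) X \<cdot> \<langle>\<one> N, \<zero> N N\<rangle>"
      "(\<theta> \<cdot> \<mu>) \<cdot> \<langle>\<zero> N N, \<one> N\<rangle> = \<zero> (N \<otimes> N) X \<cdot> \<langle>\<zero> N N, \<one> N\<rangle>"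
      by (simp_all add: reduce[OF \<theta>s(1)] reduce[OF \<theta>s(2)])
  qed auto
  note \<theta>\<mu> = this
  obtain n where n: "is_kernel C f n" using ex_kernel[of f] by auto
  note nD [simp] = kernelD[OF n]
  have "r0 \<cdot> u \<cdot> f \<cdot> n = \<zero> (Dom C n) X" "r0 \<cdot> v \<cdot> f \<cdot> n = \<zero> (Dom C n) X" "r1 \<cdot> v \<cdot> f \<cdot> n = \<zero> (Dom C n) X"
    by (simp_all del: xyz xyz')
  then have qn: "(a \<triangledown> \<one> X) \<cdot> q1 \<cdot> n = \<zero> (Dom C n) X" "(\<zero> A X \<triangledown> \<one> X) \<cdot> q1 \<cdot> n = \<zero> (Dom C n) X"
    "(a \<triangledown> \<one> X) \<cdot> q2 \<cdot> n = \<zero> (Dom C n) X" by (simp_all del: nD(4))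
  have qn': "(\<zero> A X \<triangledown> \<one> X) \<cdot> q2 \<cdot> n = \<zero> (Dom C n) X"
    using reduce[OF \<epsilon>q, of n] qn(2) by simp
  obtain h1 where h1: "h1 \<in> Ar C" "Dom C h1 = Dom C n" "Cod C h1 = N" "\<nu> \<cdot> h1 = q1 \<cdot> n"
    using kernel_lift[OF \<nu>, of "q1 \<cdot> n"] qn by (auto simp: \<kappa>_def)
  obtain h2 where h2: "h2 \<in> Ar C" "Dom C h2 = Dom C n" "Cod C h2 = N" "\<nu> \<cdot> h2 = q2 \<cdot> n"
    using kernel_lift[OF \<nu>, of "q2 \<cdot> n"] qn qn' by (auto simp: \<kappa>_def)
  have "\<mu> \<cdot> \<langle>h1, h2\<rangle> = n"
    by (rule pullback_ext[OF Q]) (simp_all add: h1 h2)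
  then have "\<theta> \<cdot> n = \<theta> \<cdot> \<mu> \<cdot> \<langle>h1, h2\<rangle>" by simp
  also have "\<dots> = \<zero> (Dom C n) X"
    using reduce[OF \<theta>\<mu>, of "\<langle>h1, h2\<rangle>"] h1 h2 by simp
  finally have "\<theta> \<cdot> n = \<zero> (Dom C n) X" .
  then obtain \<phi> where \<phi>: "\<phi> \<in> Ar C" "Dom C \<phi> = Dom C u" "Cod C \<phi> = X" and \<phi>f: "\<phi> \<cdot> f = \<theta>"
    using regular_epi_kernel_factor[OF freg n, of \<theta>] by auto
  note [simp] = \<phi>
  have \<phi>fs: "\<phi> \<cdot> f \<cdot> s1 = a \<triangledown> \<one> X" "\<phi> \<cdot> f \<cdot> s2 = a \<triangledown> \<one> X"
    using reduce[OF \<phi>f, of s1] reduce[OF \<phi>f, of s2] \<theta>s by simp_all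
  have \<phi>s: "\<phi> \<cdot> f \<cdot> s1 \<cdot> t = (a \<triangledown> \<one> X) \<cdot> t" "\<phi> \<cdot> f \<cdot> s2 \<cdot> t = (a \<triangledown> \<one> X) \<cdot> t"
    if "t \<in> Ar C" "Cod C t = A \<uplus> X" for t
    using that arg_cong[OF \<phi>fs(1), of "\<lambda>h. h \<cdot> t"] arg_cong[OF \<phi>fs(2), of "\<lambda>h. h \<cdot> t"] by simp_all
  have "\<phi> \<cdot> i = r0"
    by (rule jointly_strong_epic[OF js0]) (simp_all add: fs[symmetric] \<phi>s)
  moreover have "\<phi> \<cdot> j = r1"
    by (rule jointly_strong_epic[OF js1]) (simp_all add: fs[symmetric] \<phi>s)
  ultimately have "connector \<phi>" using connectorI[OF d i j \<phi>] by blast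
  then show ?thesis ..
qed

end

context extension_triples
begin

subsection \<open>The action of the quotient\<close>

text \<open>Up to a cover, an element of the kernel of \<open>\<tau>\<close> is
  \<open>d0 \<cdot> z\<close> with \<open>d1 \<cdot> z\<close> zero, for a word \<open>z\<close> of
  \<open>A + A + X\<close>. The connector, evaluated at a triple built from \<open>z\<close>, gives
  both the value of the conjugation action on that element and zero.\<close>

lemma action_if_connector:
  assumes "connector \<phi>"
  shows "\<exists>\<psi>. is_action_core C G A \<psi> \<and> core = \<psi> \<cdot> cosmash_mor C (\<one> A) p"
proof -
  note \<phi> [simp] = connectorD(1-3)[OF assms]
  let ?T = "T_incl C X A"
  define \<xi> where "\<xi> = factor C a ((a \<triangledown> \<one> X) \<cdot> ?T)"
  have "p \<cdot> (a \<triangledown> \<one> X) \<cdot> ?T = \<zero> (T_obj C X A) G"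
    using T_incl_zero[of X A p] by simp
  then have \<xi> [simp]: "\<xi> \<in> Ar C" "Dom C \<xi> = T_obj C X A" "Cod C \<xi> = A" "a \<cdot> \<xi> = (a \<triangledown> \<one> X) \<cdot> ?T"
    using factor_kernel[OF kernel_a, of "(a \<triangledown> \<one> X) \<cdot> ?T"] unfolding \<xi>_def by auto
  note [simp] = reduce[OF \<xi>(4)]
  define \<tau> where "\<tau> = T_map p (\<one> A)"
  have \<tau> [simp]: "\<tau> \<in> Ar C" "Dom C \<tau> = T_obj C X A" "Cod C \<tau> = T_obj C G A"
    "T_incl C G A \<cdot> \<tau> = (in1 A G \<triangledown> in2 A G \<cdot> p) \<cdot> ?T"
    unfolding \<tau>_def by simp_all
  note [simp] = reduce[OF \<tau>(4)]
  have one: "regular_epi C (\<one> A)" by (rule regular_epiI) auto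
  have \<tau>reg: "regular_epi C \<tau>" unfolding \<tau>_def by (rule T_map_regular_epi[OF one regular_epi_p])
  obtain l where l: "is_kernel C \<tau> l" using ex_kernel[of \<tau>] by auto
  note lD [simp] = kernelD[OF l]

  \<comment> \<open>\<open>d0\<close> reads the middle letter in \<open>X\<close>, \<open>d1\<close>
    discards it. Identifying them kills \<open>A\<close> inside \<open>X\<close>, so
    \<open>q\<close> is universal for this; the inclusion that skips the middle letter is a common
    section.\<close>
  define d0 where "d0 = in1 A X \<triangledown> in2 A X \<cdot> a \<triangledown> in2 A X"
  define d1 where "d1 = in1 A X \<triangledown> \<zero> A (A \<uplus> X) \<triangledown> in2 A X"
  define q where "q = in1 A G \<triangledown> in2 A G \<cdot> p"
  note defs = d0_def d1_def q_def
  have d [simp]: "d0 \<in> Ar C" "Dom C d0 = A \<uplus> A \<uplus> X" "Cod C d0 = A \<uplus> X"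
    "d1 \<in> Ar C" "Dom C d1 = A \<uplus> A \<uplus> X" "Cod C d1 = A \<uplus> X"
    "q \<in> Ar C" "Dom C q = A \<uplus> X" "Cod C q = A \<uplus> G"
    unfolding defs by simp_all
  obtain k0 k1 e where K: "is_pullback C q q k0 k1" and ereg: "regular_epi C e" and
    e [simp]: "e \<in> Ar C" "Dom C e = A \<uplus> A \<uplus> X" "Cod C e = Dom C k0" and ke: "k0 \<cdot> e = d0" "k1 \<cdot> e = d1"
  proof (rule reflexive_pair_covers_kernel_pair[of d0 d1 "in1 (A \<uplus> A) X \<cdot> in1 A A \<triangledown> in2 (A \<uplus> A) X" q])
    show "q \<cdot> d0 = q \<cdot> d1" unfolding defs by simp
    fix f assume f: "f \<in> Ar C" "Dom C f = Cod C d0" "f \<cdot> d0 = f \<cdot> d1"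
    then have fD: "f \<in> Ar C" "Dom C f = A \<uplus> X" by simp_all
    have "(f \<cdot> d0) \<cdot> in1 (A \<uplus> A) X \<cdot> in2 A A = (f \<cdot> d1) \<cdot> in1 (A \<uplus> A) X \<cdot> in2 A A" by (simp only: f(3))
    then have "f \<cdot> in2 A X \<cdot> a = \<zero> A (Cod C f)" using fD unfolding defs by simp
    then obtain h where h: "h \<in> Ar C" "Dom C h = G" "Cod C h = Cod C f" "h \<cdot> p = f \<cdot> in2 A X"
      using p_factor[of "f \<cdot> in2 A X"] fD by auto
    have "((f \<cdot> in1 A X) \<triangledown> h) \<cdot> q = f" unfolding defs using h fD by simp
    then show "\<exists>h. h \<in> Ar C \<and> Dom C h = Cod C q \<and> Cod C h = Cod C f \<and> h \<cdot> q = f"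
      using h fD by (intro exI[of _ "(f \<cdot> in1 A X) \<triangledown> h"]) simp
  qed (simp_all add: defs, blast?)
  note KD [simp] = pullbackD(3,4,6-8)[OF K]
  have ql: "q \<cdot> ?T \<cdot> l = \<zero> (Dom C l) (A \<uplus> G)"
  proof -
    have "q \<cdot> ?T \<cdot> l = T_incl C G A \<cdot> \<tau> \<cdot> l" by (simp add: q_def del: lD(4))
    then show ?thesis by simp
  qed
  \<comment> \<open>Since \<open>q\<close> kills the kernel of \<open>\<tau>\<close>, its elements
    are paired with zero in the kernel pair of \<open>q\<close>. The latter is covered by
    \<open>e\<close>, and pulling back along \<open>e\<close> produces the words
    \<open>z\<close>.\<close>
  obtain l' where l' [simp]: "l' \<in> Ar C" "Dom C l' = Dom C l" "Cod C l' = Dom C k0"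
    "k0 \<cdot> l' = ?T \<cdot> l" "k1 \<cdot> l' = \<zero> (Dom C l) (A \<uplus> X)"
    by (rule pullback_lift[OF K, of "?T \<cdot> l" "\<zero> (Dom C l) (A \<uplus> X)"]) (use ql in auto)
  note [simp] = reduce[OF l'(4)] reduce[OF l'(5)]
  obtain z o' where zo: "is_pullback C e l' z o'" using ex_pullback[of e l'] by auto
  note zoD [simp] = pullbackD(3,4,6-8)[OF zo]
  have oreg: "regular_epi C o'" by (rule regular_epi_pullback[OF ereg zo])
  have d0z: "d0 \<cdot> z = ?T \<cdot> l \<cdot> o'"
  proof -
    have "d0 \<cdot> z = k0 \<cdot> e \<cdot> z" using reduce[OF ke(1), of z] by simp
    also have "\<dots> = k0 \<cdot> l' \<cdot> o'" by (simp only: pullbackD(9)[OF zo])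
    finally show ?thesis by simp
  qed
  have d1z: "d1 \<cdot> z = \<zero> (Dom C z) (A \<uplus> X)"
  proof -
    have "d1 \<cdot> z = k1 \<cdot> e \<cdot> z" using reduce[OF ke(2), of z] by simp
    also have "\<dots> = k1 \<cdot> l' \<cdot> o'" by (simp only: pullbackD(9)[OF zo])
    finally show ?thesis by simp
  qed
  \<comment> \<open>For letters \<open>b\<close>, \<open>b'\<close>, \<open>x\<close>, the outer
    coordinates keep \<open>b, x\<close> and \<open>b', x\<close>, the middle one only
    \<open>x\<close>. On each summand two neighbouring coordinates agree, so the connector is
    determined there and \<open>\<phi> \<cdot> w\<close> evaluates the full word.\<close>
  obtain w where w [simp]: "w \<in> Ar C" "Dom C w = A \<uplus> A \<uplus> X" "Cod C w = Dom C u" and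
    xyz: "r0 \<cdot> u \<cdot> w = a \<triangledown> \<zero> A X \<triangledown> \<one> X" "r0 \<cdot> v \<cdot> w = \<zero> (A \<uplus> A) X \<triangledown> \<one> X" "r1 \<cdot> v \<cdot> w = \<zero> A X \<triangledown> a \<triangledown> \<one> X"
    by (rule triple_lift[of "a \<triangledown> \<zero> A X \<triangledown> \<one> X" "\<zero> (A \<uplus> A) X \<triangledown> \<one> X" "\<zero> A X \<triangledown> a \<triangledown> \<one> X"]) auto
  have xyz': "r0 \<cdot> u \<cdot> w \<cdot> t = (a \<triangledown> \<zero> A X \<triangledown> \<one> X) \<cdot> t" "r0 \<cdot> v \<cdot> w \<cdot> t = (\<zero> (A \<uplus> A) X \<triangledown> \<one> X) \<cdot> t"
    "r1 \<cdot> v \<cdot> w \<cdot> t = (\<zero> A X \<triangledown> a \<triangledown> \<one> X) \<cdot> t" if "t \<in> Ar C" "Cod C t = A \<uplus> A \<uplus> X" for t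
    using that arg_cong[OF xyz(1), of "\<lambda>h. h \<cdot> t"] arg_cong[OF xyz(2), of "\<lambda>h. h \<cdot> t"] arg_cong[OF xyz(3), of "\<lambda>h. h \<cdot> t"]
    by simp_all
  have "\<phi> \<cdot> w \<cdot> in1 (A \<uplus> A) X \<cdot> in1 A A = r0 \<cdot> u \<cdot> w \<cdot> in1 (A \<uplus> A) X \<cdot> in1 A A"
    by (rule connectorD(5)[OF assms]) (simp_all add: xyz')
  moreover have "\<phi> \<cdot> w \<cdot> in1 (A \<uplus> A) X \<cdot> in2 A A = r1 \<cdot> v \<cdot> w \<cdot> in1 (A \<uplus> A) X \<cdot> in2 A A"
    by (rule connectorD(4)[OF assms]) (simp_all add: xyz')
  moreover have "\<phi> \<cdot> w \<cdot> in2 (A \<uplus> A) X = r1 \<cdot> v \<cdot> w \<cdot> in2 (A \<uplus> A) X"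
    by (rule connectorD(4)[OF assms]) (simp_all add: xyz')
  ultimately have \<phi>w: "\<phi> \<cdot> w = a \<triangledown> a \<triangledown> \<one> X"
    by (intro coproduct3_ext[of "\<phi> \<cdot> w" "a \<triangledown> a \<triangledown> \<one> X" A A X]) (simp_all add: xyz')
  have "(a \<triangledown> \<one> X) \<cdot> ?T \<cdot> l \<cdot> o' = (a \<triangledown> \<one> X) \<cdot> d0 \<cdot> z" by (simp only: d0z)
  also have "\<dots> = (a \<triangledown> a \<triangledown> \<one> X) \<cdot> z" unfolding d0_def by simp
  also have "\<dots> = \<phi> \<cdot> w \<cdot> z" using reduce[OF \<phi>w, of z] by simp
  \<comment> \<open>The first two coordinates depend only on \<open>d1 \<cdot> z\<close> and are
    zero, so the connector returns the third.\<close>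
  also have "\<dots> = r1 \<cdot> v \<cdot> w \<cdot> z"
  proof (rule connectorD(4)[OF assms])
    have "r0 \<cdot> u \<cdot> w \<cdot> z = (a \<triangledown> \<one> X) \<cdot> d1 \<cdot> z" by (simp add: xyz' d1_def)
    moreover have "r0 \<cdot> v \<cdot> w \<cdot> z = (\<zero> A X \<triangledown> \<one> X) \<cdot> d1 \<cdot> z" by (simp add: xyz' d1_def)
    ultimately show "r0 \<cdot> u \<cdot> w \<cdot> z = r0 \<cdot> v \<cdot> w \<cdot> z" by (simp add: d1z)
  qed auto
  \<comment> \<open>The third coordinate is the projection of \<open>d0 \<cdot> z\<close> to
    \<open>X\<close>, which vanishes because that element comes from \<open>T_X(A)\<close>.\<close>
  also have "\<dots> = (\<zero> A X \<triangledown> \<one> X) \<cdot> d0 \<cdot> z" by (simp add: xyz' d0_def)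
  also have "\<dots> = (\<zero> A X \<triangledown> \<one> X) \<cdot> ?T \<cdot> l \<cdot> o'" by (simp only: d0z)
  also have "\<dots> = \<zero> (Dom C o') X" using reduce[OF T_incl_simps(5)[of X A], of "l \<cdot> o'"] by simp
  finally have "(a \<triangledown> \<one> X) \<cdot> ?T \<cdot> l \<cdot> o' = \<zero> (Dom C o') X" .
  then have "(\<xi> \<cdot> l) \<cdot> o' = \<zero> (Dom C l) A \<cdot> o'"
    by (intro monicD[OF monic_a, of "(\<xi> \<cdot> l) \<cdot> o'" "\<zero> (Dom C l) A \<cdot> o'"]) auto
  then have "\<xi> \<cdot> l = \<zero> (Dom C l) A"
    by (intro epicD[OF regular_epi_epic[OF oreg], of "\<xi> \<cdot> l" "\<zero> (Dom C l) A"]) auto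
  then obtain \<xi>' where \<xi>' [simp]: "\<xi>' \<in> Ar C" "Dom C \<xi>' = T_obj C G A" "Cod C \<xi>' = A" "\<xi>' \<cdot> \<tau> = \<xi>"
    using regular_epi_kernel_factor[OF \<tau>reg l, of \<xi>] by auto
  note [simp] = reduce[OF \<xi>'(4)]

  have unit: "\<xi>' \<cdot> T_unit C G A = \<one> A"
  proof -
    have "T_unit C G A = \<tau> \<cdot> T_unit C X A"
      by (rule monicD[OF T_incl_monic[of G A]]) auto
    then have "\<xi>' \<cdot> T_unit C G A = \<xi> \<cdot> T_unit C X A" by simp
    also have "\<dots> = \<one> A" by (rule monicD[OF monic_a]) auto
    finally show ?thesis .
  qed
  have mult: "\<xi>' \<cdot> T_mor C G \<xi>' = \<xi>' \<cdot> T_mult C G A"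
  proof -
    \<comment> \<open>\<open>\<omega>\<close> covers \<open>T_G(T_G(A))\<close> by
      \<open>T_X(T_X(A))\<close>. There the law becomes the one for \<open>\<xi>\<close>, which can
      be checked after composition with \<open>a\<close>.\<close>
    define \<omega> where "\<omega> = T_map p \<tau>"
    have \<omega> [simp]: "\<omega> \<in> Ar C" "Dom C \<omega> = T_obj C X (T_obj C X A)" "Cod C \<omega> = T_obj C G (T_obj C G A)"
      "T_incl C G (T_obj C G A) \<cdot> \<omega> =
        (in1 (T_obj C G A) G \<cdot> \<tau> \<triangledown> in2 (T_obj C G A) G \<cdot> p) \<cdot> T_incl C X (T_obj C X A)"
      unfolding \<omega>_def by simp_all
    note [simp] = reduce[OF \<omega>(4)]
    have \<omega>reg: "regular_epi C \<omega>" unfolding \<omega>_def by (rule T_map_regular_epi[OF \<tau>reg regular_epi_p])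
    have 1: "T_mor C G \<xi>' \<cdot> \<omega> = \<tau> \<cdot> T_mor C X \<xi>"
      by (rule monicD[OF T_incl_monic[of G A]]) auto
    have 2: "T_mult C G A \<cdot> \<omega> = \<tau> \<cdot> T_mult C X A"
      by (rule monicD[OF T_incl_monic[of G A]]) auto
    have "\<xi> \<cdot> T_mor C X \<xi> = \<xi> \<cdot> T_mult C X A"
      by (rule monicD[OF monic_a]) auto
    then show ?thesis
      by (intro epicD[OF regular_epi_epic[OF \<omega>reg], of "\<xi>' \<cdot> T_mor C G \<xi>'" "\<xi>' \<cdot> T_mult C G A"])
        (simp_all add: 1 2)
  qed
  have act: "is_action C G A \<xi>'" unfolding is_action_def using unit mult by simp
  have "cosmash_in_T G A \<cdot> cosmash_mor C (\<one> A) p = \<tau> \<cdot> cosmash_in_T X A"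
    by (rule monicD[OF T_incl_monic[of G A]]) auto
  then have "(\<xi>' \<cdot> cosmash_in_T G A) \<cdot> cosmash_mor C (\<one> A) p = \<xi> \<cdot> cosmash_in_T X A" by simp
  also have "\<dots> = core" by (rule monicD[OF monic_a]) auto
  finally have "core = (\<xi>' \<cdot> cosmash_in_T G A) \<cdot> cosmash_mor C (\<one> A) p" ..
  moreover have "is_action_core C G A (\<xi>' \<cdot> cosmash_in_T G A)"
    unfolding is_action_core_def action_core_def cosmash_in_T_def using act by blast
  ultimately show ?thesis by blast
qed

subsection \<open>The Smith/Pedicchio commutator\<close>

lemma refl_mor_eq:
  assumes "d \<in> Ar C" "Dom C d = X" "Cod C d = Dom C r0" "r0 \<cdot> d = \<one> X" "r1 \<cdot> d = \<one> X"
  shows "refl_mor C r0 r1 = d"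
  unfolding refl_mor_def
proof (rule the_equality)
  show "\<guillemotleft>d : Cod C r0 \<rightarrow> Dom C r0\<guillemotright> \<and> r0 \<cdot> d = \<one> (Cod C r0) \<and> r1 \<cdot> d = \<one> (Cod C r0)" using assms by simp
  fix e assume "\<guillemotleft>e : Cod C r0 \<rightarrow> Dom C r0\<guillemotright> \<and> r0 \<cdot> e = \<one> (Cod C r0) \<and> r1 \<cdot> e = \<one> (Cod C r0)"
  then show "e = d" using assms by (intro pullback_ext[OF pair, of e d]) auto
qed

text \<open>Uniqueness of pullback lifts leaves one candidate for each quantified morphism of the
  definition, so the cocone condition reduces to two equations.\<close>

lemma connecting_cocone_iff:
  assumes d: "d \<in> Ar C" "Dom C d = X" "Cod C d = Dom C r0" "r0 \<cdot> d = \<one> X" "r1 \<cdot> d = \<one> X"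
    and i: "i \<in> Ar C" "Dom C i = Dom C r0" "Cod C i = Dom C u" "u \<cdot> i = \<one> (Dom C r0)" "v \<cdot> i = d \<cdot> r1"
    and j: "j \<in> Ar C" "Dom C j = Dom C r0" "Cod C j = Dom C u" "u \<cdot> j = d \<cdot> r0" "v \<cdot> j = \<one> (Dom C r0)"
  shows "is_connecting_cocone C r0 r1 r0 r1 u v \<phi> t \<longleftrightarrow>
    \<guillemotleft>\<phi> : Dom C u \<rightarrow> Cod C t\<guillemotright> \<and> \<guillemotleft>t : X \<rightarrow> Cod C t\<guillemotright> \<and> \<phi> \<cdot> i = t \<cdot> r0 \<and> \<phi> \<cdot> j = t \<cdot> r1"
proof -
  have i': "i' \<in> Hom C (Dom C r0) (Dom C u) \<and> u \<cdot> i' = \<one> (Dom C r0) \<and> v \<cdot> i' = d \<cdot> r1 \<longleftrightarrow> i' = i" for i'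
    using i pullback_ext[OF triple, of i' i] by auto
  have j': "j' \<in> Hom C (Dom C r0) (Dom C u) \<and> u \<cdot> j' = d \<cdot> r0 \<and> v \<cdot> j' = \<one> (Dom C r0) \<longleftrightarrow> j' = j" for j'
    using j pullback_ext[OF triple, of j' j] by auto
  have "(\<forall>x\<in>Hom C (Dom C r0) (Dom C u). u \<cdot> x = \<one> (Dom C r0) \<longrightarrow> v \<cdot> x = d \<cdot> r1 \<longrightarrow> \<phi> \<cdot> x = t \<cdot> r0) \<longleftrightarrow> \<phi> \<cdot> i = t \<cdot> r0"
    using i' by metis
  moreover have "(\<forall>x\<in>Hom C (Dom C r0) (Dom C u). u \<cdot> x = d \<cdot> r0 \<longrightarrow> v \<cdot> x = \<one> (Dom C r0) \<longrightarrow> \<phi> \<cdot> x = t \<cdot> r1) \<longleftrightarrow> \<phi> \<cdot> j = t \<cdot> r1"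
    using j' by metis
  ultimately show ?thesis
    unfolding is_connecting_cocone_def refl_mor_eq[OF d] pair_simps(3) by metis
qed

text \<open>\<open>smith_commutator\<close> selects a colimit by choice, so existence has to be
  secured. The diagram amounts to one parallel pair from \<open>R + R\<close> to
  \<open>P + X\<close>, whose coequalizer is taken.\<close>

lemma ex_connecting_colimit: "\<exists>t. is_connecting_colimit C r0 r1 r0 r1 t"
proof -
  obtain d i j where d: "d \<in> Ar C" "Dom C d = X" "Cod C d = Dom C r0" "r0 \<cdot> d = \<one> X" "r1 \<cdot> d = \<one> X"
    and i: "i \<in> Ar C" "Dom C i = Dom C r0" "Cod C i = Dom C u" "u \<cdot> i = \<one> (Dom C r0)" "v \<cdot> i = d \<cdot> r1"
    and j: "j \<in> Ar C" "Dom C j = Dom C r0" "Cod C j = Dom C u" "u \<cdot> j = d \<cdot> r0" "v \<cdot> j = \<one> (Dom C r0)"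
    and ji: "jointly_strong j i" by (rule sections)
  define P R where "P = Dom C u" "R = Dom C r0"
  have [simp]: "P \<in> Ob C" "R \<in> Ob C" "Dom C u = P" "Dom C r0 = R" unfolding P_R_def by auto
  note [simp] = i(1-3) j(1-3)
  obtain q where q: "is_coequalizer C (in1 P X \<cdot> i \<triangledown> in1 P X \<cdot> j) (in2 P X \<cdot> r0 \<triangledown> in2 P X \<cdot> r1) q"
    by (rule ex_coequalizer[of "in1 P X \<cdot> i \<triangledown> in1 P X \<cdot> j" "in2 P X \<cdot> r0 \<triangledown> in2 P X \<cdot> r1"]) auto
  have qD [simp]: "q \<in> Ar C" "Dom C q = P \<uplus> X" using coequalizerD(3,6)[OF q] by auto
  have "(q \<cdot> (in1 P X \<cdot> i \<triangledown> in1 P X \<cdot> j)) \<cdot> in1 R R = (q \<cdot> (in2 P X \<cdot> r0 \<triangledown> in2 P X \<cdot> r1)) \<cdot> in1 R R"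
    "(q \<cdot> (in1 P X \<cdot> i \<triangledown> in1 P X \<cdot> j)) \<cdot> in2 R R = (q \<cdot> (in2 P X \<cdot> r0 \<triangledown> in2 P X \<cdot> r1)) \<cdot> in2 R R"
    using coequalizerD(7)[OF q] by simp_all
  then have qi: "(q \<cdot> in1 P X) \<cdot> i = (q \<cdot> in2 P X) \<cdot> r0" "(q \<cdot> in1 P X) \<cdot> j = (q \<cdot> in2 P X) \<cdot> r1"
    by simp_all
  have "is_connecting_colimit C r0 r1 r0 r1 (q \<cdot> in2 P X)"
    unfolding is_connecting_colimit_def
  proof (intro exI conjI allI impI)
    show "is_pullback C r1 r0 u v" by (rule triple)
    show "is_connecting_cocone C r0 r1 r0 r1 u v (q \<cdot> in1 P X) (q \<cdot> in2 P X)"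
      unfolding connecting_cocone_iff[OF d i j] using qi by simp
    fix \<phi>' t' assume "is_connecting_cocone C r0 r1 r0 r1 u v \<phi>' t'"
    then have c: "\<phi>' \<in> Ar C" "Dom C \<phi>' = P" "Cod C \<phi>' = Cod C t'" "t' \<in> Ar C" "Dom C t' = X"
      "\<phi>' \<cdot> i = t' \<cdot> r0" "\<phi>' \<cdot> j = t' \<cdot> r1"
      unfolding connecting_cocone_iff[OF d i j] by auto
    obtain h where h: "h \<in> Ar C" "Dom C h = Cod C q" "Cod C h = Cod C t'" "h \<cdot> q = \<phi>' \<triangledown> t'"
      using coequalizer_factor[OF q, of "\<phi>' \<triangledown> t'"] c by auto
    show "\<exists>!h. h \<in> Hom C (Cod C (q \<cdot> in2 P X)) (Cod C t') \<and> h \<cdot> q \<cdot> in1 P X = \<phi>' \<and> h \<cdot> q \<cdot> in2 P X = t'"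
    proof (rule ex1I[of _ h])
      show "h \<in> Hom C (Cod C (q \<cdot> in2 P X)) (Cod C t') \<and> h \<cdot> q \<cdot> in1 P X = \<phi>' \<and> h \<cdot> q \<cdot> in2 P X = t'"
        using h c reduce[OF h(4), of "in1 P X"] reduce[OF h(4), of "in2 P X"] by simp
      fix g assume g: "g \<in> Hom C (Cod C (q \<cdot> in2 P X)) (Cod C t') \<and> g \<cdot> q \<cdot> in1 P X = \<phi>' \<and> g \<cdot> q \<cdot> in2 P X = t'"
      then have "g \<cdot> q = \<phi>' \<triangledown> t'"
        using c by (intro coproduct_ext[of "g \<cdot> q" "\<phi>' \<triangledown> t'" P X]) auto
      then show "g = h"
        using g h by (intro epicD[OF coequalizer_epic[OF q], of g h]) auto
    qed
  qed
  then show ?thesis ..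
qed

end

section \<open>Kernel pairs of monomorphisms\<close>

context semi_abelian_category
begin

lemma kernel_pair_is_pullback:
  assumes "f \<in> Ar C"
  shows "is_pullback C f f (fst (kernel_pair C f)) (snd (kernel_pair C f))"
  unfolding kernel_pair_def
proof (rule someI_ex)
  obtain k0 k1 where "is_pullback C f f k0 k1" using ex_pullback[OF assms assms] by blast
  then show "\<exists>k. is_pullback C f f (fst k) (snd k)" by (intro exI[of _ "(k0, k1)"]) simp
qed

text \<open>Vanishing of the commutator thus says that the component \<open>t\<close> of the colimit
  is monic.\<close>

lemma discrete_kernel_pair_iff:
  assumes f [simp]: "f \<in> Ar C"
  shows "discrete_relation C (kernel_pair C f) \<longleftrightarrow> monic C f"
proof -
  obtain k0 k1 where k: "kernel_pair C f = (k0, k1)" by (cases "kernel_pair C f")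
  then have pb: "is_pullback C f f k0 k1" using kernel_pair_is_pullback[OF f] by simp
  note [simp] = pullbackD(1-4,6-8)[OF pb]
  obtain d where d [simp]: "d \<in> Ar C" "Dom C d = Dom C f" "Cod C d = Dom C k0" "k0 \<cdot> d = \<one> (Dom C f)" "k1 \<cdot> d = \<one> (Dom C f)"
    by (rule kernel_pair_diagonal[OF pb])
  show ?thesis unfolding discrete_relation_def k fst_conv snd_conv
  proof
    assume eq: "is_iso C k0 \<and> k1 = k0"
    show "monic C f"
    proof (rule monicI)
      fix x y assume "x \<in> Ar C" "y \<in> Ar C" "Cod C x = Dom C f" "Cod C y = Dom C f" "f \<cdot> x = f \<cdot> y"
      then obtain h where "k0 \<cdot> h = x" "k1 \<cdot> h = y" using pullback_lift[OF pb, of x y] by metis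
      then show "x = y" using eq by simp
    qed simp
  next
    assume m: "monic C f"
    have 1: "k1 = k0" by (rule monicD[OF m]) (use pullbackD(9)[OF pb] in simp_all)
    moreover have "d \<cdot> k0 = \<one> (Dom C k0)"
      by (rule pullback_ext[OF pb]) (simp_all add: 1 reduce[OF d(4)])
    then have "is_iso C k0" by (intro is_isoI[of k0 d]) auto
    ultimately show "is_iso C k0 \<and> k1 = k0" by blast
  qed
qed

end

context extension_triples
begin

text \<open>If \<open>t\<close> is monic, then \<open>\<phi>\<close> factors through it, because it
  does so on the generating sections; the factor is a connector. Conversely, a connector and the
  identity of \<open>X\<close> form a cocone, which splits \<open>t\<close>.\<close>

lemma connecting_colimit_monic_iff:
  assumes cocone: "is_connecting_cocone C r0 r1 r0 r1 u v \<phi> t"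
    and univ: "\<And>\<phi>' t'. is_connecting_cocone C r0 r1 r0 r1 u v \<phi>' t' \<Longrightarrow>
      \<exists>!h. h \<in> Hom C (Cod C t) (Cod C t') \<and> h \<cdot> \<phi> = \<phi>' \<and> h \<cdot> t = t'"
  shows "monic C t \<longleftrightarrow> (\<exists>\<psi>. connector \<psi>)"
proof -
  obtain d i j where d: "d \<in> Ar C" "Dom C d = X" "Cod C d = Dom C r0" "r0 \<cdot> d = \<one> X" "r1 \<cdot> d = \<one> X"
    and i: "i \<in> Ar C" "Dom C i = Dom C r0" "Cod C i = Dom C u" "u \<cdot> i = \<one> (Dom C r0)" "v \<cdot> i = d \<cdot> r1"
    and j: "j \<in> Ar C" "Dom C j = Dom C r0" "Cod C j = Dom C u" "u \<cdot> j = d \<cdot> r0" "v \<cdot> j = \<one> (Dom C r0)"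
    and ji: "jointly_strong j i" by (rule sections)
  have c [simp]: "\<phi> \<in> Ar C" "Dom C \<phi> = Dom C u" "Cod C \<phi> = Cod C t" "t \<in> Ar C" "Dom C t = X"
    "\<phi> \<cdot> i = t \<cdot> r0" "\<phi> \<cdot> j = t \<cdot> r1"
    using cocone unfolding connecting_cocone_iff[OF d i j] by auto
  note [simp] = d i j reduce[OF d(4)] reduce[OF d(5)] reduce[OF c(6)] reduce[OF c(7)]
  show ?thesis
  proof
    assume m: "monic C t"
    obtain \<psi> where \<psi> [simp]: "\<psi> \<in> Ar C" "Dom C \<psi> = Dom C u" "Cod C \<psi> = X" "t \<cdot> \<psi> = \<phi>"
      by (rule jointly_strong_factor[OF ji m, of \<phi> r1 r0]) (simp_all, blast?)
    note [simp] = reduce[OF \<psi>(4)]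
    have "\<psi> \<cdot> i = r0" "\<psi> \<cdot> j = r1" by (rule monicD[OF m]; simp)+
    then show "\<exists>\<psi>. connector \<psi>" using connectorI[OF d i j \<psi>(1-3)] by blast
  next
    assume "\<exists>\<psi>. connector \<psi>"
    then obtain \<psi> where \<psi>: "connector \<psi>" by blast
    note [simp] = connectorD(1-3)[OF \<psi>]
    have "\<psi> \<cdot> i = r0 \<cdot> u \<cdot> i" by (rule connectorD(5)[OF \<psi>]) auto
    moreover have "\<psi> \<cdot> j = r1 \<cdot> v \<cdot> j" by (rule connectorD(4)[OF \<psi>]) auto
    ultimately have "is_connecting_cocone C r0 r1 r0 r1 u v \<psi> (\<one> X)"
      unfolding connecting_cocone_iff[OF d i j] by simp
    from univ[OF this] obtain h where h: "h \<in> Ar C" "Dom C h = Cod C t" "h \<cdot> t = \<one> X" by auto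
    then show "monic C t" by (intro split_monic[of t h X]) auto
  qed
qed

text \<open>Compatibility with \<open>p\<close> holds on the generating sections, hence everywhere;
  it lets a connector be read as an arrow of the slice.\<close>

lemma connector_over:
  assumes "connector \<phi>"
  shows "p \<cdot> \<phi> = p \<cdot> r0 \<cdot> u"
proof -
  note [simp] = connectorD(1-3)[OF assms]
  obtain d i j where d [simp]: "d \<in> Ar C" "Dom C d = X" "Cod C d = Dom C r0" "r0 \<cdot> d = \<one> X" "r1 \<cdot> d = \<one> X"
    and i [simp]: "i \<in> Ar C" "Dom C i = Dom C r0" "Cod C i = Dom C u" "u \<cdot> i = \<one> (Dom C r0)" "v \<cdot> i = d \<cdot> r1"
    and j [simp]: "j \<in> Ar C" "Dom C j = Dom C r0" "Cod C j = Dom C u" "u \<cdot> j = d \<cdot> r0" "v \<cdot> j = \<one> (Dom C r0)"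
    and ji: "jointly_strong j i" by (rule sections)
  note [simp] = reduce[OF d(4)] reduce[OF d(5)]
  have [simp]: "\<phi> \<cdot> i = r0 \<cdot> u \<cdot> i" by (rule connectorD(5)[OF assms]) auto
  have [simp]: "\<phi> \<cdot> j = r1 \<cdot> v \<cdot> j" by (rule connectorD(4)[OF assms]) auto
  show ?thesis by (rule jointly_strong_epic[OF ji]) auto
qed

end

section \<open>Mal'tsev operations in slices\<close>

lemma (in category) slice_hom_iff:
  "F \<in> Hom (slice C G) p q \<longleftrightarrow> (\<exists>f. F = (p, q, f) \<and> p \<in> Ar C \<and> q \<in> Ar C \<and> Cod C p = G \<and> Cod C q = G \<and>
    f \<in> Ar C \<and> Dom C f = Dom C p \<and> Cod C f = Dom C q \<and> q \<cdot> f = p)"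
  by (cases F) (auto simp: Hom_def slice_def)

text \<open>The identities are stated for the projections, which form the universal pair; composing
  with \<open>\<langle>F, H\<rangle>\<close> transfers them to any other.\<close>

lemma (in product_category) maltsev_apply:
  assumes m: "maltsev_operation C X m" and X: "X \<in> Ob C"
    and F: "\<guillemotleft>F : T \<rightarrow> X\<guillemotright>" and H: "\<guillemotleft>H : T \<rightarrow> X\<guillemotright>"
  shows "m \<cdot> \<langle>\<langle>F, H\<rangle>, H\<rangle> = F" "m \<cdot> \<langle>\<langle>F, F\<rangle>, H\<rangle> = H"
proof -
  have mD: "m \<in> Ar C" "Dom C m = X \<otimes> X \<otimes> X" "Cod C m = X"
    and 1: "m \<cdot> \<langle>\<langle>pr1 X X, pr2 X X\<rangle>, pr2 X X\<rangle> = pr1 X X" and 2: "m \<cdot> \<langle>\<langle>pr1 X X, pr1 X X\<rangle>, pr2 X X\<rangle> = pr2 X X"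
    using m unfolding maltsev_operation_def by (auto simp: Let_def)
  note [simp] = mD X homD[OF F] homD[OF H]
  show "m \<cdot> \<langle>\<langle>F, H\<rangle>, H\<rangle> = F" "m \<cdot> \<langle>\<langle>F, F\<rangle>, H\<rangle> = H"
    using arg_cong[OF 1, of "\<lambda>h. h \<cdot> \<langle>F, H\<rangle>"] arg_cong[OF 2, of "\<lambda>h. h \<cdot> \<langle>F, H\<rangle>"] by simp_all
qed

context semi_abelian_category
begin

lemma slice_comp: "Comp (slice C G) (q', r, g) (p, q, f) = (p, r, g \<cdot> f)"
  by (simp add: slice_def)

text \<open>Products over \<open>G\<close> are pullbacks, with the common composite to
  \<open>G\<close> as structure morphism.\<close>

lemma slice_product_category: "product_category (slice C G)"
proof -
  interpret S: category "slice C G" by (rule category_slice) unfold_locales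
  show ?thesis
  proof
    fix x y assume "x \<in> Ob (slice C G)" "y \<in> Ob (slice C G)"
    then have xy [simp]: "x \<in> Ar C" "y \<in> Ar C" "Cod C x = G" "Cod C y = G" by (auto simp: slice_def)
    obtain m n where pb: "is_pullback C x y m n" using ex_pullback[of x y] by auto
    note [simp] = pullbackD(3,4,6-8)[OF pb]
    have eq: "y \<cdot> n = x \<cdot> m" using pullbackD(9)[OF pb] by simp
    have D: "Dom (slice C G) (x \<cdot> m, x, m) = x \<cdot> m" by (simp add: slice_def)
    have "is_product (slice C G) x y (x \<cdot> m, x, m) (x \<cdot> m, y, n)"
      unfolding is_product_def D
    proof (intro conjI allI ballI)
      show "(x \<cdot> m, x, m) \<in> Hom (slice C G) (x \<cdot> m) x" "(x \<cdot> m, y, n) \<in> Hom (slice C G) (x \<cdot> m) y"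
        unfolding slice_hom_iff by (simp_all add: eq)
      fix T F H assume "F \<in> Hom (slice C G) T x" "H \<in> Hom (slice C G) T y"
      then obtain f h where F: "F = (T, x, f)" "H = (T, y, h)" and [simp]: "T \<in> Ar C" "Cod C T = G"
        "f \<in> Ar C" "h \<in> Ar C" "Dom C f = Dom C T" "Dom C h = Dom C T" "Cod C f = Dom C x" "Cod C h = Dom C y"
        and fh: "x \<cdot> f = T" "y \<cdot> h = T"
        unfolding slice_hom_iff by blast
      obtain k where k: "k \<in> Ar C" "Dom C k = Dom C T" "Cod C k = Dom C m" "m \<cdot> k = f" "n \<cdot> k = h"
        using pullback_lift[OF pb, of f h] fh by auto
      show "\<exists>!K. K \<in> Hom (slice C G) T (x \<cdot> m) \<and> Comp (slice C G) (x \<cdot> m, x, m) K = F \<and>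
          Comp (slice C G) (x \<cdot> m, y, n) K = H"
      proof (rule ex1I[of _ "(T, x \<cdot> m, k)"])
        show "(T, x \<cdot> m, k) \<in> Hom (slice C G) T (x \<cdot> m) \<and> Comp (slice C G) (x \<cdot> m, x, m) (T, x \<cdot> m, k) = F \<and>
          Comp (slice C G) (x \<cdot> m, y, n) (T, x \<cdot> m, k) = H"
          unfolding slice_hom_iff slice_comp F using k fh by simp
        fix K assume K: "K \<in> Hom (slice C G) T (x \<cdot> m) \<and> Comp (slice C G) (x \<cdot> m, x, m) K = F \<and>
          Comp (slice C G) (x \<cdot> m, y, n) K = H"
        then obtain k' where k': "K = (T, x \<cdot> m, k')" "k' \<in> Ar C" "Dom C k' = Dom C T" "Cod C k' = Dom C m"
          unfolding slice_hom_iff by auto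
        have "m \<cdot> k' = f" "n \<cdot> k' = h" using K unfolding k'(1) F slice_comp by auto
        then have "k' = k" using k k' by (intro pullback_ext[OF pb, of k' k]) auto
        then show "K = (T, x \<cdot> m, k)" using k'(1) by simp
      qed
    qed
    then show "\<exists>p q. is_product (slice C G) x y p q" by blast
  qed
qed

end

context extension_triples
begin

text \<open>The triples, with their morphism to \<open>G\<close>, play the role of the cube of
  \<open>p\<close> in the slice. The two objects are never identified: \<open>pairing\<close> in one
  direction and \<open>triple_lift\<close> in the other carry generalised elements across, and with
  them the operation.\<close>

lemma abelian_extension_iff_connector: "abelian_extension C p \<longleftrightarrow> (\<exists>\<phi>. connector \<phi>)"
proof -
  let ?D = "slice C G"
  interpret S: product_category ?D by (rule slice_product_category)
  have pD: "p \<in> Ob ?D" by (simp add: slice_def)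
  have Hom_eq: "F \<in> Hom ?D x y \<longleftrightarrow> F \<in> Ar ?D \<and> Dom ?D F = x \<and> Cod ?D F = y" for F x y
    by (simp add: Hom_def)
  note slice = slice_hom_iff[where G = G, unfolded Hom_eq]
  show ?thesis
  proof
    assume "abelian_extension C p"
    then obtain m where m: "maltsev_operation ?D p m" unfolding abelian_extension_def by auto
    \<comment> \<open>The structure morphism of the triples over \<open>G\<close>; the coordinates
      become arrows of the slice at which the operation is evaluated.\<close>
    define P where "P = p \<cdot> r0 \<cdot> u"
    have P [simp]: "P \<in> Ar C" "Dom C P = Dom C u" "Cod C P = G" unfolding P_def by auto
    define X1 X2 X3 where X_def: "X1 = (P, p, r0 \<cdot> u)" "X2 = (P, p, r0 \<cdot> v)" "X3 = (P, p, r1 \<cdot> v)"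
    have X: "X1 \<in> Hom ?D P p" "X2 \<in> Hom ?D P p" "X3 \<in> Hom ?D P p"
      unfolding slice_hom_iff X_def by (simp_all add: P_def)
    note XD [simp] = S.homD[OF X(1)] S.homD[OF X(2)] S.homD[OF X(3)]
    have m' [simp]: "m \<in> Ar ?D" "Dom ?D m = prod_obj ?D (prod_obj ?D p p) p" "Cod ?D m = p"
      using m unfolding maltsev_operation_def by auto
    define M where "M = Comp ?D m (pairing ?D (pairing ?D X1 X2) X3)"
    have "M \<in> Hom ?D P p" unfolding M_def by simp
    then obtain \<phi> where M: "M = (P, p, \<phi>)" and \<phi>: "\<phi> \<in> Ar C" "Dom C \<phi> = Dom C u" "Cod C \<phi> = X"
      unfolding slice_hom_iff by auto
    have Mt: "M \<in> Ar ?D" "Comp ?D M K = Comp ?D m (pairing ?D (pairing ?D (Comp ?D X1 K) (Comp ?D X2 K)) (Comp ?D X3 K))"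
      if "K \<in> Hom ?D T P" for K T
      using S.homD[OF that] unfolding M_def by simp_all
    have "connector \<phi>"
      unfolding connector_def
    proof (intro conjI allI impI)
      fix t assume t: "t \<in> Ar C" "Cod C t = Dom C u"
      define T where "T = P \<cdot> t"
      define K where "K = (T, P, t)"
      have K: "K \<in> Hom ?D T P" unfolding slice_hom_iff K_def T_def using t by simp
      have X1K: "Comp ?D X1 K = (T, p, r0 \<cdot> u \<cdot> t)" and X2K: "Comp ?D X2 K = (T, p, r0 \<cdot> v \<cdot> t)"
        and X3K: "Comp ?D X3 K = (T, p, r1 \<cdot> v \<cdot> t)" and MK: "Comp ?D M K = (T, p, \<phi> \<cdot> t)"
        unfolding X_def K_def M slice_comp using t by simp_all
      have H: "Comp ?D X1 K \<in> Hom ?D T p" "Comp ?D X2 K \<in> Hom ?D T p" "Comp ?D X3 K \<in> Hom ?D T p"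
        using S.comp_in_Hom[OF K] X by blast+
      {
        assume "r0 \<cdot> u \<cdot> t = r0 \<cdot> v \<cdot> t"
        then have "Comp ?D M K = Comp ?D X3 K"
          unfolding Mt(2)[OF K] using S.maltsev_apply(2)[OF m pD H(1) H(3)] by (simp only: X1K X2K)
        then show "\<phi> \<cdot> t = r1 \<cdot> v \<cdot> t" unfolding MK X3K by simp
      next
        assume "r0 \<cdot> v \<cdot> t = r1 \<cdot> v \<cdot> t"
        then have "Comp ?D M K = Comp ?D X1 K"
          unfolding Mt(2)[OF K] using S.maltsev_apply(1)[OF m pD H(1) H(3)] by (simp only: X3K X2K)
        then show "\<phi> \<cdot> t = r0 \<cdot> u \<cdot> t" unfolding MK X1K by simp
      }
    qed (use \<phi> in auto)
    then show "\<exists>\<phi>. connector \<phi>" ..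
  next
    assume "\<exists>\<phi>. connector \<phi>"
    then obtain \<phi> where \<phi>: "connector \<phi>" by blast
    note [simp] = connectorD(1-3)[OF \<phi>]
    let ?Q = "prod_obj ?D p p" and ?Q3 = "prod_obj ?D (prod_obj ?D p p) p"
    let ?x = "proj1 ?D p p" and ?y = "proj2 ?D p p"
    let ?F1 = "Comp ?D ?x (proj1 ?D ?Q p)" and ?F2 = "Comp ?D ?y (proj1 ?D ?Q p)" and ?F3 = "proj2 ?D ?Q p"
    have Q: "?Q \<in> Ob ?D" using pD by simp
    have F: "?F1 \<in> Hom ?D ?Q3 p" "?F2 \<in> Hom ?D ?Q3 p" "?F3 \<in> Hom ?D ?Q3 p"
      using pD Q by simp_all
    obtain f1 f2 f3 where F_eq: "?F1 = (?Q3, p, f1)" "?F2 = (?Q3, p, f2)" "?F3 = (?Q3, p, f3)"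
      and f [simp]: "f1 \<in> Ar C" "f2 \<in> Ar C" "f3 \<in> Ar C" "Dom C f1 = Dom C ?Q3" "Dom C f2 = Dom C ?Q3" "Dom C f3 = Dom C ?Q3"
        "Cod C f1 = X" "Cod C f2 = X" "Cod C f3 = X" "p \<cdot> f1 = ?Q3" "p \<cdot> f2 = ?Q3" "p \<cdot> f3 = ?Q3"
        "?Q3 \<in> Ar C" "Cod C ?Q3 = G"
      using F unfolding slice_hom_iff by (metis homD(2) p)
    \<comment> \<open>The generic element of the cube of \<open>p\<close>, read as a triple.\<close>
    obtain t where t: "t \<in> Ar C" "Dom C t = Dom C f1" "Cod C t = Dom C u"
      "r0 \<cdot> u \<cdot> t = f1" "r0 \<cdot> v \<cdot> t = f2" "r1 \<cdot> v \<cdot> t = f3"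
      by (rule triple_lift[of f1 f2 f3]) (simp_all, blast?)
    have tw [simp]: "r0 \<cdot> u \<cdot> t \<cdot> w = f1 \<cdot> w" "r0 \<cdot> v \<cdot> t \<cdot> w = f2 \<cdot> w" "r1 \<cdot> v \<cdot> t \<cdot> w = f3 \<cdot> w"
      if "w \<in> Ar C" "Cod C w = Dom C ?Q3" for w
      using that t(1-3) arg_cong[OF t(4), of "\<lambda>h. h \<cdot> w"] arg_cong[OF t(5), of "\<lambda>h. h \<cdot> w"]
        arg_cong[OF t(6), of "\<lambda>h. h \<cdot> w"] by simp_all
    note [simp] = t
    define m where "m = (?Q3, p, \<phi> \<cdot> t)"
    have m: "m \<in> Hom ?D ?Q3 p"
      unfolding m_def slice_hom_iff using reduce[OF connector_over[OF \<phi>], of t] by simp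
    have law: "Comp ?D m W = Comp ?D ?F1 W" if h: "W \<in> Hom ?D T ?Q3" "Comp ?D ?F2 W = Comp ?D ?F3 W" for W T
    proof -
      obtain w where W: "W = (T, ?Q3, w)" and w [simp]: "w \<in> Ar C" "Cod C w = Dom C ?Q3"
        using h(1) unfolding slice_hom_iff by blast
      have "f2 \<cdot> w = f3 \<cdot> w" using h(2) unfolding F_eq W slice_comp by simp
      then have "\<phi> \<cdot> t \<cdot> w = r0 \<cdot> u \<cdot> t \<cdot> w"
        by (intro connectorD(5)[OF \<phi>, of "t \<cdot> w"]) simp_all
      then show ?thesis unfolding F_eq W slice_comp m_def by simp
    qed
    have law': "Comp ?D m W = Comp ?D ?F3 W" if h: "W \<in> Hom ?D T ?Q3" "Comp ?D ?F1 W = Comp ?D ?F2 W" for W T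
    proof -
      obtain w where W: "W = (T, ?Q3, w)" and w [simp]: "w \<in> Ar C" "Cod C w = Dom C ?Q3"
        using h(1) unfolding slice_hom_iff by blast
      have "f1 \<cdot> w = f2 \<cdot> w" using h(2) unfolding F_eq W slice_comp by simp
      then have "\<phi> \<cdot> t \<cdot> w = r1 \<cdot> v \<cdot> t \<cdot> w"
        by (intro connectorD(4)[OF \<phi>, of "t \<cdot> w"]) simp_all
      then show ?thesis unfolding F_eq W slice_comp m_def by simp
    qed
    let ?W1 = "pairing ?D (pairing ?D ?x ?y) ?y" and ?W2 = "pairing ?D (pairing ?D ?x ?x) ?y"
    have W: "?W1 \<in> Hom ?D ?Q ?Q3" "?W2 \<in> Hom ?D ?Q ?Q3" using pD by simp_all
    have FW: "Comp ?D ?F1 ?W1 = ?x" "Comp ?D ?F2 ?W1 = ?y" "Comp ?D ?F3 ?W1 = ?y"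
      "Comp ?D ?F1 ?W2 = ?x" "Comp ?D ?F2 ?W2 = ?x" "Comp ?D ?F3 ?W2 = ?y" using pD Q by simp_all
    have "maltsev_operation ?D p m"
      unfolding maltsev_operation_def Let_def
      using m law[OF W(1)] law'[OF W(2)] by (simp only: FW simp_thms)
    then show "abelian_extension C p"
      unfolding abelian_extension_def ap_simps using regular_epi_p by blast
  qed
qed

end

section \<open>Assembling the equivalences\<close>

context extension
begin

lemma ex_triples:
  obtains r0 r1 u v where "extension_triples C A X G a p r0 r1 u v"
proof -
  obtain r0 r1 where pair: "is_pullback C p p r0 r1" using ex_pullback[of p p] by auto
  obtain u v where "is_pullback C r1 r0 u v" using ex_pullback[of r1 r0] pullbackD[OF pair] by auto
  with pair show thesis by (intro that) (unfold_locales)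
qed

lemma smith_commutator_discrete_iff:
  "discrete_relation C (smith_commutator C (kernel_pair C p) (kernel_pair C p)) \<longleftrightarrow> abelian_extension C p"
proof -
  define r0 r1 where r: "r0 = fst (kernel_pair C p)" "r1 = snd (kernel_pair C p)"
  define t where "t = (SOME t. is_connecting_colimit C r0 r1 r0 r1 t)"
  have pair: "is_pullback C p p r0 r1" unfolding r by (rule kernel_pair_is_pullback) simp
  \<comment> \<open>An auxiliary object of triples, from which existence of the colimit follows. The
    colimit selected by choice comes with its own \<open>u\<close> and \<open>v\<close>, hence the
    second interpretation below.\<close>
  obtain u' v' where uv': "is_pullback C r1 r0 u' v'" using ex_pullback[of r1 r0] pullbackD[OF pair] by auto
  interpret T': extension_triples C A X G a p r0 r1 u' v' by unfold_locales (rule pair, rule uv')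
  have "is_connecting_colimit C r0 r1 r0 r1 t" unfolding t_def
    by (rule someI_ex) (rule T'.ex_connecting_colimit)
  then obtain u v \<phi> where uv: "is_pullback C r1 r0 u v" and
    cocone: "is_connecting_cocone C r0 r1 r0 r1 u v \<phi> t" and
    univ: "\<And>\<phi>' t'. is_connecting_cocone C r0 r1 r0 r1 u v \<phi>' t' \<Longrightarrow>
      \<exists>!h. h \<in> Hom C (Cod C t) (Cod C t') \<and> h \<cdot> \<phi> = \<phi>' \<and> h \<cdot> t = t'"
    unfolding is_connecting_colimit_def by blast
  interpret T: extension_triples C A X G a p r0 r1 u v by unfold_locales (rule pair, rule uv)
  have t: "t \<in> Ar C" using cocone unfolding is_connecting_cocone_def by auto
  have "smith_commutator C (kernel_pair C p) (kernel_pair C p) = kernel_pair C t"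
    unfolding smith_commutator_def t_def r ..
  then show ?thesis
    using discrete_kernel_pair_iff[OF t] T.connecting_colimit_monic_iff[OF cocone univ]
      T.abelian_extension_iff_connector by simp
qed

lemma action_core_if_abelian_extension:
  assumes "abelian_extension C p"
  shows "\<exists>\<psi>. is_action_core C G A \<psi> \<and> core = \<psi> \<cdot> cosmash_mor C (\<one> A) p"
proof -
  obtain r0 r1 u v where "extension_triples C A X G a p r0 r1 u v" by (rule ex_triples)
  then interpret T: extension_triples C A X G a p r0 r1 u v .
  show ?thesis using assms T.abelian_extension_iff_connector T.action_if_connector by blast
qed

lemma abelian_extension_if_core21_zero:
  assumes "conj_core21 C a = \<zero> (cosmash3 C A A X) A" "abelian_object C A"
  shows "abelian_extension C p"
proof -
  obtain r0 r1 u v where "extension_triples C A X G a p r0 r1 u v" by (rule ex_triples)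
  then interpret T: extension_triples C A X G a p r0 r1 u v .
  show ?thesis using T.abelian_extension_iff_connector T.connector_if_core21_zero[OF assms] by blast
qed

lemma action_core_hom:
  assumes "is_action_core C G A \<psi>"
  shows "\<guillemotleft>\<psi> : cosmash C A G \<rightarrow> A\<guillemotright>"
  using assms unfolding is_action_core_def action_core_def is_action_def cosmash_in_T_def[symmetric] by auto

text \<open>The morphism \<open>cosmash_mor C (\<one> A) p\<close> is a regular epimorphism, so it
  can be cancelled on the right.\<close>

lemma action_core_unique:
  assumes "is_action_core C G A \<psi>" "core = \<psi> \<cdot> cosmash_mor C (\<one> A) p"
    and "is_action_core C G A \<psi>'" "core = \<psi>' \<cdot> cosmash_mor C (\<one> A) p"
  shows "\<psi> = \<psi>'"
  using action_core_hom[OF assms(1)] action_core_hom[OF assms(3)] assms(2,4)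
  by (intro epicD[OF regular_epi_epic[OF cosmash_mor_regular_epi[OF ap_simps(4) regular_epi_p]], of \<psi> \<psi>']) auto

end

theorem theorem10p3:
  fixes C :: "('o, 'm) cat" and A X G :: 'o and a p :: 'm
  assumes "semi_abelian C"
    and "a \<in> Hom C A X" and "p \<in> Hom C X G"
    and "short_exact C a p"
    and "abelian_object C A"
  shows "(abelian_extension C p
            \<longleftrightarrow> discrete_relation C (smith_commutator C (kernel_pair C p) (kernel_pair C p))) \<and>
    (abelian_extension C p
            \<longleftrightarrow> zero_subobject C (commutator3 C a a (Ide C X))) \<and>
    (abelian_extension C p
            \<longleftrightarrow> conj_core21 C a = zero_mor C (cosmash3 C A A X) A) \<and>
    (abelian_extension C p
            \<longleftrightarrow> (\<exists>\<psi>. is_action_core C G A \<psi> \<and>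
                    conj_core C a = \<psi> \<cdot>\<^bsub>C\<^esub> cosmash_mor C (Ide C A) p)) \<and>
    (abelian_extension C p
            \<longleftrightarrow> (\<exists>\<psi> \<in> Hom C (cosmash C A G) A.
                    conj_core C a = \<psi> \<cdot>\<^bsub>C\<^esub> cosmash_mor C (Ide C A) p)) \<and>
    (\<forall>\<psi> \<psi>'. is_action_core C G A \<psi> \<longrightarrow> conj_core C a = \<psi> \<cdot>\<^bsub>C\<^esub> cosmash_mor C (Ide C A) p \<longrightarrow>
      is_action_core C G A \<psi>' \<longrightarrow> conj_core C a = \<psi>' \<cdot>\<^bsub>C\<^esub> cosmash_mor C (Ide C A) p \<longrightarrow> \<psi> = \<psi>')"
proof -
  have "category C" using assms(1) unfolding semi_abelian_def by simp
  then interpret extension C A X G a p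
    using assms by (intro extension.intro semi_abelian_category.intro semi_abelian_category_axioms.intro
      extension_axioms.intro)
  let ?i = "abelian_extension C p" and ?iv = "conj_core21 C a = zero_mor C (cosmash3 C A A X) A"
    and ?v = "\<exists>\<psi>. is_action_core C G A \<psi> \<and> conj_core C a = \<psi> \<cdot>\<^bsub>C\<^esub> cosmash_mor C (Ide C A) p"
    and ?vi = "\<exists>\<psi> \<in> Hom C (cosmash C A G) A. conj_core C a = \<psi> \<cdot>\<^bsub>C\<^esub> cosmash_mor C (Ide C A) p"
  \<comment> \<open>The cycle (i), (v), (vi), (iv), (i); abelianness of \<open>A\<close> is invoked
    on its last edge.\<close>
  have "?i \<Longrightarrow> ?v" by (rule action_core_if_abelian_extension)
  moreover have "?v \<Longrightarrow> ?vi" using action_core_hom by blast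
  moreover have "?vi \<Longrightarrow> ?iv" using core21_zero_if_factors by blast
  moreover have "?iv \<Longrightarrow> ?i" using abelian_extension_if_core21_zero assms(5) by blast
  ultimately have "?i \<longleftrightarrow> ?iv" "?i \<longleftrightarrow> ?v" "?i \<longleftrightarrow> ?vi" by blast+
  then show ?thesis
    using smith_commutator_discrete_iff commutator3_zero_iff action_core_unique by blast
qed

end
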